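(* Let $\mathcal{K}$ be the Koopman operator of a measure-preserving dynamical system on $L^2(\Omega,\omega)$, and for each $N$ let $V_N$ be the span of a dictionary of $N$ functions, with mpEDMD matrices $\mathbb{K}=\mathbb{K}_{N,M}$ computed from $M$ snapshots (see context). Suppose that $\lim_{N\rightarrow\infty}\mathrm{dist}(h,V_{N})=0$ for all $h\in L^2(\Omega,\omega)$ and that, for each fixed $N$, the quadrature converges, i.e. $\lim_{M\to\infty}G_{jk}=\langle\psi_k,\psi_j\rangle$ and $\lim_{M\to\infty}A_{jk}=\langle\mathcal{K}\psi_k,\psi_j\rangle$ for $1\le j,k\le N$. Then for any $g\in L^2(\Omega,\omega)$ with $\|g\|=1$ and $\pmb{g}_N\in\mathbb{C}^N$ with $\lim_{N\rightarrow\infty}\|g-\Psi \pmb{g}_N\|=0$, $$ \lim_{N\rightarrow\infty}\limsup_{M\rightarrow\infty}W_1\left(\mu_g,\mu_{\tilde{\pmb{g}}_{N,M}}^{(N,M)}\right)=0,\qquad \tilde{\pmb{g}}_{N,M}=\frac{\pmb{g}_N}{(\pmb{g}_N^*G\pmb{g}_N)^{1/2}} $$ (where $N$ is taken large enough that $\pmb{g}_N\neq0$).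
   Context: Setting. $\Omega\subseteq\mathbb{R}^d$, $\omega$ is a positive measure on $\Omega$, and $F:\Omega\to\Omega$ is measurable and preserves $\omega$. The Koopman operator $\mathcal{K}g=g\circ F$ is an isometry on $L^2(\Omega,\omega)$, whose inner product (linear in the first argument) and norm are $\langle\cdot,\cdot\rangle$ and $\|\cdot\|$. $\mathbb{T}$ is the unit circle in $\mathbb{C}$. Spectral measures of $\mathcal{K}$. There is a unitary operator $\mathcal{K}'$ on a Hilbert space $\mathcal{H}'\supseteq L^2(\Omega,\omega)$ (closed subspace) with $\mathcal{K}'|_{L^2(\Omega,\omega)}=\mathcal{K}$. Let $\mathcal{E}'$ be the projection-valued spectral measure of $\mathcal{K}'$ on $\mathbb{T}$ and $\mathcal{P}:\mathcal{H}'\to L^2(\Omega,\omega)$ the orthogonal projection. The spectral measure of $\mathcal{K}$ is $\mathcal{E}(U)=\mathcal{P}\mathcal{E}'(U)\mathcal{P}^*$, $U\subset\mathbb{T}$ Borel; it does not depend on the choice of unitary extension. For $g\in L^2(\Omega,\omega)$ with $\|g\|=1$, $\mu_g$ is the Borel probability measure on $\mathbb{T}$ given by $\mu_g(U)=\langle\mathcal{E}(U)g,g\rangle$. mpEDMD. For each $N$ there is a dictionary $\psi_1,\dots,\psi_N\in L^2(\Omega,\omega)$ (possibly depending on $N$), linearly independent, with span $V_N$. Write $\Psi(\pmb{x})=[\psi_1(\pmb{x})\ \cdots\ \psi_N(\pmb{x})]$, and for $\pmb{c}\in\mathbb{C}^N$, $\Psi\pmb{c}=\sum_j c_j\psi_j\in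 V_N$. For each $M$ the data are points $\pmb{x}^{(m)}\in\Omega$, $\pmb{y}^{(m)}=F(\pmb{x}^{(m)})$, $m=1,\dots,M$, with quadrature weights $w_m\ge 0$ (points and weights may depend on $M$); $W=\mathrm{diag}(w_1,\dots,w_M)$. $\Psi_X,\Psi_Y\in\mathbb{C}^{M\times N}$ are the matrices whose $m$th rows are $\Psi(\pmb{x}^{(m)})$ and $\Psi(\pmb{y}^{(m)})$. Put $G=\Psi_X^*W\Psi_X$ and $A=\Psi_X^*W\Psi_Y$ (both depend on $N,M$); $G$ is assumed invertible. Take any singular value decomposition $G^{-1/2}A^*G^{-1/2}=U_1\Sigma U_2^*$ with $U_1,U_2$ unitary, and set $\mathbb{K}=G^{-1/2}U_2U_1^*G^{1/2}$. Take an eigendecomposition $U_2U_1^*=\hat V\Lambda\hat V^*$ with $\hat V$ unitary and $\Lambda=\mathrm{diag}(\lambda_1,\dots,\lambda_N)$, and let $v_j$ be the $j$th column of $V=G^{-1/2}\hat V$, so that $\mathbb{K}v_j=\lambda_jv_j$. For $\pmb{g}\in\mathbb{C}^N$ with $\pmb{g}^*G\pmb{g}=1$, $\mu_{\pmb{g}}^{(N,M)}$ is the probability measure on $\mathbb{T}$ given by $\mu_{\pmb{g}}^{(N,M)}(U)=\sum_{\lambda_j\in U}|v_j^*G\pmb{g}|^2$. Wasserstein distance. For Borel probability measures $\mu,\nu$ on $\mathbb{T}$, $W_1(\mu,\nu)=\sup\{\int_{\mathbb{T}}\phi\,d(\mu-\nu):\phi:\mathbb{T}\to\mathbb{R}\text{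 Lipschitz with constant}\le1\}$, the Lipschitz constant being with respect to $|\lambda-\lambda'|$. $\mathrm{dist}(h,V_N)=\inf_{f\in V_N}\|h-f\|$. *)

theory Defs
  imports
    "HOL-Analysis.Analysis"
    "Jordan_Normal_Form.Schur_Decomposition"
begin

section \<open>The space of square-integrable functions and the Koopman operator\<close>

text \<open>Elements of $L^2$ are represented by functions; equality in $L^2$ is equality almost
  everywhere. The dictionary is evaluated at points, so functions are needed there anyway.\<close>

definition L2 :: "'p measure \<Rightarrow> ('p \<Rightarrow> complex) set" where
  "L2 \<omega> = {f \<in> borel_measurable \<omega>. integrable \<omega> (\<lambda>p. (cmod (f p))\<^sup>2)}"

definition L2_inner :: "'p measure \<Rightarrow> ('p \<Rightarrow> complex) \<Rightarrow> ('p \<Rightarrow> complex) \<Rightarrow> complex" where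
  "L2_inner \<omega> f g = (LINT p|\<omega>. f p * cnj (g p))"

definition L2_norm :: "'p measure \<Rightarrow> ('p \<Rightarrow> complex) \<Rightarrow> real" where
  "L2_norm \<omega> f = sqrt (LINT p|\<omega>. (cmod (f p))\<^sup>2)"

definition L2_dist :: "'p measure \<Rightarrow> ('p \<Rightarrow> complex) \<Rightarrow> ('p \<Rightarrow> complex) set \<Rightarrow> real" where
  "L2_dist \<omega> h V = (INF f\<in>V. L2_norm \<omega> (\<lambda>p. h p - f p))"

definition measure_preserving_map :: "'p measure \<Rightarrow> ('p \<Rightarrow> 'p) \<Rightarrow> bool" where
  "measure_preserving_map \<omega> F \<longleftrightarrow> F \<in> measurable \<omega> \<omega> \<and> distr \<omega> \<omega> F = \<omega>"

definition koopman :: "('p \<Rightarrow> 'p) \<Rightarrow> ('p \<Rightarrow> complex) \<Rightarrow> ('p \<Rightarrow> complex)" where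
  "koopman F g = g \<circ> F"

section \<open>Complex Hilbert spaces and projection-valued measures\<close>

text \<open>The inner product is linear in its first argument.\<close>

class complex_hilbert = banach +
  fixes scaleC :: "complex \<Rightarrow> 'a \<Rightarrow> 'a"
    and cinner :: "'a \<Rightarrow> 'a \<Rightarrow> complex"
  assumes scaleC_add_right: "scaleC c (u + v) = scaleC c u + scaleC c v"
    and scaleC_add_left: "scaleC (c + d) u = scaleC c u + scaleC d u"
    and scaleC_scaleC: "scaleC c (scaleC d u) = scaleC (c * d) u"
    and scaleR_scaleC: "scaleR r u = scaleC (complex_of_real r) u"
    and cinner_commute: "cinner u v = cnj (cinner v u)"
    and cinner_add_left: "cinner (u + v) z = cinner u z + cinner v z"
    and cinner_scaleC_left: "cinner (scaleC c u) z = c * cinner u z"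
    and norm_eq_sqrt_cinner: "norm u = sqrt (Re (cinner u u))"

definition clinear_op :: "('h::complex_hilbert \<Rightarrow> 'h) \<Rightarrow> bool" where
  "clinear_op T \<longleftrightarrow>
     (\<forall>u v. T (u + v) = T u + T v) \<and> (\<forall>c u. T (scaleC c u) = scaleC c (T u))"

definition unitary_op :: "('h::complex_hilbert \<Rightarrow> 'h) \<Rightarrow> bool" where
  "unitary_op T \<longleftrightarrow> clinear_op T \<and> surj T \<and> (\<forall>u v. cinner (T u) (T v) = cinner u v)"

definition projection_op :: "('h::complex_hilbert \<Rightarrow> 'h) \<Rightarrow> bool" where
  "projection_op T \<longleftrightarrow>
     clinear_op T \<and> (\<forall>u. T (T u) = T u) \<and> (\<forall>u v. cinner (T u) v = cinner u (T v))"

text \<open>The orthogonal projection onto a closed subspace.\<close>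

definition orth_proj :: "'h::complex_hilbert set \<Rightarrow> 'h \<Rightarrow> 'h" where
  "orth_proj S u = (THE y. y \<in> S \<and> (\<forall>s\<in>S. cinner (u - y) s = 0))"

abbreviation circle :: "complex set" where
  "circle \<equiv> sphere 0 1"

abbreviation circle_borel :: "complex measure" where
  "circle_borel \<equiv> restrict_space borel circle"

definition projection_valued_measure :: "(complex set \<Rightarrow> 'h::complex_hilbert \<Rightarrow> 'h) \<Rightarrow> bool" where
  "projection_valued_measure E \<longleftrightarrow>
     (\<forall>U\<in>sets circle_borel. projection_op (E U)) \<and>
     E {} = (\<lambda>u. 0) \<and> E circle = (\<lambda>u. u) \<and>
     (\<forall>U\<in>sets circle_borel. \<forall>V\<in>sets circle_borel. \<forall>u. E (U \<inter> V) u = E U (E V u)) \<and>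
     (\<forall>B. range B \<subseteq> sets circle_borel \<longrightarrow> disjoint_family B \<longrightarrow>
        (\<forall>u. (\<lambda>n::nat. E (B n) u) sums E (\<Union>n. B n) u))"

definition scalar_measure :: "(complex set \<Rightarrow> 'h::complex_hilbert \<Rightarrow> 'h) \<Rightarrow> 'h \<Rightarrow> complex measure" where
  "scalar_measure E u =
     measure_of circle (sets circle_borel) (\<lambda>U. ennreal (Re (cinner (E U u) u)))"

text \<open>$T = \int_{\mathbb T} \lambda \, dE(\lambda)$ in the weak sense. The quadratic form determines a
  bounded operator on a complex Hilbert space, so only the measures with equal arguments occur.\<close>

definition spectral_measure_of :: "('h::complex_hilbert \<Rightarrow> 'h) \<Rightarrow> (complex set \<Rightarrow> 'h \<Rightarrow> 'h) \<Rightarrow> bool" where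
  "spectral_measure_of T E \<longleftrightarrow>
     projection_valued_measure E \<and>
     (\<forall>u. cinner (T u) u = (LINT z|scalar_measure E u. z))"

section \<open>Spectral measures of the Koopman operator\<close>

text \<open>\<open>J\<close> is the inclusion of $L^2$ into the larger Hilbert space. Preservation of inner products makes
  \<open>J\<close> depend only on almost-everywhere classes and be injective on them.\<close>

definition L2_embedding :: "'p measure \<Rightarrow> (('p \<Rightarrow> complex) \<Rightarrow> 'h::complex_hilbert) \<Rightarrow> bool" where
  "L2_embedding \<omega> J \<longleftrightarrow>
     (\<forall>f\<in>L2 \<omega>. \<forall>g\<in>L2 \<omega>. J (\<lambda>p. f p + g p) = J f + J g) \<and>
     (\<forall>c. \<forall>f\<in>L2 \<omega>. J (\<lambda>p. c * f p) = scaleC c (J f)) \<and>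
     (\<forall>f\<in>L2 \<omega>. \<forall>g\<in>L2 \<omega>. cinner (J f) (J g) = L2_inner \<omega> f g) \<and>
     closed (J ` L2 \<omega>)"

definition unitary_extension ::
  "'p measure \<Rightarrow> ('p \<Rightarrow> 'p) \<Rightarrow> (('p \<Rightarrow> complex) \<Rightarrow> 'h::complex_hilbert) \<Rightarrow> ('h \<Rightarrow> 'h) \<Rightarrow> bool" where
  "unitary_extension \<omega> F J K' \<longleftrightarrow>
     L2_embedding \<omega> J \<and> unitary_op K' \<and> (\<forall>f\<in>L2 \<omega>. K' (J f) = J (koopman F f))"

text \<open>$\mathcal P \mathcal E'(U) \mathcal P^*$ as an operator on the image of $L^2$ under \<open>J\<close>;
  there $\mathcal P^*$ is the inclusion.\<close>

definition koopman_spectral_measure ::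
  "'p measure \<Rightarrow> (('p \<Rightarrow> complex) \<Rightarrow> 'h::complex_hilbert) \<Rightarrow> (complex set \<Rightarrow> 'h \<Rightarrow> 'h) \<Rightarrow>
   complex set \<Rightarrow> 'h \<Rightarrow> 'h" where
  "koopman_spectral_measure \<omega> J E' U u = orth_proj (J ` L2 \<omega>) (E' U u)"

definition koopman_scalar_measure ::
  "'p measure \<Rightarrow> (('p \<Rightarrow> complex) \<Rightarrow> 'h::complex_hilbert) \<Rightarrow> (complex set \<Rightarrow> 'h \<Rightarrow> 'h) \<Rightarrow>
   ('p \<Rightarrow> complex) \<Rightarrow> complex measure" where
  "koopman_scalar_measure \<omega> J E' g = scalar_measure (koopman_spectral_measure \<omega> J E') (J g)"

section \<open>The matrices of mpEDMD\<close>

text \<open>Dictionary functions and data points are indexed from 0. The arguments \<open>\<psi>\<close>, \<open>x\<close>, \<open>w\<close> below are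
  the dictionary, points and weights for one fixed pair \<open>N\<close>, \<open>M\<close>.\<close>

definition dict_comb :: "nat \<Rightarrow> (nat \<Rightarrow> 'p \<Rightarrow> complex) \<Rightarrow> complex Matrix.vec \<Rightarrow> 'p \<Rightarrow> complex" where
  "dict_comb N \<psi> c p = (\<Sum>j<N. vec_index c j * \<psi> j p)"

definition dict_span :: "nat \<Rightarrow> (nat \<Rightarrow> 'p \<Rightarrow> complex) \<Rightarrow> ('p \<Rightarrow> complex) set" where
  "dict_span N \<psi> = dict_comb N \<psi> ` carrier_vec N"

definition L2_independent :: "'p measure \<Rightarrow> nat \<Rightarrow> (nat \<Rightarrow> 'p \<Rightarrow> complex) \<Rightarrow> bool" where
  "L2_independent \<omega> N \<psi> \<longleftrightarrow>
     (\<forall>c\<in>carrier_vec N. (AE p in \<omega>. dict_comb N \<psi> c p = 0) \<longrightarrow> c = 0\<^sub>v N)"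

definition data_mat :: "nat \<Rightarrow> nat \<Rightarrow> (nat \<Rightarrow> 'p \<Rightarrow> complex) \<Rightarrow> (nat \<Rightarrow> 'p) \<Rightarrow> complex mat" where
  "data_mat N M \<psi> x = Matrix.mat M N (\<lambda>(m, j). \<psi> j (x m))"

definition weight_mat :: "nat \<Rightarrow> (nat \<Rightarrow> real) \<Rightarrow> complex mat" where
  "weight_mat M w = mat_diag M (\<lambda>m. complex_of_real (w m))"

definition edmd_G ::
  "nat \<Rightarrow> nat \<Rightarrow> (nat \<Rightarrow> 'p \<Rightarrow> complex) \<Rightarrow> (nat \<Rightarrow> 'p) \<Rightarrow> (nat \<Rightarrow> real) \<Rightarrow> complex mat" where
  "edmd_G N M \<psi> x w =
     mat_adjoint (data_mat N M \<psi> x) * weight_mat M w * data_mat N M \<psi> x"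

definition edmd_A ::
  "nat \<Rightarrow> nat \<Rightarrow> (nat \<Rightarrow> 'p \<Rightarrow> complex) \<Rightarrow> ('p \<Rightarrow> 'p) \<Rightarrow> (nat \<Rightarrow> 'p) \<Rightarrow> (nat \<Rightarrow> real) \<Rightarrow> complex mat" where
  "edmd_A N M \<psi> F x w =
     mat_adjoint (data_mat N M \<psi> x) * weight_mat M w * data_mat N M \<psi> (F \<circ> x)"

definition psd_mat :: "nat \<Rightarrow> complex mat \<Rightarrow> bool" where
  "psd_mat n B \<longleftrightarrow> B \<in> carrier_mat n n \<and> mat_adjoint B = B \<and>
     (\<forall>v\<in>carrier_vec n. 0 \<le> Re ((B *\<^sub>v v) \<bullet>c v))"

definition unitary_mat :: "nat \<Rightarrow> complex mat \<Rightarrow> bool" where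
  "unitary_mat n U \<longleftrightarrow> U \<in> carrier_mat n n \<and>
     mat_adjoint U * U = 1\<^sub>m n \<and> U * mat_adjoint U = 1\<^sub>m n"

text \<open>\<open>R\<close> is $G^{1/2}$ and \<open>Q\<close> is $G^{-1/2}$.\<close>

definition sqrt_pair :: "nat \<Rightarrow> complex mat \<Rightarrow> complex mat \<Rightarrow> complex mat \<Rightarrow> bool" where
  "sqrt_pair n G R Q \<longleftrightarrow>
     psd_mat n R \<and> R * R = G \<and> Q \<in> carrier_mat n n \<and> R * Q = 1\<^sub>m n \<and> Q * R = 1\<^sub>m n"

definition svd_factors ::
  "nat \<Rightarrow> complex mat \<Rightarrow> complex mat \<Rightarrow> (nat \<Rightarrow> real) \<Rightarrow> complex mat \<Rightarrow> bool" where
  "svd_factors n B U1 \<sigma> U2 \<longleftrightarrow>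
     unitary_mat n U1 \<and> unitary_mat n U2 \<and> (\<forall>i<n. 0 \<le> \<sigma> i) \<and>
     B = U1 * mat_diag n (\<lambda>i. complex_of_real (\<sigma> i)) * mat_adjoint U2"

definition unitary_eigendecomposition ::
  "nat \<Rightarrow> complex mat \<Rightarrow> complex mat \<Rightarrow> (nat \<Rightarrow> complex) \<Rightarrow> bool" where
  "unitary_eigendecomposition n B Vh lam \<longleftrightarrow>
     unitary_mat n Vh \<and> B = Vh * mat_diag n lam * mat_adjoint Vh"

definition mpedmd_factors ::
  "nat \<Rightarrow> complex mat \<Rightarrow> complex mat \<Rightarrow> complex mat \<Rightarrow> complex mat \<Rightarrow> complex mat \<Rightarrow>
   (nat \<Rightarrow> real) \<Rightarrow> complex mat \<Rightarrow> complex mat \<Rightarrow> (nat \<Rightarrow> complex) \<Rightarrow> bool" where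
  "mpedmd_factors n G A R Q U1 \<sigma> U2 Vh lam \<longleftrightarrow>
     sqrt_pair n G R Q \<and>
     svd_factors n (Q * mat_adjoint A * Q) U1 \<sigma> U2 \<and>
     unitary_eigendecomposition n (U2 * mat_adjoint U1) Vh lam"

definition mpedmd_mat :: "complex mat \<Rightarrow> complex mat \<Rightarrow> complex mat \<Rightarrow> complex mat \<Rightarrow> complex mat" where
  "mpedmd_mat R Q U1 U2 = Q * (U2 * mat_adjoint U1) * R"

text \<open>The columns of $V = G^{-1/2} \hat V$ are eigenvectors of the mpEDMD matrix.\<close>

lemma mpedmd_mat_eigenvectors:
  assumes "mpedmd_factors n G A R Q U1 \<sigma> U2 Vh lam"
  shows "mpedmd_mat R Q U1 U2 * (Q * Vh) = (Q * Vh) * mat_diag n lam"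
proof -
  have R: "R \<in> carrier_mat n n" and Q: "Q \<in> carrier_mat n n" and RQ: "R * Q = 1\<^sub>m n"
    and Vh: "Vh \<in> carrier_mat n n" and VhVh: "mat_adjoint Vh * Vh = 1\<^sub>m n"
    and B: "U2 * mat_adjoint U1 = Vh * mat_diag n lam * mat_adjoint Vh"
    using assms
    by (auto simp: mpedmd_factors_def sqrt_pair_def psd_mat_def unitary_eigendecomposition_def
        unitary_mat_def)
  define D where "D = mat_diag n lam"
  define H where "H = mat_adjoint Vh"
  have D: "D \<in> carrier_mat n n" and H: "H \<in> carrier_mat n n"
    using Vh by (auto simp: D_def H_def mat_adjoint_def mat_of_rows_def)
  have "Q * (Vh * D * H) * R * (Q * Vh) = Q * (Vh * D * H) * (R * (Q * Vh))"
    by (rule assoc_mult_mat) (use Q Vh D H R in auto)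
  also have "R * (Q * Vh) = R * Q * Vh"
    by (rule assoc_mult_mat[symmetric]) (use Q Vh R in auto)
  also have "\<dots> = Vh"
    using RQ Vh by simp
  also have "Q * (Vh * D * H) * Vh = Q * (Vh * D * H * Vh)"
    by (rule assoc_mult_mat) (use Q Vh D H in auto)
  also have "Vh * D * H * Vh = Vh * D * (H * Vh)"
    by (rule assoc_mult_mat) (use Q Vh D H in auto)
  also have "\<dots> = Vh * D"
    using VhVh Vh D by (simp add: H_def)
  also have "Q * (Vh * D) = Q * Vh * D"
    by (rule assoc_mult_mat[symmetric]) (use Q Vh D in auto)
  finally show ?thesis
    by (simp add: mpedmd_mat_def B D_def H_def)
qed

text \<open>Here \<open>V\<close> is $G^{-1/2} \hat V$, and $v_j^* G c$ is written \<open>(G *\<^sub>v c) \<bullet>c col V j\<close>.\<close>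

definition mpedmd_measure ::
  "nat \<Rightarrow> complex mat \<Rightarrow> complex mat \<Rightarrow> (nat \<Rightarrow> complex) \<Rightarrow> complex Matrix.vec \<Rightarrow> complex measure" where
  "mpedmd_measure n G V lam c =
     measure_of circle (sets circle_borel)
       (\<lambda>U. ennreal (\<Sum>j | j < n \<and> lam j \<in> U. (cmod ((G *\<^sub>v c) \<bullet>c col V j))\<^sup>2))"

definition G_normalize :: "complex mat \<Rightarrow> complex Matrix.vec \<Rightarrow> complex Matrix.vec" where
  "G_normalize G c = complex_of_real (1 / sqrt (Re ((G *\<^sub>v c) \<bullet>c c))) \<cdot>\<^sub>v c"

section \<open>The Wasserstein distance\<close>

definition W1 :: "complex measure \<Rightarrow> complex measure \<Rightarrow> ereal" where
  "W1 \<mu> \<nu> = (SUP \<phi>\<in>{\<phi> :: complex \<Rightarrow> real. 1-lipschitz_on circle \<phi>}.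
               ereal ((LINT z|\<mu>. \<phi> z) - (LINT z|\<nu>. \<phi> z)))"

end

theory Submission
  imports Defs
begin

text \<open>Embed $L^2$ into the Hilbert space of the unitary extension. On the circle it suffices to compare
  moments: on one side they are \<open>cinner ((K ^^ k) u) u\<close>, on the other \<open>(P ^^ k) v \<bullet>c v\<close> with \<open>P\<close> the
  unitary polar factor of \<open>B = Q * A * Q\<close> and \<open>v = R *\<^sub>v c\<close>. Since \<open>B\<close> tends to a compression of an
  isometry, its singular values are eventually at most \<open>1 + \<delta>\<close>. Hence, for coefficient vectors \<open>a\<close> of \<open>h\<close> and \<open>b\<close> of an
  approximation of \<open>K h\<close> in the dictionary span, the limit superior in \<open>M\<close> of the distance from
  \<open>P *\<^sub>v (R *\<^sub>v a)\<close> to \<open>R *\<^sub>v b\<close> is at most twice the error of that approximation.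
  Iterating \<open>k\<close> times tracks the orbit of the Koopman operator. Nothing requires \<open>B\<close> to
  be invertible, so the polar factors themselves need not converge as \<open>M\<close> tends to infinity.\<close>

section \<open>Polar factors and finite-dimensional spectral measures\<close>

text \<open>The obstacle is that the polar factor depends discontinuously on its matrix at singular
  matrices, so convergence of the entries of \<open>G\<close> and \<open>A\<close> says nothing
  directly about \<open>P\<close>. The way around is an estimate for \<open>P\<close> on a single
  vector whose right-hand side contains only quadratic forms of \<open>G\<close> and
  \<open>A\<close>. With v = Rh and y = Bv, the bounds for the squared norms of Pv - y and of y - Rb
  contain the squared norm of y with opposite signs. Their sum is therefore at most an expression
  free of y, which converges to the squared norm of Kh - b up to a term of order \<delta>. Each of
  the two distances costs one copy of that error, hence the factor two. Independence of the
  dictionary makes the bound 1 + \<delta> uniform over all unit vectors. Moments with natural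
  exponents suffice because on the circle negative powers are conjugates of positive ones, and
  forward powers of the Koopman operator never leave the image of L2, where the dictionary
  approximates.\<close>

lemma cscalar_prod_sum:
  fixes v w :: "complex Matrix.vec"
  assumes "w \<in> carrier_vec n"
  shows "v \<bullet>c w = (\<Sum>i<n. vec_index v i * cnj (vec_index w i))"
  using assms by (auto simp: Matrix.scalar_prod_def conjugate_complex_def lessThan_atLeast0 intro!: sum.cong)

lemma mat_adjoint_carrier:
  "A \<in> carrier_mat m n \<Longrightarrow> mat_adjoint A \<in> carrier_mat n m" for A :: "complex mat"
  by (auto simp: mat_adjoint_def mat_of_rows_def)

lemma mat_adjoint_index:
  fixes A :: "complex mat"
  assumes "A \<in> carrier_mat m n" "i < n" "j < m"
  shows "mat_adjoint A $$ (i, j) = cnj (A $$ (j, i))"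
  using assms by (auto simp: mat_adjoint_def mat_of_rows_def conjugate_complex_def)

lemma mult_mat_vec_index:
  fixes A :: "complex mat"
  assumes "A \<in> carrier_mat m n" "v \<in> carrier_vec n" "i < m"
  shows "vec_index (A *\<^sub>v v) i = (\<Sum>j<n. A $$ (i, j) * vec_index v j)"
  using assms by (auto simp: Matrix.scalar_prod_def lessThan_atLeast0 intro!: sum.cong)

lemma cscalar_prod_adjoint:
  fixes A :: "complex mat"
  assumes A: "A \<in> carrier_mat m n" and v: "v \<in> carrier_vec n" and w: "w \<in> carrier_vec m"
  shows "(A *\<^sub>v v) \<bullet>c w = v \<bullet>c (mat_adjoint A *\<^sub>v w)"
proof -
  have "(A *\<^sub>v v) \<bullet>c w = (\<Sum>i<m. \<Sum>j<n. A $$ (i, j) * vec_index v j * cnj (vec_index w i))"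
    using assms by (subst cscalar_prod_sum[OF w])
      (auto simp: mult_mat_vec_index[OF A v] sum_distrib_right simp del: index_mult_mat_vec intro!: sum.cong)
  also have "\<dots> = (\<Sum>j<n. \<Sum>i<m. A $$ (i, j) * vec_index v j * cnj (vec_index w i))"
    by (rule sum.swap)
  also have "\<dots> = (\<Sum>j<n. vec_index v j * cnj (\<Sum>i<m. mat_adjoint A $$ (j, i) * vec_index w i))"
    by (auto simp: mat_adjoint_index[OF A] sum_distrib_left algebra_simps intro!: sum.cong)
  also have "\<dots> = v \<bullet>c (mat_adjoint A *\<^sub>v w)"
    using A w mult_mat_vec_carrier[OF mat_adjoint_carrier[OF A] w]
    by (subst cscalar_prod_sum[where n = n])
      (auto simp: mult_mat_vec_index[OF mat_adjoint_carrier[OF A] w] simp del: index_mult_mat_vec)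
  finally show ?thesis .
qed

lemma mat_adjoint_adjoint [simp]:
  "A \<in> carrier_mat m n \<Longrightarrow> mat_adjoint (mat_adjoint A) = A" for A :: "complex mat"
  by (rule eq_matI) (use mat_adjoint_carrier[of A m n] mat_adjoint_carrier[of "mat_adjoint A" n m] in
    \<open>auto simp: mat_adjoint_index[of _ n m] mat_adjoint_index[of _ m n]\<close>)

lemma mat_adjoint_mult:
  fixes A B :: "complex mat"
  assumes A: "A \<in> carrier_mat l m" and B: "B \<in> carrier_mat m n"
  shows "mat_adjoint (A * B) = mat_adjoint B * mat_adjoint A"
proof (rule eq_matI)
  have AB: "A * B \<in> carrier_mat l n" using A B by simp
  note d = mat_adjoint_carrier[OF A] mat_adjoint_carrier[OF B] mat_adjoint_carrier[OF AB]
  show "dim_row (mat_adjoint (A * B)) = dim_row (mat_adjoint B * mat_adjoint A)"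
    "dim_col (mat_adjoint (A * B)) = dim_col (mat_adjoint B * mat_adjoint A)"
    using d by auto
  fix i j assume "i < dim_row (mat_adjoint B * mat_adjoint A)" "j < dim_col (mat_adjoint B * mat_adjoint A)"
  then have i: "i < n" and j: "j < l" using d by auto
  show "mat_adjoint (A * B) $$ (i, j) = (mat_adjoint B * mat_adjoint A) $$ (i, j)"
    using i j A B d mat_adjoint_index[OF AB i j]
    by (auto simp: Matrix.scalar_prod_def mat_adjoint_index[OF A _ j] mat_adjoint_index[OF B i] mult.commute
        intro!: sum.cong)
qed

lemma mat_adjoint_mat_diag: "mat_adjoint (mat_diag n f) = mat_diag n (\<lambda>i. cnj (f i))"
  for f :: "nat \<Rightarrow> complex"
proof -
  have D: "mat_diag n f \<in> carrier_mat n n" by simp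
  have d: "dim_row (mat_adjoint (mat_diag n f)) = n" "dim_col (mat_adjoint (mat_diag n f)) = n"
    using mat_adjoint_carrier[OF D] by auto
  have D': "mat_diag n (\<lambda>i. cnj (f i)) \<in> carrier_mat n n" by simp
  show ?thesis
  proof (rule eq_matI)
    fix i j assume "i < dim_row (mat_diag n (\<lambda>i. cnj (f i)))" "j < dim_col (mat_diag n (\<lambda>i. cnj (f i)))"
    then have "i < n" "j < n" using D' by auto
    then show "mat_adjoint (mat_diag n f) $$ (i, j) = mat_diag n (\<lambda>i. cnj (f i)) $$ (i, j)"
      unfolding mat_adjoint_index[OF D \<open>i < n\<close> \<open>j < n\<close>] by (auto simp: mat_diag_def)
  qed (use d carrier_matD[OF D'] in auto)
qed

lemma mat_diag_mult_vec_index: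
  "v \<in> carrier_vec n \<Longrightarrow> i < n \<Longrightarrow> vec_index (mat_diag n f *\<^sub>v v) i = f i * vec_index v i"
  for f :: "nat \<Rightarrow> complex"
  by (subst mult_mat_vec_index[of _ n n])
    (auto simp: mat_diag_def if_distrib[of "\<lambda>x. x * _"] cong: if_cong)

section \<open>Euclidean norm of complex vectors\<close>

definition vec_norm :: "complex Matrix.vec \<Rightarrow> real" where
  "vec_norm v = sqrt (Re (v \<bullet>c v))"

lemma cscalar_prod_self:
  assumes "v \<in> carrier_vec n"
  shows "v \<bullet>c v = complex_of_real (\<Sum>i<n. (cmod (vec_index v i))\<^sup>2)"
  using assms by (simp add: cscalar_prod_sum complex_mult_cnj cmod_power2)

text \<open>Gives access to the triangle and product inequalities of \<open>L2_set\<close>, which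
  carry the Euclidean geometry below.\<close>

lemma vec_norm_L2_set:
  "v \<in> carrier_vec n \<Longrightarrow> vec_norm v = L2_set (\<lambda>i. cmod (vec_index v i)) {..<n}"
  by (simp add: vec_norm_def L2_set_def cscalar_prod_self)

lemma vec_norm_nonneg: "0 \<le> vec_norm v"
  using vec_norm_L2_set[of v "dim_vec v"] by (simp add: L2_set_nonneg)

lemma vec_norm_power2: "v \<in> carrier_vec n \<Longrightarrow> (vec_norm v)\<^sup>2 = Re (v \<bullet>c v)"
  by (simp add: vec_norm_def cscalar_prod_self sum_nonneg)

lemma vec_norm_power2_sum:
  "v \<in> carrier_vec n \<Longrightarrow> (vec_norm v)\<^sup>2 = (\<Sum>i<n. (cmod (vec_index v i))\<^sup>2)"
  by (simp add: vec_norm_power2 cscalar_prod_self)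

lemma cscalar_prod_Cauchy_Schwarz:
  assumes "v \<in> carrier_vec n" "w \<in> carrier_vec n"
  shows "cmod (v \<bullet>c w) \<le> vec_norm v * vec_norm w"
proof -
  have "cmod (v \<bullet>c w) \<le> (\<Sum>i<n. cmod (vec_index v i) * cmod (vec_index w i))"
    unfolding cscalar_prod_sum[OF assms(2)] by (rule order_trans[OF norm_sum]) (simp add: norm_mult)
  also have "\<dots> \<le> vec_norm v * vec_norm w"
    using L2_set_mult_ineq[of "\<lambda>i. cmod (vec_index v i)" "\<lambda>i. cmod (vec_index w i)" "{..<n}"] assms
    by (simp add: vec_norm_L2_set)
  finally show ?thesis .
qed

lemma vec_norm_triangle:
  assumes "u \<in> carrier_vec n" "v \<in> carrier_vec n" "w \<in> carrier_vec n"
  shows "vec_norm (u - w) \<le> vec_norm (u - v) + vec_norm (v - w)"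
proof -
  have "vec_norm (u - w) \<le> L2_set (\<lambda>i. cmod (vec_index (u - v) i) + cmod (vec_index (v - w) i)) {..<n}"
    unfolding vec_norm_L2_set[OF minus_carrier_vec[OF assms(1,3)]]
  proof (rule L2_set_mono)
    fix i assume "i \<in> {..<n}"
    then show "cmod (vec_index (u - w) i) \<le> cmod (vec_index (u - v) i) + cmod (vec_index (v - w) i)"
      using assms norm_triangle_ineq[of "vec_index u i - vec_index v i" "vec_index v i - vec_index w i"]
      by simp
  qed simp
  also have "\<dots> \<le> vec_norm (u - v) + vec_norm (v - w)"
    unfolding vec_norm_L2_set[OF minus_carrier_vec[OF assms(1,2)]]
      vec_norm_L2_set[OF minus_carrier_vec[OF assms(2,3)]]
    by (rule L2_set_triangle_ineq)
  finally show ?thesis .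
qed

lemma vec_norm_diff_power2:
  assumes "v \<in> carrier_vec n" "w \<in> carrier_vec n"
  shows "(vec_norm (v - w))\<^sup>2 = (vec_norm v)\<^sup>2 - 2 * Re (v \<bullet>c w) + (vec_norm w)\<^sup>2"
proof -
  have "(\<Sum>i<n. (cmod (vec_index v i - vec_index w i))\<^sup>2) =
    (\<Sum>i<n. (cmod (vec_index v i))\<^sup>2 - 2 * Re (vec_index v i * cnj (vec_index w i)) + (cmod (vec_index w i))\<^sup>2)"
    by (rule sum.cong) (auto simp: cmod_power2, auto simp: power2_eq_square algebra_simps)
  also have "\<dots> = (vec_norm v)\<^sup>2 - 2 * Re (v \<bullet>c w) + (vec_norm w)\<^sup>2"
    using assms by (simp add: vec_norm_power2_sum cscalar_prod_sum sum.distrib sum_subtractf sum_distrib_left)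
  finally show ?thesis
    using assms by (simp add: vec_norm_power2_sum[OF minus_carrier_vec[OF assms]])
qed

section \<open>Unitary matrices and square roots of Gram matrices\<close>

lemma unitary_mat_cscalar_prod:
  assumes U: "unitary_mat n U" and v: "v \<in> carrier_vec n" and w: "w \<in> carrier_vec n"
  shows "(U *\<^sub>v v) \<bullet>c (U *\<^sub>v w) = v \<bullet>c w"
proof -
  have c: "U \<in> carrier_mat n n" using U by (simp add: unitary_mat_def)
  have "(U *\<^sub>v v) \<bullet>c (U *\<^sub>v w) = v \<bullet>c (mat_adjoint U *\<^sub>v (U *\<^sub>v w))"
    using c v w mult_mat_vec_carrier[OF c w] by (intro cscalar_prod_adjoint) auto
  also have "mat_adjoint U *\<^sub>v (U *\<^sub>v w) = mat_adjoint U * U *\<^sub>v w"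
    by (rule assoc_mult_mat_vec[symmetric]) (use c w mat_adjoint_carrier[OF c] in auto)
  finally show ?thesis using U w by (simp add: unitary_mat_def)
qed

lemma unitary_mat_vec_norm:
  "unitary_mat n U \<Longrightarrow> v \<in> carrier_vec n \<Longrightarrow> vec_norm (U *\<^sub>v v) = vec_norm v"
  by (simp add: vec_norm_def unitary_mat_cscalar_prod)

lemma unitary_mat_adjoint: "unitary_mat n U \<Longrightarrow> unitary_mat n (mat_adjoint U)"
  using mat_adjoint_carrier[of U n n] by (auto simp: unitary_mat_def)

lemma unitary_mat_mult:
  assumes U: "unitary_mat n U" and V: "unitary_mat n V"
  shows "unitary_mat n (U * V)"
proof -
  have c: "U \<in> carrier_mat n n" "V \<in> carrier_mat n n"
    using U V by (auto simp: unitary_mat_def)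
  note ad = mat_adjoint_carrier[OF c(1)] mat_adjoint_carrier[OF c(2)]
  have "mat_adjoint V * mat_adjoint U * (U * V) = mat_adjoint V * (mat_adjoint U * U * V)"
    using c ad by (simp add: assoc_mult_mat[of _ n n _ n _ n])
  also have "\<dots> = 1\<^sub>m n"
    using U V c by (simp add: unitary_mat_def)
  finally have 1: "mat_adjoint V * mat_adjoint U * (U * V) = 1\<^sub>m n" .
  have "U * V * (mat_adjoint V * mat_adjoint U) = U * (V * mat_adjoint V * mat_adjoint U)"
    using c ad by (simp add: assoc_mult_mat[of _ n n _ n _ n])
  also have "\<dots> = 1\<^sub>m n"
    using U V c ad by (simp add: unitary_mat_def)
  finally have 2: "U * V * (mat_adjoint V * mat_adjoint U) = 1\<^sub>m n" .
  from 1 2 show ?thesis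
    using c by (simp add: unitary_mat_def mat_adjoint_mult[OF c])
qed

text \<open>\<open>R\<close> carries the form of \<open>G\<close> to the standard scalar product, so
  estimates can be made in the coordinates \<open>R *\<^sub>v c\<close>.\<close>

lemma sqrt_pair_cscalar_prod:
  assumes RQ: "sqrt_pair n G R Q" and v: "v \<in> carrier_vec n" and w: "w \<in> carrier_vec n"
  shows "(R *\<^sub>v v) \<bullet>c (R *\<^sub>v w) = (G *\<^sub>v v) \<bullet>c w"
proof -
  have c: "R \<in> carrier_mat n n" and h: "mat_adjoint R = R" and G: "G = R * R"
    using RQ by (auto simp: sqrt_pair_def psd_mat_def)
  have "(R *\<^sub>v (R *\<^sub>v v)) \<bullet>c w = (R *\<^sub>v v) \<bullet>c (R *\<^sub>v w)"
    using cscalar_prod_adjoint[OF c, of "R *\<^sub>v v" w] c v w by (simp add: h)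
  then show ?thesis using c v by (simp add: G assoc_mult_mat_vec[of R n n R n v])
qed

text \<open>Taking adjoints in \<open>Q * R = 1\<^sub>m n\<close> makes the adjoint of
  \<open>Q\<close> a right inverse of \<open>R\<close>, and inverses are unique.\<close>

lemma sqrt_pair_inverse_hermitian:
  assumes "sqrt_pair n G R Q"
  shows "mat_adjoint Q = Q"
proof -
  have c: "R \<in> carrier_mat n n" "Q \<in> carrier_mat n n" and h: "mat_adjoint R = R"
    and RQ: "R * Q = 1\<^sub>m n" "Q * R = 1\<^sub>m n"
    using assms by (auto simp: sqrt_pair_def psd_mat_def)
  note ad = mat_adjoint_carrier[OF c(2)]
  have "mat_adjoint (Q * R) = 1\<^sub>m n"
    using RQ mat_adjoint_mat_diag[of n "\<lambda>_. 1"] by simp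
  then have *: "R * mat_adjoint Q = 1\<^sub>m n"
    by (simp add: mat_adjoint_mult[OF c(2,1)] h)
  have "mat_adjoint Q = Q * R * mat_adjoint Q"
    using RQ ad by simp
  also have "\<dots> = Q * (R * mat_adjoint Q)"
    using c ad by (simp add: assoc_mult_mat[of _ n n _ n _ n])
  finally show ?thesis using * c by simp
qed

text \<open>If B is \<open>U2\<close> times a nonnegative diagonal matrix times the adjoint of
  \<open>U1\<close>, then this is a unitary factor in a polar decomposition of B. Conjugating it by
  \<open>R\<close> gives the mpEDMD matrix.\<close>

definition polar_factor :: "complex mat \<Rightarrow> complex mat \<Rightarrow> complex mat" where
  "polar_factor U1 U2 = U2 * mat_adjoint U1"

section \<open>Singular values and eigenvalues for one fixed matrix pair\<close>

locale mpedmd_data =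
  fixes n :: nat and G A R Q U1 U2 Vh :: "complex mat" and \<sigma> :: "nat \<Rightarrow> real" and lam :: "nat \<Rightarrow> complex"
  assumes factors: "mpedmd_factors n G A R Q U1 \<sigma> U2 Vh lam"
    and A_carrier: "A \<in> carrier_mat n n"
begin

abbreviation U :: "complex mat" where "U \<equiv> polar_factor U1 U2"

lemma R_carrier: "R \<in> carrier_mat n n" and Q_carrier: "Q \<in> carrier_mat n n"
  and RQ: "R * Q = 1\<^sub>m n" and QR: "Q * R = 1\<^sub>m n"
  and unitary_U1: "unitary_mat n U1" and unitary_U2: "unitary_mat n U2"
  and unitary_Vh: "unitary_mat n Vh" and sqrt_pair: "sqrt_pair n G R Q"
  and sigma_nonneg: "i < n \<Longrightarrow> 0 \<le> \<sigma> i"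
  and svd: "Q * mat_adjoint A * Q = U1 * mat_diag n (\<lambda>i. complex_of_real (\<sigma> i)) * mat_adjoint U2"
  and U_eigen: "U = Vh * mat_diag n lam * mat_adjoint Vh"
  and U1_carrier: "U1 \<in> carrier_mat n n" and U2_carrier: "U2 \<in> carrier_mat n n"
  and Vh_carrier: "Vh \<in> carrier_mat n n" and G_eq: "G = R * R"
  using factors
  by (auto simp: mpedmd_factors_def sqrt_pair_def psd_mat_def svd_factors_def
      unitary_eigendecomposition_def unitary_mat_def polar_factor_def)

lemma Q_hermitian: "mat_adjoint Q = Q"
  using sqrt_pair by (rule sqrt_pair_inverse_hermitian)

lemma unitary_U: "unitary_mat n U"
  unfolding polar_factor_def by (intro unitary_mat_mult unitary_mat_adjoint unitary_U1 unitary_U2)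

text \<open>The given decomposition is that of the adjoint; passing to adjoints exchanges the
  unitary factors and fixes the real diagonal.\<close>

lemma QAQ_eq: "Q * A * Q = U2 * mat_diag n (\<lambda>i. complex_of_real (\<sigma> i)) * mat_adjoint U1"
proof -
  note A' = mat_adjoint_carrier[OF A_carrier]
  have "Q * A * Q = mat_adjoint (Q * mat_adjoint A * Q)"
    using A_carrier A' Q_carrier
    by (simp add: mat_adjoint_mult[of _ n n _ n] Q_hermitian assoc_mult_mat[of _ n n _ n _ n])
  also have "\<dots> = U2 * mat_diag n (\<lambda>i. complex_of_real (\<sigma> i)) * mat_adjoint U1"
  proof -
    define D where "D = mat_diag n (\<lambda>i. complex_of_real (\<sigma> i))"
    have D: "D \<in> carrier_mat n n" "mat_adjoint D = D"
      by (simp_all add: D_def mat_adjoint_mat_diag)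
    show ?thesis
      unfolding svd D_def[symmetric]
      using U1_carrier U2_carrier mat_adjoint_carrier[OF U2_carrier] mat_adjoint_carrier[OF U1_carrier] D
      by (simp add: mat_adjoint_mult[of _ n n _ n] assoc_mult_mat[of _ n n _ n _ n])
  qed
  finally show ?thesis .
qed

lemma QAQ_form:
  assumes v: "v \<in> carrier_vec n" and w: "w \<in> carrier_vec n"
  shows "(Q * A * Q *\<^sub>v v) \<bullet>c w = (A *\<^sub>v (Q *\<^sub>v v)) \<bullet>c (Q *\<^sub>v w)"
proof -
  have "Q * A * Q *\<^sub>v v = Q *\<^sub>v (A *\<^sub>v (Q *\<^sub>v v))"
    using A_carrier Q_carrier v by (simp add: assoc_mult_mat_vec[of _ n n _ n])
  then show ?thesis
    using cscalar_prod_adjoint[OF Q_carrier _ w, of "A *\<^sub>v (Q *\<^sub>v v)"] A_carrier Q_carrier v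
    by (simp add: Q_hermitian)
qed

lemma vec_norm_R: "v \<in> carrier_vec n \<Longrightarrow> (vec_norm (R *\<^sub>v v))\<^sup>2 = Re ((G *\<^sub>v v) \<bullet>c v)"
  using R_carrier by (simp add: vec_norm_power2[of _ n] sqrt_pair_cscalar_prod[OF sqrt_pair])

lemma RQ_vec: "v \<in> carrier_vec n \<Longrightarrow> R *\<^sub>v (Q *\<^sub>v v) = v"
  and QR_vec: "v \<in> carrier_vec n \<Longrightarrow> Q *\<^sub>v (R *\<^sub>v v) = v"
  using R_carrier Q_carrier
  by (simp_all add: assoc_mult_mat_vec[of _ n n _ n, symmetric] RQ QR)

text \<open>A singular value is the value of the form of \<open>Q * A * Q\<close> at the
  corresponding pair of singular vectors, and that form is the form of \<open>A\<close> after
  applying \<open>Q\<close> to both arguments.\<close>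

lemma sigma_le:
  assumes bound: "\<And>a b. a \<in> carrier_vec n \<Longrightarrow> b \<in> carrier_vec n \<Longrightarrow> Re ((G *\<^sub>v a) \<bullet>c a) = 1 \<Longrightarrow>
      Re ((G *\<^sub>v b) \<bullet>c b) = 1 \<Longrightarrow> cmod ((A *\<^sub>v a) \<bullet>c b) \<le> 1 + \<delta>"
    and i: "i < n"
  shows "\<sigma> i \<le> 1 + \<delta>"
proof -
  define e where "e = (unit_vec n i :: complex Matrix.vec)"
  define D where "D = mat_diag n (\<lambda>i. complex_of_real (\<sigma> i))"
  have D: "D \<in> carrier_mat n n" by (simp add: D_def)
  have e: "e \<in> carrier_vec n" by (simp add: e_def)
  have ee: "x \<bullet>c e = vec_index x i" if "x \<in> carrier_vec n" for x
    unfolding cscalar_prod_sum[OF e] using that i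
    by (simp add: e_def if_distrib[of cnj] if_distrib[of "\<lambda>x. _ * x"] cong: if_cong)
  have ne: "vec_norm e = 1"
    using ee[OF e] i by (simp add: vec_norm_def e_def)
  have c: "U1 *\<^sub>v e \<in> carrier_vec n" "U2 *\<^sub>v e \<in> carrier_vec n"
    using U1_carrier U2_carrier e by auto
  \<comment> \<open>\<open>Q\<close> maps Euclidean unit vectors to unit vectors for
    \<open>G\<close>, which is what \<open>bound\<close> requires.\<close>
  have n: "Re ((G *\<^sub>v (Q *\<^sub>v (V *\<^sub>v e))) \<bullet>c (Q *\<^sub>v (V *\<^sub>v e))) = 1"
    if V: "unitary_mat n V" for V
  proof -
    have "V *\<^sub>v e \<in> carrier_vec n" using V e by (auto simp: unitary_mat_def)
    then have "Re ((G *\<^sub>v (Q *\<^sub>v (V *\<^sub>v e))) \<bullet>c (Q *\<^sub>v (V *\<^sub>v e))) = (vec_norm (V *\<^sub>v e))\<^sup>2"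
      using Q_carrier by (subst vec_norm_R[symmetric]) (auto simp: RQ_vec)
    then show ?thesis by (simp add: unitary_mat_vec_norm[OF V e] ne)
  qed
  have De: "D *\<^sub>v e \<in> carrier_vec n" using D e by auto
  have "Q * A * Q *\<^sub>v (U1 *\<^sub>v e) = U2 *\<^sub>v (D *\<^sub>v (mat_adjoint U1 *\<^sub>v (U1 *\<^sub>v e)))"
    using U1_carrier U2_carrier D e c mat_adjoint_carrier[OF U1_carrier]
    by (simp add: QAQ_eq D_def[symmetric] assoc_mult_mat_vec[of _ n n _ n])
  also have "mat_adjoint U1 *\<^sub>v (U1 *\<^sub>v e) = e"
    using unitary_U1 e mat_adjoint_carrier[OF U1_carrier]
    by (subst assoc_mult_mat_vec[of _ n n _ n, symmetric]) (auto simp: unitary_mat_def)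
  finally have "(Q * A * Q *\<^sub>v (U1 *\<^sub>v e)) \<bullet>c (U2 *\<^sub>v e) = complex_of_real (\<sigma> i)"
    using i mat_diag_mult_vec_index[OF e i, of "\<lambda>i. complex_of_real (\<sigma> i)"]
    by (simp add: unitary_mat_cscalar_prod[OF unitary_U2 De e] ee[OF De] del: index_mult_mat_vec)
      (simp add: D_def e_def del: index_mult_mat_vec)
  then have "cmod ((A *\<^sub>v (Q *\<^sub>v (U1 *\<^sub>v e))) \<bullet>c (Q *\<^sub>v (U2 *\<^sub>v e))) = \<sigma> i"
    using sigma_nonneg[OF i] by (simp add: QAQ_form[OF c])
  with bound[OF _ _ n[OF unitary_U1] n[OF unitary_U2]] show ?thesis
    using Q_carrier c by auto
qed

text \<open>With \<open>B = Q * A * Q\<close>, the polar factor is close to \<open>B\<close> on vectors whose norm \<open>B\<close> almost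
  preserves, because \<open>(1 - s)\<^sup>2 \<le> 1 - s\<^sup>2\<close> for singular values \<open>0 \<le> s \<le> 1\<close>.\<close>

lemma polar_factor_error:
  assumes bound: "\<And>i. i < n \<Longrightarrow> \<sigma> i \<le> 1 + \<delta>" and \<delta>: "0 \<le> \<delta>"
    and h: "h \<in> carrier_vec n" and a: "a \<in> carrier_vec n"
  defines "L \<equiv> 2 * Re ((A *\<^sub>v h) \<bullet>c a) - Re ((G *\<^sub>v a) \<bullet>c a)"
  shows "vec_norm (U *\<^sub>v (R *\<^sub>v h) - R *\<^sub>v a)
    \<le> 2 * sqrt ((1 + 2 * \<delta> * (1 + \<delta>)) * Re ((G *\<^sub>v h) \<bullet>c h) - L)"
proof -
  define v where "v = R *\<^sub>v h"
  define t where "t = mat_adjoint U1 *\<^sub>v v"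
  define D where "D = mat_diag n (\<lambda>i. complex_of_real (\<sigma> i))"
  define y where "y = Q * A * Q *\<^sub>v v"
  have D: "D \<in> carrier_mat n n" by (simp add: D_def)
  have v: "v \<in> carrier_vec n" using R_carrier h by (auto simp: v_def)
  have t: "t \<in> carrier_vec n" using mat_adjoint_carrier[OF U1_carrier] v by (auto simp: t_def)
  have Ra: "R *\<^sub>v a \<in> carrier_vec n" using R_carrier a by auto
  have y: "y \<in> carrier_vec n" unfolding y_def
    by (intro mult_mat_vec_carrier[of _ n n] mult_carrier_mat[of _ n n] A_carrier Q_carrier v)
  have Dt: "D *\<^sub>v t \<in> carrier_vec n" using D t by auto
  have Uv: "U *\<^sub>v v = U2 *\<^sub>v t"
    using U2_carrier mat_adjoint_carrier[OF U1_carrier] v by (simp add: polar_factor_def t_def assoc_mult_mat_vec[of _ n n _ n])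
  have y_eq: "y = U2 *\<^sub>v (D *\<^sub>v t)"
    using U1_carrier U2_carrier D v mat_adjoint_carrier[OF U1_carrier]
    by (simp add: y_def t_def QAQ_eq D_def[symmetric] assoc_mult_mat_vec[of _ n n _ n])
  have nt: "vec_norm t = vec_norm v"
    unfolding t_def by (rule unitary_mat_vec_norm[OF unitary_mat_adjoint[OF unitary_U1] v])
  have ny: "(vec_norm y)\<^sup>2 = (\<Sum>i<n. (\<sigma> i)\<^sup>2 * (cmod (vec_index t i))\<^sup>2)"
    unfolding y_eq unitary_mat_vec_norm[OF unitary_U2 Dt] vec_norm_power2_sum[OF Dt]
    using t by (simp add: D_def mat_diag_mult_vec_index norm_mult power_mult_distrib del: index_mult_mat_vec)
  have "U *\<^sub>v v - y = U2 *\<^sub>v (t - D *\<^sub>v t)"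
    unfolding Uv y_eq by (rule mult_minus_distrib_mat_vec[OF U2_carrier t Dt, symmetric])
  then have "(vec_norm (U *\<^sub>v v - y))\<^sup>2 = (\<Sum>i<n. (cmod (vec_index (t - D *\<^sub>v t) i))\<^sup>2)"
    using unitary_mat_vec_norm[OF unitary_U2 minus_carrier_vec[OF t Dt]]
      vec_norm_power2_sum[OF minus_carrier_vec[OF t Dt]] by simp
  also have "\<dots> = (\<Sum>i<n. (1 - \<sigma> i)\<^sup>2 * (cmod (vec_index t i))\<^sup>2)"
  proof (rule sum.cong)
    fix i assume "i \<in> {..<n}"
    then have "vec_index (t - D *\<^sub>v t) i = complex_of_real (1 - \<sigma> i) * vec_index t i"
      using t D mat_diag_mult_vec_index[OF t, of i "\<lambda>i. complex_of_real (\<sigma> i)"]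
      by (simp add: algebra_simps del: index_mult_mat_vec) (simp add: D_def algebra_simps del: index_mult_mat_vec)
    then show "(cmod (vec_index (t - D *\<^sub>v t) i))\<^sup>2 = (1 - \<sigma> i)\<^sup>2 * (cmod (vec_index t i))\<^sup>2"
      by (simp only: norm_mult norm_of_real power_mult_distrib power2_abs)
  qed simp
  also have "\<dots> \<le> (\<Sum>i<n. (1 + 2 * \<delta> * (1 + \<delta>) - (\<sigma> i)\<^sup>2) * (cmod (vec_index t i))\<^sup>2)"
  proof (intro sum_mono mult_right_mono)
    fix i assume "i \<in> {..<n}"
    then have s: "0 \<le> \<sigma> i" "\<sigma> i \<le> 1 + \<delta>" using sigma_nonneg bound by auto
    \<comment> \<open>With s = \<open>\<sigma> i\<close>, the sum of (1 - s)^2 and s^2 is 1 + 2s(s -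
      1). This explains the constant: s(s - 1) is at most (1 + \<delta>)\<delta> for s up to 1 +
      \<delta>.\<close>
    have "\<sigma> i * (\<sigma> i - 1) \<le> (1 + \<delta>) * \<delta>"
      using s \<delta> mult_left_mono[of "\<sigma> i - 1" \<delta> "\<sigma> i"] mult_right_mono[of "\<sigma> i" "1 + \<delta>" \<delta>] by linarith
    then show "(1 - \<sigma> i)\<^sup>2 \<le> 1 + 2 * \<delta> * (1 + \<delta>) - (\<sigma> i)\<^sup>2"
      by (simp add: power2_eq_square algebra_simps)
  qed simp
  also have "\<dots> = (1 + 2 * \<delta> * (1 + \<delta>)) * (vec_norm v)\<^sup>2 - (vec_norm y)\<^sup>2"
    unfolding ny nt[symmetric] vec_norm_power2_sum[OF t]
    by (simp add: left_diff_distrib sum_subtractf sum_distrib_left)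
  finally have 1: "(vec_norm (U *\<^sub>v v - y))\<^sup>2 \<le> (1 + 2 * \<delta> * (1 + \<delta>)) * (vec_norm v)\<^sup>2 - (vec_norm y)\<^sup>2" .
  have "y \<bullet>c (R *\<^sub>v a) = (A *\<^sub>v h) \<bullet>c a"
    unfolding y_def by (simp add: QAQ_form[OF v Ra] QR_vec[OF a]) (simp add: v_def QR_vec[OF h])
  then have 2: "(vec_norm (y - R *\<^sub>v a))\<^sup>2 = (vec_norm y)\<^sup>2 - L"
    by (simp add: vec_norm_diff_power2[OF y Ra] L_def vec_norm_R[OF a])
  \<comment> \<open>Adding facts 1 and 2 cancels the norm of \<open>y\<close>, leaving
    \<open>X\<close>, which depends on \<open>h\<close> and \<open>a\<close> only through the forms
    of \<open>G\<close> and \<open>A\<close>. Both summands are nonnegative, so each is at most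
    \<open>X\<close>.\<close>
  define X where "X = (1 + 2 * \<delta> * (1 + \<delta>)) * Re ((G *\<^sub>v h) \<bullet>c h) - L"
  have v2: "(vec_norm v)\<^sup>2 = Re ((G *\<^sub>v h) \<bullet>c h)" by (simp add: v_def vec_norm_R[OF h])
  have a1: "(vec_norm (U *\<^sub>v v - y))\<^sup>2 \<le> X" and a2: "(vec_norm (y - R *\<^sub>v a))\<^sup>2 \<le> X"
    using 1 2 zero_le_power2[of "vec_norm (y - R *\<^sub>v a)"] zero_le_power2[of "vec_norm (U *\<^sub>v v - y)"]
    unfolding X_def v2 by linarith+
  have Uvc: "U *\<^sub>v v \<in> carrier_vec n" using unitary_U v by (auto simp: unitary_mat_def)
  have "vec_norm (U *\<^sub>v v - R *\<^sub>v a) \<le> vec_norm (U *\<^sub>v v - y) + vec_norm (y - R *\<^sub>v a)"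
    by (rule vec_norm_triangle[OF Uvc y Ra])
  also have "\<dots> \<le> sqrt X + sqrt X"
    using real_le_rsqrt[OF a1] real_le_rsqrt[OF a2] by linarith
  finally show ?thesis by (simp add: X_def v_def)
qed

text \<open>Conjugating the unitary matrix \<open>U\<close> by \<open>Vh\<close> shows that the
  diagonal factor is itself unitary, so its entries are unimodular.\<close>

lemma cmod_lam:
  assumes i: "i < n"
  shows "cmod (lam i) = 1"
proof -
  define D where "D = mat_diag n lam"
  have D: "D \<in> carrier_mat n n" by (simp add: D_def)
  note ad = mat_adjoint_carrier[OF Vh_carrier]
  have "unitary_mat n (mat_adjoint Vh * U * Vh)"
    by (intro unitary_mat_mult unitary_mat_adjoint unitary_Vh unitary_U)
  moreover have "mat_adjoint Vh * U * Vh = (mat_adjoint Vh * Vh) * D * (mat_adjoint Vh * Vh)"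
    using D ad Vh_carrier by (simp add: U_eigen D_def[symmetric] assoc_mult_mat[of _ n n _ n _ n])
  moreover have "\<dots> = D"
    using D unitary_Vh by (simp add: unitary_mat_def)
  ultimately have "unitary_mat n D" by simp
  then have "mat_diag n (\<lambda>i. cnj (lam i) * lam i) = 1\<^sub>m n"
    by (simp add: unitary_mat_def D_def mat_adjoint_mat_diag)
  then have "mat_diag n (\<lambda>i. cnj (lam i) * lam i) $$ (i, i) = 1"
    using i by simp
  then have "cnj (lam i) * lam i = 1"
    using i by (simp add: mat_diag_def)
  then show ?thesis
    using complex_norm_square[of "lam i"] norm_ge_zero[of "lam i"]
    by (simp add: mult.commute power2_eq_1_iff flip: of_real_power)
qed

lemma U_funpow:
  assumes v: "v \<in> carrier_vec n"
  defines "t \<equiv> mat_adjoint Vh *\<^sub>v v"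
  shows "((*\<^sub>v) U ^^ k) v = Vh *\<^sub>v Matrix.vec n (\<lambda>i. lam i ^ k * vec_index t i)"
proof (induction k)
  case 0
  note ad = mat_adjoint_carrier[OF Vh_carrier]
  have t: "t \<in> carrier_vec n" using ad v by (auto simp: t_def)
  then have "Matrix.vec n (\<lambda>i. lam i ^ 0 * vec_index t i) = t"
    by (intro eq_vecI) auto
  moreover have "Vh *\<^sub>v t = v"
    using ad Vh_carrier v unitary_Vh
    by (simp add: t_def unitary_mat_def flip: assoc_mult_mat_vec[of _ n n _ n])
  ultimately show ?case by simp
next
  case (Suc k)
  define D where "D = mat_diag n lam"
  define s where "s = Matrix.vec n (\<lambda>i. lam i ^ k * vec_index t i)"
  have D: "D \<in> carrier_mat n n" and s: "s \<in> carrier_vec n" by (simp_all add: D_def s_def)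
  note ad = mat_adjoint_carrier[OF Vh_carrier]
  have "U *\<^sub>v (Vh *\<^sub>v s) = Vh *\<^sub>v (D *\<^sub>v (mat_adjoint Vh *\<^sub>v (Vh *\<^sub>v s)))"
    using D ad Vh_carrier s by (simp add: U_eigen D_def[symmetric] assoc_mult_mat_vec[of _ n n _ n])
  also have "mat_adjoint Vh *\<^sub>v (Vh *\<^sub>v s) = s"
    using ad Vh_carrier s unitary_Vh
    by (simp add: unitary_mat_def flip: assoc_mult_mat_vec[of _ n n _ n])
  also have "D *\<^sub>v s = Matrix.vec n (\<lambda>i. lam i ^ Suc k * vec_index t i)"
  proof (rule eq_vecI)
    fix i assume "i < dim_vec (Matrix.vec n (\<lambda>i. lam i ^ Suc k * vec_index t i))"
    then show "vec_index (D *\<^sub>v s) i = vec_index (Matrix.vec n (\<lambda>i. lam i ^ Suc k * vec_index t i)) i"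
      using s by (simp add: D_def mat_diag_mult_vec_index del: index_mult_mat_vec) (simp add: s_def)
  qed (use D in auto)
  finally show ?case by (simp add: Suc s_def)
qed

lemma U_funpow_carrier: "v \<in> carrier_vec n \<Longrightarrow> ((*\<^sub>v) U ^^ k) v \<in> carrier_vec n"
  using unitary_U by (induction k) (auto simp: unitary_mat_def)

text \<open>In the orthonormal eigenbasis the form of a power is the moment of an atomic measure,
  with the squared coordinates of \<open>v\<close> as masses.\<close>

lemma U_funpow_moment:
  assumes v: "v \<in> carrier_vec n"
  shows "((*\<^sub>v) U ^^ k) v \<bullet>c v =
    (\<Sum>i<n. lam i ^ k * complex_of_real ((cmod (vec_index (mat_adjoint Vh *\<^sub>v v) i))\<^sup>2))"
proof -
  define t where "t = mat_adjoint Vh *\<^sub>v v"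
  have t: "t \<in> carrier_vec n" using mat_adjoint_carrier[OF Vh_carrier] v by (auto simp: t_def)
  have "((*\<^sub>v) U ^^ k) v \<bullet>c v = Matrix.vec n (\<lambda>i. lam i ^ k * vec_index t i) \<bullet>c t"
    unfolding U_funpow[OF v] t_def[symmetric] unfolding t_def
    by (rule cscalar_prod_adjoint[OF Vh_carrier _ v]) simp
  also have "\<dots> = (\<Sum>i<n. lam i ^ k * complex_of_real ((cmod (vec_index t i))\<^sup>2))"
    by (simp add: cscalar_prod_sum[OF t] complex_norm_square mult.assoc del: of_real_power)
  finally show ?thesis by (simp add: t_def)
qed

text \<open>Since \<open>Q * G\<close> equals \<open>R\<close>, the coefficients that define the
  discrete measure are the coordinates of \<open>R *\<^sub>v c\<close> in the basis
  \<open>Vh\<close>.\<close>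

lemma cscalar_prod_col:
  assumes c: "c \<in> carrier_vec n" and j: "j < n"
  shows "(G *\<^sub>v c) \<bullet>c col (Q * Vh) j = vec_index (mat_adjoint Vh *\<^sub>v (R *\<^sub>v c)) j"
proof -
  have Rc: "R *\<^sub>v c \<in> carrier_vec n" and Gc: "G *\<^sub>v c \<in> carrier_vec n" and y: "col Vh j \<in> carrier_vec n"
    using R_carrier Vh_carrier j c by (auto simp: G_eq intro: mult_mat_vec_carrier[of _ n n] mult_carrier_mat[of _ n n])
  have "(G *\<^sub>v c) \<bullet>c col (Q * Vh) j = (Q *\<^sub>v (G *\<^sub>v c)) \<bullet>c col Vh j"
    using cscalar_prod_adjoint[OF Q_carrier Gc y] j
    by (simp add: Q_hermitian col_mult2[OF Q_carrier Vh_carrier])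
  also have "Q *\<^sub>v (G *\<^sub>v c) = R *\<^sub>v c"
    using R_carrier Q_carrier c Rc by (simp add: G_eq assoc_mult_mat_vec[of R n n R n c] QR_vec)
  also have "(R *\<^sub>v c) \<bullet>c col Vh j = vec_index (mat_adjoint Vh *\<^sub>v (R *\<^sub>v c)) j"
    using Vh_carrier j
    by (auto simp: cscalar_prod_sum[OF y] mult_mat_vec_index[OF mat_adjoint_carrier[OF Vh_carrier] Rc j]
        mat_adjoint_index[OF Vh_carrier j] mult.commute simp del: index_mult_mat_vec intro!: sum.cong)
  finally show ?thesis .
qed

end

text \<open>Seeing the set function as a push-forward of a point measure yields both its countable
  additivity, without which \<open>measure_of\<close> would not return it, and the formula for
  integrals. Repeated eigenvalues simply add their masses.\<close>

lemma mpedmd_measure_eq: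
  fixes G V :: "complex mat" and c :: "complex Matrix.vec"
  assumes "\<forall>j<n. lam j \<in> circle"
  defines "p \<equiv> \<lambda>j. (cmod ((G *\<^sub>v c) \<bullet>c col V j))\<^sup>2"
  shows "mpedmd_measure n G V lam c = distr (point_measure {..<n} p) circle_borel lam"
proof -
  define D where "D = distr (point_measure {..<n} p) circle_borel lam"
  have m: "lam \<in> point_measure {..<n} p \<rightarrow>\<^sub>M circle_borel"
    using assms(1) by (auto simp: space_restrict_space)
  have em: "emeasure D X = ennreal (\<Sum>j | j < n \<and> lam j \<in> X. p j)" if "X \<in> sets circle_borel" for X
  proof -
    have "emeasure D X = emeasure (point_measure {..<n} p) (lam -` X \<inter> {..<n})"
      unfolding D_def by (subst emeasure_distr[OF m that]) (simp add: space_point_measure)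
    also have "\<dots> = (\<Sum>j\<in>lam -` X \<inter> {..<n}. ennreal (p j))"
      by (rule emeasure_point_measure_finite) auto
    also have "\<dots> = ennreal (\<Sum>j\<in>lam -` X \<inter> {..<n}. p j)"
      by (rule sum_ennreal) (simp add: p_def)
    also have "lam -` X \<inter> {..<n} = {j. j < n \<and> lam j \<in> X}" by auto
    finally show ?thesis .
  qed
  have sp: "space D = circle" "sets D = sets circle_borel"
    by (auto simp: D_def space_restrict_space)
  have "mpedmd_measure n G V lam c = measure_of circle (sets circle_borel) (emeasure D)"
    unfolding mpedmd_measure_def p_def[symmetric]
  proof (rule measure_of_eq)
    show "sets circle_borel \<subseteq> Pow circle"
      using sets.space_closed[of circle_borel] by (simp add: space_restrict_space)
    fix a assume "a \<in> sigma_sets circle (sets circle_borel)"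
    then have "a \<in> sets circle_borel"
      using sets.sigma_sets_eq[of circle_borel] by (simp add: space_restrict_space)
    then show "ennreal (\<Sum>j | j < n \<and> lam j \<in> a. p j) = emeasure D a" by (simp add: em)
  qed
  also have "\<dots> = D"
    using measure_of_of_measure[of D] by (simp add: sp)
  finally show ?thesis by (simp add: D_def)
qed

lemma integral_mpedmd_measure:
  fixes f :: "complex \<Rightarrow> 'b::{banach, second_countable_topology}"
  assumes "\<forall>j<n. lam j \<in> circle" and f: "f \<in> borel_measurable circle_borel"
  shows "(LINT z|mpedmd_measure n G V lam c. f z) = (\<Sum>j<n. (cmod ((G *\<^sub>v c) \<bullet>c col V j))\<^sup>2 *\<^sub>R f (lam j))"
proof -
  have m: "lam \<in> point_measure {..<n} (\<lambda>j. ennreal ((cmod ((G *\<^sub>v c) \<bullet>c col V j))\<^sup>2)) \<rightarrow>\<^sub>M circle_borel"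
    using assms(1) by (auto simp: space_restrict_space)
  show ?thesis
    unfolding mpedmd_measure_eq[OF assms(1)]
    by (simp add: integral_distr[OF m f] lebesgue_integral_point_measure_finite)
qed

lemma emeasure_mpedmd_measure_circle:
  assumes "\<forall>j<n. lam j \<in> circle"
  shows "emeasure (mpedmd_measure n G V lam c) circle = ennreal (\<Sum>j<n. (cmod ((G *\<^sub>v c) \<bullet>c col V j))\<^sup>2)"
proof -
  have m: "lam \<in> point_measure {..<n} (\<lambda>j. ennreal ((cmod ((G *\<^sub>v c) \<bullet>c col V j))\<^sup>2)) \<rightarrow>\<^sub>M circle_borel"
    using assms by (auto simp: space_restrict_space)
  have "circle \<in> sets circle_borel"
    using sets.top[of circle_borel] by (simp add: space_restrict_space)
  moreover have "lam -` circle \<inter> {..<n} = {..<n}"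
    using assms by auto
  ultimately show ?thesis
    unfolding mpedmd_measure_eq[OF assms]
    by (simp add: emeasure_distr[OF m] space_point_measure emeasure_point_measure_finite)
qed

lemma sets_mpedmd_measure:
  assumes "\<forall>j<n. lam j \<in> circle"
  shows "sets (mpedmd_measure n G V lam c) = sets circle_borel"
  unfolding mpedmd_measure_eq[OF assms] by simp

text \<open>The form is linear in the matrix entries with coefficients depending only on the
  vectors, so entrywise limits and errors pass to it.\<close>

lemma mat_form_sum:
  assumes "A \<in> carrier_mat n n" "a \<in> carrier_vec n" "b \<in> carrier_vec n"
  shows "(A *\<^sub>v a) \<bullet>c b = (\<Sum>i<n. \<Sum>j<n. A $$ (i, j) * (vec_index a j * cnj (vec_index b i)))"
  by (simp add: cscalar_prod_sum[OF assms(3)] mult_mat_vec_index[OF assms(1,2)] sum_distrib_right mult.assoc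
      del: index_mult_mat_vec)

section \<open>Hilbert spaces and spectral measures of unitary operators\<close>

lemma Re_cinner_self: "Re (cinner u u) = (norm u)\<^sup>2" for u :: "'h::complex_hilbert"
proof -
  have "0 \<le> sqrt (Re (cinner u u))" by (simp flip: norm_eq_sqrt_cinner)
  then show ?thesis by (simp add: norm_eq_sqrt_cinner)
qed

lemma cinner_self: "cinner u u = complex_of_real ((norm u)\<^sup>2)" for u :: "'h::complex_hilbert"
  using cinner_commute[of u u] by (simp add: complex_eq_iff Re_cinner_self)

lemma cinner_add_right: "cinner u (v + w) = cinner u v + cinner u w" for u :: "'h::complex_hilbert"
  by (metis cinner_add_left cinner_commute complex_cnj_add)

lemma cinner_scaleC_right: "cinner u (scaleC c v) = cnj c * cinner u v" for u :: "'h::complex_hilbert"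
  by (metis cinner_commute cinner_scaleC_left complex_cnj_mult)

lemma norm_scaleC: "norm (scaleC c u) = cmod c * norm u" for u :: "'h::complex_hilbert"
proof -
  have "complex_of_real ((norm (scaleC c u))\<^sup>2) = (c * cnj c) * complex_of_real ((norm u)\<^sup>2)"
    by (simp add: cinner_scaleC_left cinner_scaleC_right mult.assoc del: of_real_power flip: cinner_self)
  also have "\<dots> = complex_of_real ((cmod c * norm u)\<^sup>2)"
    by (simp add: power_mult_distrib flip: complex_norm_square)
  finally have "(norm (scaleC c u))\<^sup>2 = (cmod c * norm u)\<^sup>2"
    by (simp only: of_real_eq_iff)
  then show ?thesis by (simp add: power2_eq_iff_nonneg)
qed

lemma norm_add_power2: "(norm (u + v))\<^sup>2 = (norm u)\<^sup>2 + 2 * Re (cinner u v) + (norm v)\<^sup>2"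
  for u v :: "'h::complex_hilbert"
proof -
  have "Re (cinner v u) = Re (cinner u v)"
    by (subst cinner_commute) simp
  then show ?thesis
    by (simp add: cinner_add_left cinner_add_right flip: Re_cinner_self)
qed

lemma cinner_Cauchy_Schwarz: "cmod (cinner u v) \<le> norm u * norm v" for u v :: "'h::complex_hilbert"
proof (cases "v = 0")
  case True
  then show ?thesis using cinner_scaleC_right[of u 0 0] scaleR_scaleC[of 0 "0::'h"] by simp
next
  case False
  \<comment> \<open>This \<open>c\<close> minimizes the norm of
    \<open>u + scaleC c v\<close>.\<close>
  define c where "c = - cinner u v / complex_of_real ((norm v)\<^sup>2)"
  have v: "0 < (norm v)\<^sup>2" using False by simp
  have "0 \<le> (norm (u + scaleC c v))\<^sup>2" by simp
  also have "\<dots> = (norm u)\<^sup>2 + 2 * Re (cnj c * cinner u v) + (cmod c)\<^sup>2 * (norm v)\<^sup>2"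
    by (simp add: norm_add_power2 cinner_scaleC_right norm_scaleC power_mult_distrib)
  also have "cnj c * cinner u v = - complex_of_real ((cmod (cinner u v))\<^sup>2 / (norm v)\<^sup>2)"
    by (simp only: c_def complex_cnj_divide complex_cnj_minus complex_cnj_complex_of_real of_real_divide
        complex_norm_square) simp
  also have "(cmod c)\<^sup>2 * (norm v)\<^sup>2 = (cmod (cinner u v))\<^sup>2 / (norm v)\<^sup>2"
  proof -
    have "cmod c = cmod (cinner u v) / (norm v)\<^sup>2"
      by (simp add: c_def norm_divide del: of_real_power)
    then show ?thesis using v by (simp add: power_divide power2_eq_square)
  qed
  finally have "(cmod (cinner u v))\<^sup>2 / (norm v)\<^sup>2 \<le> (norm u)\<^sup>2"
    by (simp only: Re_complex_of_real uminus_complex.sel)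
  then have "(cmod (cinner u v))\<^sup>2 \<le> (norm u * norm v)\<^sup>2"
    using v by (simp add: divide_le_eq power_mult_distrib)
  then show ?thesis by (rule power2_le_imp_le) simp
qed

lemma bounded_bilinear_cinner: "bounded_bilinear (cinner :: 'h::complex_hilbert \<Rightarrow> 'h \<Rightarrow> complex)"
proof
  show "\<exists>K. \<forall>a b::'h. cmod (cinner a b) \<le> norm a * norm b * K"
    by (intro exI[of _ 1]) (simp add: cinner_Cauchy_Schwarz)
qed (simp_all add: cinner_add_left cinner_add_right cinner_scaleC_left cinner_scaleC_right
      scaleR_scaleC scaleR_conv_of_real)

interpretation cinner: bounded_bilinear "cinner :: 'h::complex_hilbert \<Rightarrow> 'h \<Rightarrow> complex"
  by (rule bounded_bilinear_cinner)

lemma norm_diff_power2: "(norm (u - v))\<^sup>2 = (norm u)\<^sup>2 - 2 * Re (cinner u v) + (norm v)\<^sup>2"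
  for u v :: "'h::complex_hilbert"
  using norm_add_power2[of u "- v"] by (simp add: cinner.minus_right)

lemma scaleC_simps [simp]: "scaleC 1 u = u" "scaleC 0 u = 0" "scaleC c 0 = 0"
  "scaleC (- 1) u = - u" for u :: "'h::complex_hilbert"
  using scaleR_scaleC[of 1 u] scaleR_scaleC[of 0 u] scaleR_scaleC[of "-1" u] scaleC_add_right[of c 0 0]
  by auto

lemma scaleC_diff_right: "scaleC c (u - v) = scaleC c u - scaleC c v" for u v :: "'h::complex_hilbert"
  using scaleC_add_right[of c "u - v" v] by simp

text \<open>Perturbing the minimizer in the direction \<open>s\<close> by the optimal amount contradicts minimality unless
  the residual is orthogonal to \<open>s\<close>.\<close>

lemma cinner_eq_0_if_minimal:
  fixes r s :: "'h::complex_hilbert"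
  assumes min: "\<And>c. norm r \<le> norm (r - scaleC c s)"
  shows "cinner r s = 0"
proof (cases "s = 0")
  case False
  define c where "c = cinner r s / complex_of_real ((norm s)\<^sup>2)"
  have s: "0 < (norm s)\<^sup>2" using False by simp
  have "(norm r)\<^sup>2 \<le> (norm (r - scaleC c s))\<^sup>2"
    using min by (intro power_mono) auto
  also have "\<dots> = (norm r)\<^sup>2 - 2 * Re (cnj c * cinner r s) + (cmod c)\<^sup>2 * (norm s)\<^sup>2"
    by (simp add: norm_diff_power2 cinner_scaleC_right norm_scaleC power_mult_distrib)
  also have "cnj c * cinner r s = complex_of_real ((cmod (cinner r s))\<^sup>2 / (norm s)\<^sup>2)"
    by (simp only: c_def complex_cnj_divide complex_cnj_complex_of_real of_real_divide
        complex_norm_square) simp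
  also have "(cmod c)\<^sup>2 * (norm s)\<^sup>2 = (cmod (cinner r s))\<^sup>2 / (norm s)\<^sup>2"
  proof -
    have "cmod c = cmod (cinner r s) / (norm s)\<^sup>2"
      by (simp add: c_def norm_divide del: of_real_power)
    then show ?thesis using s by (simp add: power_divide power2_eq_square)
  qed
  finally have "(cmod (cinner r s))\<^sup>2 / (norm s)\<^sup>2 \<le> 0"
    by (simp only: Re_complex_of_real)
  then show ?thesis using s by (simp add: divide_le_0_iff)
qed (simp add: cinner.zero_right)

text \<open>By the parallelogram law a minimizing sequence is Cauchy, because midpoints of its
  members stay in \<open>S\<close> and so are no closer to \<open>u\<close> than the
  infimum.\<close>

lemma closest_point_exists:
  fixes S :: "'h::complex_hilbert set"
  assumes cl: "closed S" and ne: "S \<noteq> {}" and mid: "\<And>s t. s \<in> S \<Longrightarrow> t \<in> S \<Longrightarrow> scaleC (1/2) (s + t) \<in> S"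
  obtains y where "y \<in> S" "\<And>s. s \<in> S \<Longrightarrow> norm (u - y) \<le> norm (u - s)"
proof -
  define d where "d = (INF s\<in>S. norm (u - s))"
  have bdd: "bdd_below ((\<lambda>s. norm (u - s)) ` S)" by (auto intro: bdd_belowI[of _ 0])
  have d_le: "d \<le> norm (u - s)" if "s \<in> S" for s
    unfolding d_def using that by (intro cINF_lower[OF bdd])
  have d0: "0 \<le> d" unfolding d_def using ne by (intro cINF_greatest) auto
  have "\<exists>s\<in>S. norm (u - s) < d + inverse (real (Suc n))" for n
    using cINF_less_iff[OF ne bdd, of "d + inverse (real (Suc n))"] by (auto simp: d_def)
  then obtain s where s: "\<And>n. s n \<in> S" "\<And>n. norm (u - s n) < d + inverse (real (Suc n))"
    by metis
  \<comment> \<open>\<open>b n\<close> bounds the excess of the squared distance from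
    \<open>u\<close> to \<open>s n\<close> over the minimal one.\<close>
  define b where "b n = (d + inverse (real (Suc n)))\<^sup>2 - d\<^sup>2" for n
  have b: "b \<longlonglongrightarrow> 0"
  proof -
    have "b \<longlonglongrightarrow> (d + 0)\<^sup>2 - d\<^sup>2"
      unfolding b_def by (intro tendsto_intros LIMSEQ_inverse_real_of_nat)
    then show ?thesis by simp
  qed
  have est: "(norm (s m - s n))\<^sup>2 \<le> 2 * b m + 2 * b n" for m n
  proof -
    define x where "x = u - s m"
    define z where "z = u - s n"
    have "x + z = scaleC 2 (u - scaleC (1/2) (s m + s n))"
    proof -
      have "scaleC 2 (u - scaleC (1/2) (s m + s n)) = scaleC 2 u - scaleC 2 (scaleC (1/2) (s m + s n))"
        using scaleC_add_right[of 2 "u - scaleC (1/2) (s m + s n)" "scaleC (1/2) (s m + s n)"]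
        by (simp add: algebra_simps)
      moreover have "scaleC 2 u = u + u" using scaleC_add_left[of 1 1 u] by simp
      ultimately show ?thesis by (simp add: scaleC_scaleC x_def z_def)
    qed
    then have "norm (x + z) = 2 * norm (u - scaleC (1/2) (s m + s n))"
      by (simp only: norm_scaleC) simp
    then have "2 * d \<le> norm (x + z)"
      using d_le[OF mid[OF s(1)[of m] s(1)[of n]]] by simp
    then have "4 * d\<^sup>2 \<le> (norm (x + z))\<^sup>2"
      using power_mono[of "2 * d" "norm (x + z)" 2] d0 by (simp add: power_mult_distrib)
    moreover have "(norm (x - z))\<^sup>2 + (norm (x + z))\<^sup>2 = 2 * (norm x)\<^sup>2 + 2 * (norm z)\<^sup>2"
      by (simp add: norm_diff_power2 norm_add_power2)
    moreover have "(norm x)\<^sup>2 \<le> b m + d\<^sup>2" "(norm z)\<^sup>2 \<le> b n + d\<^sup>2"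
      using s(2)[of m] s(2)[of n] by (auto simp: b_def x_def z_def intro!: power_mono)
    moreover have "norm (x - z) = norm (s m - s n)" by (simp add: x_def z_def norm_minus_commute)
    ultimately show ?thesis by simp
  qed
  have "Cauchy s"
  proof (rule CauchyI)
    fix e :: real assume e: "0 < e"
    then obtain M where M: "\<And>n. n \<ge> M \<Longrightarrow> \<bar>b n\<bar> < e\<^sup>2 / 4"
      using LIMSEQ_D[OF b, of "e\<^sup>2 / 4"] by auto
    have "norm (s m - s n) < e" if "m \<ge> M" "n \<ge> M" for m n
    proof -
      have "(norm (s m - s n))\<^sup>2 < e\<^sup>2"
        using est[of m n] M[OF that(1)] M[OF that(2)] by linarith
      then show ?thesis using e by (meson power2_less_imp_less less_imp_le)
    qed
    then show "\<exists>M. \<forall>m\<ge>M. \<forall>n\<ge>M. norm (s m - s n) < e" by blast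
  qed
  then obtain y where y: "s \<longlonglongrightarrow> y" using Cauchy_convergent convergent_def by blast
  have "y \<in> S" using closed_sequentially[OF cl] s(1) y by blast
  moreover have "norm (u - y) \<le> d"
  proof (rule LIMSEQ_le)
    show "(\<lambda>n. norm (u - s n)) \<longlonglongrightarrow> norm (u - y)" by (intro tendsto_intros y)
    show "(\<lambda>n. d + inverse (real (Suc n))) \<longlonglongrightarrow> d"
      using tendsto_add[OF tendsto_const[of d] LIMSEQ_inverse_real_of_nat] by simp
  qed (use s(2) less_imp_le in blast)
  ultimately show thesis using d_le by (intro that[of y]) (auto intro: order_trans)
qed

text \<open>Justifies the definite description in \<open>orth_proj\<close>: the closest point exists
  and its residual is orthogonal to \<open>S\<close>.\<close>

lemma orth_proj_properties:
  fixes S :: "'h::complex_hilbert set"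
  assumes cl: "closed S" and zero: "0 \<in> S" and add: "\<And>s t. s \<in> S \<Longrightarrow> t \<in> S \<Longrightarrow> s + t \<in> S"
    and scale: "\<And>c s. s \<in> S \<Longrightarrow> scaleC c s \<in> S"
  shows "orth_proj S u \<in> S" and "s \<in> S \<Longrightarrow> cinner (orth_proj S u) s = cinner u s"
proof -
  have diff: "s - t \<in> S" if "s \<in> S" "t \<in> S" for s t
    using add[OF that(1) scale[OF that(2), of "-1"]] by simp
  obtain y where y: "y \<in> S" "\<And>s. s \<in> S \<Longrightarrow> norm (u - y) \<le> norm (u - s)"
    using closest_point_exists[OF cl, of u] zero add scale by (metis empty_iff)
  have orth: "cinner (u - y) s = 0" if "s \<in> S" for s
  proof (rule cinner_eq_0_if_minimal)
    fix c
    have "y + scaleC c s \<in> S" by (intro add scale y that)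
    then show "norm (u - y) \<le> norm (u - y - scaleC c s)"
      using y(2) by (metis diff_diff_eq)
  qed
  have "orth_proj S u = y"
    unfolding orth_proj_def
  proof (rule the_equality)
    show "y \<in> S \<and> (\<forall>s\<in>S. cinner (u - y) s = 0)" using y(1) orth by blast
    fix z assume z: "z \<in> S \<and> (\<forall>s\<in>S. cinner (u - z) s = 0)"
    then have zy: "z - y \<in> S" using diff y(1) by blast
    \<comment> \<open>Uniqueness: the difference of two candidates lies in \<open>S\<close> and is
      orthogonal to \<open>S\<close>, hence to itself.\<close>
    have "cinner (z - y) (z - y) = cinner (u - y) (z - y) - cinner (u - z) (z - y)"
      by (simp add: cinner.diff_left)
    also have "\<dots> = 0" using orth[OF zy] z zy by simp
    finally show "z = y" by (simp add: cinner_self)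
  qed
  with y(1) orth show "orth_proj S u \<in> S" and "s \<in> S \<Longrightarrow> cinner (orth_proj S u) s = cinner u s"
    by (auto simp: cinner.diff_left)
qed

text \<open>Over the complex numbers a quadratic form determines its operator by polarization, and
  the parallelogram law collapses the four terms. The weak spectral identity, known only for equal
  arguments, becomes a norm estimate in this way.\<close>

lemma sesquilinear_bound:
  fixes D :: "'h::complex_hilbert \<Rightarrow> 'h"
  assumes D: "clinear_op D" and q: "\<And>u. cmod (cinner (D u) u) \<le> e * (norm u)\<^sup>2"
  shows "norm (D u) \<le> 2 * e * norm u"
proof -
  have add: "D (x + y) = D x + D y" and scale: "D (scaleC c x) = scaleC c (D x)" for x y c
    using D by (auto simp: clinear_op_def)
  have diff: "D (x - y) = D x - D y" for x y
    using add[of "x - y" y] by (simp add: algebra_simps)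
  have polar: "cmod (cinner (D u) v) \<le> e * ((norm u)\<^sup>2 + (norm v)\<^sup>2)" for v
  proof -
    define q' where "q' x = cinner (D x) x" for x
    define w where "w = scaleC \<i> v"
    have nw: "norm w = norm v" by (simp add: w_def norm_scaleC)
    have eq: "4 * cinner (D u) v = (q' (u + v) - q' (u - v)) + \<i> * (q' (u + w) - q' (u - w))"
      by (simp add: q'_def w_def add diff scale cinner_add_left cinner_add_right cinner.diff_left
          cinner.diff_right cinner_scaleC_left cinner_scaleC_right algebra_simps)
    have qb: "cmod (q' x) \<le> e * (norm x)\<^sup>2" for x
      unfolding q'_def by (rule q)
    have par: "(norm (u + x))\<^sup>2 + (norm (u - x))\<^sup>2 = 2 * (norm u)\<^sup>2 + 2 * (norm x)\<^sup>2" for x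
      by (simp add: norm_add_power2 norm_diff_power2)
    have "4 * cmod (cinner (D u) v) \<le> cmod (q' (u + v) - q' (u - v)) + cmod (q' (u + w) - q' (u - w))"
      using arg_cong[OF eq, of cmod] norm_triangle_ineq[of "q' (u + v) - q' (u - v)" "\<i> * (q' (u + w) - q' (u - w))"]
      by (simp add: norm_mult)
    also have "\<dots> \<le> e * (norm (u + v))\<^sup>2 + e * (norm (u - v))\<^sup>2 + (e * (norm (u + w))\<^sup>2 + e * (norm (u - w))\<^sup>2)"
      by (intro add_mono order_trans[OF norm_triangle_ineq4] qb)
    also have "\<dots> = 4 * (e * ((norm u)\<^sup>2 + (norm v)\<^sup>2))"
      unfolding distrib_left[symmetric] par nw by simp
    finally show ?thesis by simp
  qed
  show ?thesis
  proof (cases "u = 0 \<or> D u = 0")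
    case True
    then have "D u = 0" using scale[of 0 u] by auto
    \<comment> \<open>For nonzero \<open>u\<close> the sign of \<open>e\<close> can be read off from
      the bound \<open>q\<close> at \<open>u\<close>.\<close>
    moreover have "0 \<le> e * norm u"
    proof (cases "u = 0")
      case False
      have "0 \<le> e * (norm u)\<^sup>2" using q[of u] norm_ge_zero order_trans by blast
      then show ?thesis using False by (simp add: zero_le_mult_iff)
    qed simp
    ultimately show ?thesis by simp
  next
    case False
    \<comment> \<open>\<open>D u\<close> rescaled to the norm of \<open>u\<close>, so that the two
      squares in \<open>polar\<close> coincide and give the factor 2.\<close>
    define v where "v = scaleC (complex_of_real (norm u / norm (D u))) (D u)"
    have nv: "norm v = norm u" using False by (simp add: v_def norm_scaleC norm_divide)
    have "cinner (D u) v = complex_of_real (norm u * norm (D u))"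
      using False by (simp add: v_def cinner_scaleC_right cinner_self power2_eq_square)
    then have "norm u * norm (D u) \<le> e * ((norm u)\<^sup>2 + (norm u)\<^sup>2)"
      using polar[of v] nv by (simp add: norm_mult)
    then have "norm u * norm (D u) \<le> norm u * (2 * e * norm u)"
      by (simp add: power2_eq_square algebra_simps)
    then show ?thesis using False by simp
  qed
qed

section \<open>Scalar measures of a projection-valued measure\<close>

locale pvm =
  fixes E :: "complex set \<Rightarrow> 'h::complex_hilbert \<Rightarrow> 'h"
  assumes pvm: "projection_valued_measure E"
begin

lemma E_projection: "U \<in> sets circle_borel \<Longrightarrow> projection_op (E U)"
  and E_empty: "E {} u = 0" and E_circle: "E circle u = u"
  and E_Int: "U \<in> sets circle_borel \<Longrightarrow> V \<in> sets circle_borel \<Longrightarrow> E U (E V u) = E (U \<inter> V) u"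
  and E_sums: "range B \<subseteq> sets circle_borel \<Longrightarrow> disjoint_family B \<Longrightarrow> (\<lambda>n::nat. E (B n) u) sums E (\<Union>n. B n) u"
  using pvm by (simp_all add: projection_valued_measure_def)

lemma E_add: "U \<in> sets circle_borel \<Longrightarrow> E U (u + v) = E U u + E U v"
  and E_scaleC: "U \<in> sets circle_borel \<Longrightarrow> E U (scaleC c u) = scaleC c (E U u)"
  using E_projection by (auto simp: projection_op_def clinear_op_def)

lemma E_zero: "U \<in> sets circle_borel \<Longrightarrow> E U 0 = 0"
  using E_scaleC[of U 0 0] by simp

lemma E_sum: "U \<in> sets circle_borel \<Longrightarrow> E U (\<Sum>i\<in>I. f i) = (\<Sum>i\<in>I. E U (f i))"
  by (induction I rule: infinite_finite_induct) (simp_all add: E_zero E_add)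

lemma cinner_E: "U \<in> sets circle_borel \<Longrightarrow> cinner (E U u) u = complex_of_real ((norm (E U u))\<^sup>2)"
  using E_projection[of U] unfolding projection_op_def by (metis cinner_self)

lemma scalar_measure_space: "space (scalar_measure E u) = circle"
  and scalar_measure_sets: "sets (scalar_measure E u) = sets circle_borel"
proof -
  have "sets circle_borel \<subseteq> Pow circle"
    using sets.space_closed[of circle_borel] by (simp add: space_restrict_space)
  moreover have "sigma_sets circle (sets circle_borel) = sets circle_borel"
    using sets.sigma_sets_eq[of circle_borel] by (simp add: space_restrict_space)
  ultimately show "space (scalar_measure E u) = circle" "sets (scalar_measure E u) = sets circle_borel"
    by (simp_all add: scalar_measure_def)
qed

text \<open>\<open>measure_of\<close> takes the prescribed values only for countably additive set
  functions. Additivity comes from the convergent series of \<open>E\<close>, tested against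
  \<open>u\<close>.\<close>

lemma emeasure_scalar_measure:
  assumes "U \<in> sets circle_borel"
  shows "emeasure (scalar_measure E u) U = ennreal ((norm (E U u))\<^sup>2)"
proof -
  define m where "m = (\<lambda>U. ennreal (Re (cinner (E U u) u)))"
  have m: "m U = ennreal ((norm (E U u))\<^sup>2)" if "U \<in> sets circle_borel" for U
    using that by (simp add: m_def cinner_E)
  have "emeasure (scalar_measure E u) U = m U"
    unfolding scalar_measure_def m_def[symmetric]
  proof (rule emeasure_measure_of_sigma)
    show "sigma_algebra circle (sets circle_borel)"
      using sets.sigma_algebra_axioms[of circle_borel] by (simp add: space_restrict_space)
    show "positive (sets circle_borel) m"
      by (simp add: positive_def m_def E_empty cinner.zero_left)
    show "countably_additive (sets circle_borel) m"
    proof (rule countably_additiveI)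
      fix B :: "nat \<Rightarrow> complex set"
      assume B: "range B \<subseteq> sets circle_borel" "disjoint_family B" "(\<Union>i. B i) \<in> sets circle_borel"
      have "(\<lambda>n. Re (cinner (E (B n) u) u)) sums Re (cinner (E (\<Union>n. B n) u) u)"
        by (intro sums_Re bounded_linear.sums[OF cinner.bounded_linear_left] E_sums B)
      then have "(\<lambda>n. (norm (E (B n) u))\<^sup>2) sums (norm (E (\<Union>n. B n) u))\<^sup>2"
        using B by (simp add: cinner_E image_subset_iff)
      then have "(\<Sum>n. ennreal ((norm (E (B n) u))\<^sup>2)) = ennreal ((norm (E (\<Union>n. B n) u))\<^sup>2)"
        by (intro suminf_ennreal_eq) auto
      moreover have "B n \<in> sets circle_borel" for n using B(1) by auto
      ultimately show "(\<Sum>n. m (B n)) = m (\<Union>n. B n)"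
        by (simp only: m B(3))
    qed
  qed fact
  then show ?thesis using m[OF assms] by simp
qed

lemma circle_sets: "circle \<in> sets circle_borel"
  using sets.top[of circle_borel] by (simp add: space_restrict_space)

lemma emeasure_scalar_measure_circle: "emeasure (scalar_measure E u) circle = ennreal ((norm u)\<^sup>2)"
  by (simp add: emeasure_scalar_measure circle_sets E_circle)

lemma finite_measure_scalar_measure: "finite_measure (scalar_measure E u)"
  by (rule finite_measureI) (simp add: scalar_measure_space emeasure_scalar_measure_circle)

lemma measure_scalar_measure:
  "U \<in> sets circle_borel \<Longrightarrow> measure (scalar_measure E u) U = (norm (E U u))\<^sup>2"
  by (simp add: measure_def emeasure_scalar_measure)

end

text \<open>Total boundedness gives finitely many small balls, which \<open>disjointed\<close> makes
  disjoint. The pieces form a sequence that is empty from \<open>m\<close> on, since countable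
  additivity of \<open>E\<close> speaks about sequences.\<close>

lemma circle_fine_partition:
  fixes e :: real
  assumes e: "0 < e"
  obtains m :: nat and B :: "nat \<Rightarrow> complex set" and c :: "nat \<Rightarrow> complex" where
    "range B \<subseteq> sets circle_borel" "disjoint_family B" "(\<Union>i. B i) = circle"
    "\<And>i. m \<le> i \<Longrightarrow> B i = {}" "\<And>i. i < m \<Longrightarrow> c i \<in> circle" "\<And>i z. z \<in> B i \<Longrightarrow> dist z (c i) < e"
proof -
  obtain C where C: "finite C" "C \<subseteq> circle" "circle \<subseteq> (\<Union>x\<in>C. ball x e)"
    using seq_compact_imp_totally_bounded[OF compact_imp_seq_compact[OF compact_sphere[of "0::complex" 1]],
        rule_format, OF e]
    by (elim exE conjE) (rule that)
  obtain c :: "nat \<Rightarrow> complex" and m where c: "C = c ` {i. i < m}"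
    using finite_imp_nat_seg_image_inj_on[OF C(1)] by (elim exE conjE) (rule that)
  define A where "A i = (if i < m then circle \<inter> ball (c i) e else {})" for i
  have "circle \<inter> ball (c i) e \<in> sets circle_borel" for i
    unfolding sets_restrict_space by (rule imageI) simp
  then have "A i \<in> sets circle_borel" for i
    by (cases "i < m") (simp_all only: A_def if_True if_False sets.empty_sets)
  then have A: "range A \<subseteq> sets circle_borel" by blast
  show thesis
  proof (rule that[of "disjointed A" m c])
    show "range (disjointed A) \<subseteq> sets circle_borel"
      by (rule sets.range_disjointed_sets[OF A])
    show "disjoint_family (disjointed A)" by (rule disjoint_family_disjointed)
    show "(\<Union>i. disjointed A i) = circle"
      unfolding UN_disjointed_eq
    proof (intro equalityI subsetI)
      fix z assume z: "z \<in> circle"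
      from subsetD[OF C(3) z] obtain i where "i < m" "z \<in> ball (c i) e" by (auto simp: c)
      then have "z \<in> A i" using z by (simp add: A_def)
      then show "z \<in> (\<Union>i. A i)" by blast
    qed (auto simp: A_def split: if_splits)
    show "disjointed A i = {}" if "m \<le> i" for i
      using that disjointed_subset[of A i] by (auto simp: A_def)
    show "c i \<in> circle" if "i < m" for i using C(2) that by (auto simp: c)
    show "dist z (c i) < e" if "z \<in> disjointed A i" for i z
      using that disjointed_subset[of A i] by (auto simp: A_def dist_commute split: if_splits)
  qed
qed

locale unitary_spectral = pvm E for E :: "complex set \<Rightarrow> 'h::complex_hilbert \<Rightarrow> 'h" +
  fixes K :: "'h \<Rightarrow> 'h"
  assumes K: "unitary_op K"
    and spectral: "\<And>u. cinner (K u) u = (LINT z|scalar_measure E u. z)"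
begin

lemma norm_K: "norm (K u) = norm u"
  using K by (simp add: unitary_op_def norm_eq_sqrt_cinner)

lemma K_add: "K (u + v) = K u + K v" and K_scaleC: "K (scaleC c u) = scaleC c (K u)"
  using K by (auto simp: unitary_op_def clinear_op_def)

lemma K_diff: "K (u - v) = K u - K v"
  using K_add[of "u - v" v] by (simp add: algebra_simps)

text \<open>Approximate \<open>K\<close> by \<open>T = \<Sum>i. c i * E (B i)\<close> for a partition \<open>B\<close> of the circle of mesh \<open>e\<close>:
  multiplicativity of \<open>E\<close> gives the powers of \<open>T\<close>, and the weak spectral identity bounds \<open>K - T\<close>.\<close>

lemma moment_step_approx:
  assumes e: "0 < e" "e \<le> 1"
  shows "cmod ((LINT z|scalar_measure E u. z ^ k) - cinner ((K ^^ k) u) u)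
    \<le> (real k + 2 * real k * 3 ^ k) * e * (norm u)\<^sup>2"
proof -
  obtain m :: nat and B :: "nat \<Rightarrow> complex set" and c :: "nat \<Rightarrow> complex" where
    B: "range B \<subseteq> sets circle_borel" "disjoint_family B" "(\<Union>i. B i) = circle"
    and Bm: "\<And>i. m \<le> i \<Longrightarrow> B i = {}" and c: "\<And>i. i < m \<Longrightarrow> c i \<in> circle"
    and Bc: "\<And>i z. z \<in> B i \<Longrightarrow> dist z (c i) < e"
    using circle_fine_partition[OF e(1)] by metis
  have Bs: "B i \<in> sets circle_borel" for i using B(1) by auto
  have E_partition: "(\<Sum>i<m. E (B i) u) = u" for u
  proof -
    have "(\<lambda>i. E (B i) u) sums u" using E_sums[OF B(1,2), of u] by (simp add: B(3) E_circle)
    moreover have "(\<lambda>i. E (B i) u) sums (\<Sum>i<m. E (B i) u)"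
      by (rule sums_finite) (use Bm E_empty in \<open>auto simp: not_less\<close>)
    ultimately show ?thesis by (rule sums_unique2[symmetric])
  qed
  define T where "T u = (\<Sum>i<m. scaleC (c i) (E (B i) u))" for u
  have scaleC_sum: "scaleC a (\<Sum>i\<in>I. f i) = (\<Sum>i\<in>I. scaleC a (f i))" for a I and f :: "nat \<Rightarrow> 'h"
    by (induction I rule: infinite_finite_induct) (simp_all add: scaleC_add_right)
  have T_lin: "clinear_op T"
    by (simp add: clinear_op_def T_def E_add[OF Bs] E_scaleC[OF Bs] scaleC_add_right sum.distrib
        scaleC_sum scaleC_scaleC mult.commute)
  have E_orth: "E (B i) (E (B j) u) = (if i = j then E (B i) u else 0)" for i j u
    using B(2) by (auto simp: E_Int[OF Bs Bs] disjoint_family_on_def E_empty)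
  have T_pow: "(T ^^ k) u = (\<Sum>i<m. scaleC (c i ^ k) (E (B i) u))" for k u
  proof (induction k)
    case 0
    then show ?case by (simp add: E_partition)
  next
    case (Suc k)
    have "E (B i) ((T ^^ k) u) = scaleC (c i ^ k) (E (B i) u)" if "i < m" for i
    proof -
      have "E (B i) ((T ^^ k) u) = (\<Sum>j<m. if i = j then scaleC (c i ^ k) (E (B i) u) else 0)"
        unfolding Suc E_sum[OF Bs] by (rule sum.cong) (auto simp: E_scaleC[OF Bs] E_orth)
      also have "\<dots> = scaleC (c i ^ k) (E (B i) u)" using that by simp
      finally show ?thesis .
    qed
    then show ?case by (simp add: T_def[of "(T ^^ k) u"] scaleC_scaleC)
  qed
  have close: "cmod ((LINT z|scalar_measure E u. z ^ k) - cinner ((T ^^ k) u) u) \<le> real k * e * (norm u)\<^sup>2" for k u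
  proof -
    define M where "M = scalar_measure E u"
    interpret finite_measure M unfolding M_def by (rule finite_measure_scalar_measure)
    have sM: "space M = circle" "sets M = sets circle_borel"
      by (simp_all add: M_def scalar_measure_space scalar_measure_sets)
    \<comment> \<open>The step function with value \<open>c i ^ k\<close> on \<open>B i\<close>. Its
      integral is the form of \<open>T ^^ k\<close> at \<open>u\<close>, and on the circle it is
      within \<open>k * e\<close> of the power function.\<close>
    define s where "s z = (\<Sum>i<m. indicator (B i) z *\<^sub>R c i ^ k)" for z :: complex
    have s_eq: "s z = c i ^ k" and im: "i < m" if "z \<in> B i" for z i
    proof -
      show im: "i < m" using Bm[of i] that by (auto simp: not_less[symmetric])
      have "indicator (B j) z *\<^sub>R c j ^ k = (if j = i then c i ^ k else 0)" for j
        using that B(2) by (auto simp: disjoint_family_on_def indicator_def)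
      then show "s z = c i ^ k" using im by (simp add: s_def)
    qed
    have int_B: "integrable M (indicator (B i) :: complex \<Rightarrow> real)" for i
      using Bs by (intro integrable_real_indicator) (auto simp: sM emeasure_finite less_top[symmetric])
    have int_B': "integrable M (\<lambda>z. indicator (B i) z *\<^sub>R c i ^ k)" for i
      by (intro integrable_scaleR_left int_B)
    have int_s: "integrable M s"
      unfolding s_def by (intro Bochner_Integration.integrable_sum int_B')
    have B_sub: "B i \<inter> circle = B i" for i
      using B(3) by blast
    have "(LINT z|M. s z) = (\<Sum>i<m. measure M (B i) *\<^sub>R c i ^ k)"
    proof -
      have "(LINT z|M. indicator (B i) z *\<^sub>R c i ^ k) = measure M (B i) *\<^sub>R c i ^ k" for i
      proof -
        have "(LINT z|M. indicator (B i) z *\<^sub>R c i ^ k) = (LINT z|M. indicator (B i) z) *\<^sub>R c i ^ k"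
          by (rule integral_scaleR_left) (rule int_B)
        then show ?thesis by (simp add: sM B_sub)
      qed
      then show ?thesis unfolding s_def by (simp only: Bochner_Integration.integral_sum[OF int_B'])
    qed
    also have "\<dots> = (\<Sum>i<m. cinner (scaleC (c i ^ k) (E (B i) u)) u)"
      by (simp add: M_def measure_scalar_measure[OF Bs] cinner_scaleC_left cinner_E[OF Bs]
          scaleR_conv_of_real mult.commute)
    also have "\<dots> = cinner ((T ^^ k) u) u" by (simp add: T_pow cinner.sum_left)
    finally have s: "(LINT z|M. s z) = cinner ((T ^^ k) u) u" .
    have meas: "(\<lambda>z. z ^ k) \<in> borel_measurable M"
      using borel_measurable_continuous_on_restrict[of circle "\<lambda>z::complex. z ^ k"]
      by (simp add: measurable_cong_sets[OF sM(2) refl] continuous_intros)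
    have int_k: "integrable M (\<lambda>z. z ^ k)"
      by (rule integrable_const_bound[of _ 1, OF AE_I2 meas]) (simp add: sM norm_power)
    have "cmod ((LINT z|M. z ^ k) - (LINT z|M. s z)) = cmod (LINT z|M. z ^ k - s z)"
      by (simp add: Bochner_Integration.integral_diff int_s int_k)
    also have "\<dots> \<le> (LINT z|M. cmod (z ^ k - s z))"
      by (rule integral_norm_bound)
    also have "\<dots> \<le> (LINT z|M. real k * e)"
    proof (rule integral_mono)
      fix z assume "z \<in> space M"
      then have z: "z \<in> circle" by (simp add: sM)
      then obtain i where i: "z \<in> B i" using B(3) by blast
      have "cmod (z ^ k - c i ^ k) \<le> real k * cmod (z - c i)"
        using z c[OF im[OF i]] by (intro norm_power_diff) auto
      also have "\<dots> \<le> real k * e"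
        using Bc[OF i] by (intro mult_left_mono) (auto simp: dist_norm)
      finally show "cmod (z ^ k - s z) \<le> real k * e" by (simp add: s_eq[OF i])
    qed (auto intro!: integrable_norm Bochner_Integration.integrable_diff int_s int_k)
    also have "\<dots> = real k * e * (norm u)\<^sup>2"
      using measure_scalar_measure[OF circle_sets, of u] by (simp add: sM M_def scalar_measure_space E_circle)
    finally show ?thesis by (simp only: s flip: M_def)
  qed
  \<comment> \<open>The case k = 1 of \<open>close\<close> compares quadratic forms only;
    polarization turns it into a norm bound at the cost of a factor 2.\<close>
  have KT: "norm (K v - T v) \<le> 2 * e * norm v" for v
  proof (rule sesquilinear_bound)
    show "clinear_op (\<lambda>v. K v - T v)"
      using T_lin by (simp add: clinear_op_def K_add K_scaleC scaleC_diff_right)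
    show "cmod (cinner (K u - T u) u) \<le> e * (norm u)\<^sup>2" for u
      using close[where k = 1 and u = u] by (simp add: cinner.diff_left spectral)
  qed
  \<comment> \<open>Isometry of \<open>K\<close> contributes 1, and e at most 1 leaves at most 2 for
    the error. This crude bound only affects a constant independent of \<open>e\<close>.\<close>
  have T_norm: "norm (T v) \<le> 3 * norm v" for v
  proof -
    have "norm (T v) \<le> norm (K v) + norm (K v - T v)"
      using norm_triangle_ineq4[of "K v" "K v - T v"] by simp
    also have "\<dots> \<le> norm v + 2 * norm v"
      using KT[of v] mult_right_mono[OF e(2) norm_ge_zero[of v]] by (simp add: norm_K)
    finally show ?thesis by simp
  qed
  have T_pow_norm: "norm ((T ^^ k) u) \<le> 3 ^ k * norm u" for k
  proof (induction k)
    case (Suc k)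
    then show ?case using T_norm[of "(T ^^ k) u"] by simp
  qed simp
  have pow_close: "norm ((K ^^ k) u - (T ^^ k) u) \<le> 2 * real k * 3 ^ k * e * norm u" for k
  proof (induction k)
    case (Suc k)
    \<comment> \<open>Telescoping: the isometry \<open>K\<close> preserves the old error, and the
      new error is of order \<open>e\<close> at \<open>(T ^^ k) u\<close>.\<close>
    have "(K ^^ Suc k) u - (T ^^ Suc k) u
        = K ((K ^^ k) u - (T ^^ k) u) + (K ((T ^^ k) u) - T ((T ^^ k) u))"
      by (simp add: K_diff)
    also have "norm \<dots> \<le> norm ((K ^^ k) u - (T ^^ k) u) + 2 * e * norm ((T ^^ k) u)"
      using norm_triangle_ineq[of "K ((K ^^ k) u - (T ^^ k) u)" "K ((T ^^ k) u) - T ((T ^^ k) u)"]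
        KT[of "(T ^^ k) u"] by (simp add: norm_K)
    also have "\<dots> \<le> 2 * real k * 3 ^ k * e * norm u + 2 * e * (3 ^ k * norm u)"
      using e by (intro add_mono Suc mult_left_mono T_pow_norm) auto
    also have "\<dots> = 2 * real (Suc k) * 3 ^ k * e * norm u" by (simp add: algebra_simps)
    also have "\<dots> \<le> 2 * real (Suc k) * 3 ^ Suc k * e * norm u"
      using e by (intro mult_right_mono mult_left_mono) auto
    finally show ?case .
  qed simp
  have "cmod (cinner ((T ^^ k) u) u - cinner ((K ^^ k) u) u) \<le> norm ((K ^^ k) u - (T ^^ k) u) * norm u"
    using cinner_Cauchy_Schwarz[of "(T ^^ k) u - (K ^^ k) u" u]
    by (simp add: cinner.diff_left norm_minus_commute)
  also have "\<dots> \<le> 2 * real k * 3 ^ k * e * norm u * norm u"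
    by (intro mult_right_mono pow_close) simp
  finally have "cmod (cinner ((T ^^ k) u) u - cinner ((K ^^ k) u) u) \<le> 2 * real k * 3 ^ k * e * (norm u)\<^sup>2"
    by (simp add: power2_eq_square mult.assoc)
  with close[where k = k and u = u] norm_triangle_ineq[of "(LINT z|scalar_measure E u. z ^ k) - cinner ((T ^^ k) u) u"
      "cinner ((T ^^ k) u) u - cinner ((K ^^ k) u) u"]
  show ?thesis by (simp add: algebra_simps)
qed

text \<open>The spectral identity prescribes the first moment only; multiplicativity of
  \<open>E\<close> yields the others. The constant in the step estimate does not depend on the mesh,
  which can therefore tend to 0.\<close>

lemma moment_eq: "(LINT z|scalar_measure E u. z ^ k) = cinner ((K ^^ k) u) u"
proof -
  define C where "C = (real k + 2 * real k * 3 ^ k) * (norm u)\<^sup>2"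
  define x where "x = cmod ((LINT z|scalar_measure E u. z ^ k) - cinner ((K ^^ k) u) u)"
  have "x \<le> C * inverse (real (Suc n))" for n
    using moment_step_approx[of "inverse (real (Suc n))" u k]
    by (simp add: x_def C_def algebra_simps inverse_le_1_iff del: of_nat_Suc)
  then have "x \<le> C * 0"
    by (intro LIMSEQ_le_const[of "\<lambda>n. C * inverse (real (Suc n))"] tendsto_intros LIMSEQ_inverse_real_of_nat) auto
  then show ?thesis by (simp add: x_def)
qed

end

section \<open>Wasserstein convergence on the circle from moments\<close>

text \<open>On the circle these are all real trigonometric polynomials: a negative power is the
  conjugate of a positive one and has the same real part up to conjugating the coefficient. Their
  integrals are thus determined by moments with natural exponents.\<close>

inductive trig_poly :: "(complex \<Rightarrow> real) \<Rightarrow> bool" where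
  monomial: "trig_poly (\<lambda>z. Re (c * z ^ k))"
| add: "trig_poly p \<Longrightarrow> trig_poly q \<Longrightarrow> trig_poly (\<lambda>z. p z + q z)"

text \<open>The product-to-sum formula: a product of real parts is half of Re(ab) plus Re(a cnj b),
  and on the circle \<open>z ^ k * cnj (z ^ l)\<close> is a natural power when
  \<open>l \<le> k\<close>. The other order follows by symmetry.\<close>

lemma trig_poly_monomial_mult:
  "\<exists>r. trig_poly r \<and> (\<forall>z\<in>circle. r z = Re (c * z ^ k) * Re (d * z ^ l))"
proof -
  have *: "\<exists>r. trig_poly r \<and> (\<forall>z\<in>circle. r z = Re (c * z ^ k) * Re (d * z ^ l))" if "l \<le> k" for c d k l
  proof (intro exI conjI ballI)
    show "trig_poly (\<lambda>z. Re (c * d / 2 * z ^ (k + l)) + Re (c * cnj d / 2 * z ^ (k - l)))"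
      by (intro trig_poly.intros)
    fix z :: complex assume "z \<in> circle"
    then have z: "z * cnj z = 1" by (simp add: complex_norm_square[symmetric])
    have "z ^ k * cnj z ^ l = z ^ (k - l) * (z * cnj z) ^ l"
      using that by (simp add: power_mult_distrib power_add[symmetric] mult.assoc[symmetric])
    then have k: "z ^ k * cnj (z ^ l) = z ^ (k - l)" by (simp add: z)
    have Re_mult: "Re a * Re b = (Re (a * b) + Re (a * cnj b)) / 2" for a b
      by simp
    have "Re (c * z ^ k) * Re (d * z ^ l) =
      (Re (c * d * z ^ (k + l)) + Re (c * cnj d * (z ^ k * cnj (z ^ l)))) / 2"
      by (subst Re_mult) (simp only: power_add complex_cnj_mult mult_ac)
    also have "\<dots> = Re (c * d * z ^ (k + l) / 2) + Re (c * cnj d * z ^ (k - l) / 2)"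
      by (simp only: k Re_divide_numeral add_divide_distrib)
    finally show "Re (c * d / 2 * z ^ (k + l)) + Re (c * cnj d / 2 * z ^ (k - l)) =
      Re (c * z ^ k) * Re (d * z ^ l)"
      by (simp only: times_divide_eq_left)
  qed
  show ?thesis
  proof (cases "l \<le> k")
    case False
    then show ?thesis using *[of k l d c] by (simp add: mult.commute)
  qed (rule *)
qed

lemma trig_poly_mult:
  assumes "trig_poly p" "trig_poly q"
  shows "\<exists>r. trig_poly r \<and> (\<forall>z\<in>circle. r z = p z * q z)"
  using assms(1)
proof induction
  case (monomial c k)
  show ?case using assms(2)
  proof induction
    case (monomial d l)
    show ?case by (rule trig_poly_monomial_mult)
  next
    case (add p q)
    then obtain r s where "trig_poly r" "\<forall>z\<in>circle. r z = Re (c * z ^ k) * p z"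
      "trig_poly s" "\<forall>z\<in>circle. s z = Re (c * z ^ k) * q z" by auto
    then show ?case by (intro exI[of _ "\<lambda>z. r z + s z"]) (auto intro: trig_poly.add simp: distrib_left)
  qed
next
  case (add p1 p2)
  then obtain r s where "trig_poly r" "\<forall>z\<in>circle. r z = p1 z * q z"
    "trig_poly s" "\<forall>z\<in>circle. s z = p2 z * q z" by auto
  then show ?case by (intro exI[of _ "\<lambda>z. r z + s z"]) (auto intro: trig_poly.add simp: distrib_right)
qed

text \<open>Makes the Stone-Weierstrass theorem for real polynomials on the plane available for
  functions controlled by moments.\<close>

lemma real_polynomial_function_trig_poly:
  fixes p :: "complex \<Rightarrow> real"
  assumes "real_polynomial_function p"
  shows "\<exists>r. trig_poly r \<and> (\<forall>z\<in>circle. r z = p z)"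
  using assms
proof induction
  case (linear f)
  \<comment> \<open>A real linear functional on the complex plane is the real part of multiplication
    by a fixed complex number.\<close>
  have eq: "f z = Re (Complex (f 1) (- f \<i>) * z ^ 1)" for z
  proof -
    interpret f: bounded_linear f by fact
    have "f z = f (Re z *\<^sub>R 1 + Im z *\<^sub>R \<i>)"
      by (rule arg_cong[where f = f]) (simp add: complex_eq_iff)
    then show ?thesis by (simp add: f.add f.scaleR mult.commute)
  qed
  show ?case
    by (intro exI[of _ "\<lambda>z. Re (Complex (f 1) (- f \<i>) * z ^ 1)"] conjI ballI trig_poly.monomial eq[symmetric])
next
  case (const c)
  show ?case using trig_poly.monomial[of "of_real c" 0] by (intro exI[of _ "\<lambda>z. c"]) simp
next
  case (add f g)
  then obtain r s where "trig_poly r" "\<forall>z\<in>circle. r z = f z" "trig_poly s" "\<forall>z\<in>circle. s z = g z" by auto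
  then show ?case by (intro exI[of _ "\<lambda>z. r z + s z"]) (auto intro: trig_poly.add)
next
  case (mult f g)
  then obtain r s where rs: "trig_poly r" "\<forall>z\<in>circle. r z = f z" "trig_poly s" "\<forall>z\<in>circle. s z = g z" by auto
  with trig_poly_mult[OF rs(1,3)] show ?case by auto
qed

lemma trig_poly_continuous: "trig_poly p \<Longrightarrow> continuous_on S p"
  by (induction rule: trig_poly.induct) (intro continuous_intros; assumption)+

lemma trig_poly_dense:
  fixes f :: "complex \<Rightarrow> real"
  assumes "continuous_on circle f" "0 < e"
  obtains p where "trig_poly p" "\<And>z. z \<in> circle \<Longrightarrow> \<bar>f z - p z\<bar> < e"
proof -
  obtain g where "real_polynomial_function g" "\<And>z. z \<in> circle \<Longrightarrow> \<bar>f z - g z\<bar> < e"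
    using Stone_Weierstrass_real_polynomial_function[OF compact_sphere assms] by metis
  with real_polynomial_function_trig_poly[of g] that show ?thesis by metis
qed

section \<open>Integration against probability measures on the circle\<close>

lemma integrable_circle_measure:
  fixes f :: "complex \<Rightarrow> 'b::{banach, second_countable_topology}"
  assumes M: "sets M = sets circle_borel" "emeasure M circle = 1" and f: "continuous_on circle f"
  shows "integrable M f"
proof -
  have sp: "space M = circle"
    using sets_eq_imp_space_eq[OF M(1)] by (simp add: space_restrict_space)
  interpret finite_measure M
    by (rule finite_measureI) (simp add: sp M)
  obtain B where B: "\<And>z. z \<in> circle \<Longrightarrow> norm (f z) \<le> B"
    using compact_continuous_image[OF f compact_sphere] compact_imp_bounded bounded_iff
    by (metis imageI)
  have "f \<in> borel_measurable M"
    using borel_measurable_continuous_on_restrict[OF f] by (simp add: measurable_cong_sets[OF M(1) refl])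
  then show ?thesis
    by (rule integrable_const_bound[of _ B, rotated]) (use B sp in auto)
qed

lemma integral_circle_measure_bound:
  fixes f :: "complex \<Rightarrow> real"
  assumes M: "sets M = sets circle_borel" "emeasure M circle = 1" and f: "continuous_on circle f"
    and B: "\<And>z. z \<in> circle \<Longrightarrow> \<bar>f z\<bar> \<le> B"
  shows "\<bar>LINT z|M. f z\<bar> \<le> B"
proof -
  have sp: "space M = circle"
    using sets_eq_imp_space_eq[OF M(1)] by (simp add: space_restrict_space)
  interpret finite_measure M
    by (rule finite_measureI) (simp add: sp M)
  have "\<bar>LINT z|M. f z\<bar> \<le> (LINT z|M. \<bar>f z\<bar>)"
    by (rule integral_abs_bound)
  also have "\<dots> \<le> (LINT z|M. B)"
    by (rule integral_mono) (use B sp in \<open>auto intro!: integrable_circle_measure[OF M] continuous_intros f\<close>)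
  also have "\<dots> = B"
    using M by (simp add: measure_def sp)
  finally show ?thesis .
qed

lemma integral_circle_measure_close:
  fixes f g :: "complex \<Rightarrow> real"
  assumes M: "sets M = sets circle_borel" "emeasure M circle = 1" and f: "continuous_on circle f"
    and g: "continuous_on circle g" and B: "\<And>z. z \<in> circle \<Longrightarrow> \<bar>f z - g z\<bar> \<le> B"
  shows "\<bar>(LINT z|M. f z) - (LINT z|M. g z)\<bar> \<le> B"
  using integral_circle_measure_bound[OF M continuous_on_diff[OF f g] B]
  by (simp add: Bochner_Integration.integral_diff integrable_circle_measure[OF M] f g)

text \<open>The measures are known to be probability measures only eventually along the filter, so
  linearity of the integral is also used only eventually.\<close>

lemma trig_poly_integral_tendsto:
  assumes \<nu>: "\<forall>\<^sub>F i in Fl. sets (\<nu> i) = sets circle_borel \<and> emeasure (\<nu> i) circle = 1"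
    and \<mu>: "sets \<mu> = sets circle_borel" "emeasure \<mu> circle = 1"
    and moments: "\<And>k. ((\<lambda>i. LINT z|\<nu> i. z ^ k) \<longlongrightarrow> (LINT z|\<mu>. z ^ k)) Fl"
    and p: "trig_poly p"
  shows "((\<lambda>i. LINT z|\<nu> i. p z) \<longlongrightarrow> (LINT z|\<mu>. p z)) Fl"
  using p
proof induction
  case (monomial c k)
  have eq: "(LINT z|M. Re (c * z ^ k)) = Re (c * (LINT z|M. z ^ k))"
    if "sets M = sets circle_borel \<and> emeasure M circle = 1" for M
  proof -
    have "integrable M (\<lambda>z. z ^ k)"
      using that by (intro integrable_circle_measure continuous_intros) auto
    then show ?thesis
      by (subst integral_bounded_linear[OF bounded_linear_Re]) auto
  qed
  have "((\<lambda>i. Re (c * (LINT z|\<nu> i. z ^ k))) \<longlongrightarrow> Re (c * (LINT z|\<mu>. z ^ k))) Fl"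
    by (intro tendsto_intros moments)
  moreover have "\<forall>\<^sub>F i in Fl. Re (c * (LINT z|\<nu> i. z ^ k)) = (LINT z|\<nu> i. Re (c * z ^ k))"
    using \<nu> by eventually_elim (rule eq[symmetric])
  ultimately show ?case
    unfolding eq[OF conjI[OF \<mu>]] by (rule Lim_transform_eventually)
next
  case (add p q)
  have eq: "(LINT z|M. p z + q z) = (LINT z|M. p z) + (LINT z|M. q z)"
    if "sets M = sets circle_borel \<and> emeasure M circle = 1" for M
    using that by (intro Bochner_Integration.integral_add integrable_circle_measure trig_poly_continuous add) auto
  have "((\<lambda>i. (LINT z|\<nu> i. p z) + (LINT z|\<nu> i. q z)) \<longlongrightarrow> (LINT z|\<mu>. p z) + (LINT z|\<mu>. q z)) Fl"
    by (intro tendsto_intros add.IH)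
  moreover have "\<forall>\<^sub>F i in Fl. (LINT z|\<nu> i. p z) + (LINT z|\<nu> i. q z) = (LINT z|\<nu> i. p z + q z)"
    using \<nu> by eventually_elim (rule eq[symmetric])
  ultimately show ?case
    unfolding eq[OF conjI[OF \<mu>]] by (rule Lim_transform_eventually)
qed

text \<open>A uniformly close trigonometric polynomial changes each integral by at most e/3, because
  all masses are 1.\<close>

lemma continuous_integral_tendsto:
  fixes f :: "complex \<Rightarrow> real"
  assumes \<nu>: "\<forall>\<^sub>F i in Fl. sets (\<nu> i) = sets circle_borel \<and> emeasure (\<nu> i) circle = 1"
    and \<mu>: "sets \<mu> = sets circle_borel" "emeasure \<mu> circle = 1"
    and moments: "\<And>k. ((\<lambda>i. LINT z|\<nu> i. z ^ k) \<longlongrightarrow> (LINT z|\<mu>. z ^ k)) Fl"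
    and f: "continuous_on circle f"
  shows "((\<lambda>i. LINT z|\<nu> i. f z) \<longlongrightarrow> (LINT z|\<mu>. f z)) Fl"
proof (rule tendstoI)
  fix e :: real assume e: "0 < e"
  obtain p where p: "trig_poly p" "\<And>z. z \<in> circle \<Longrightarrow> \<bar>f z - p z\<bar> < e / 3"
    using trig_poly_dense[OF f, of "e / 3"] e by auto
  have close: "\<bar>(LINT z|M. f z) - (LINT z|M. p z)\<bar> \<le> e / 3"
    if "sets M = sets circle_borel" "emeasure M circle = 1" for M
    by (rule integral_circle_measure_close[OF that f trig_poly_continuous[OF p(1)] less_imp_le[OF p(2)]])
  have "\<forall>\<^sub>F i in Fl. dist (LINT z|\<nu> i. p z) (LINT z|\<mu>. p z) < e / 3"
    using tendstoD[OF trig_poly_integral_tendsto[OF \<nu> \<mu> moments p(1)], of "e / 3"] e by simp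
  with \<nu> show "\<forall>\<^sub>F i in Fl. dist (LINT z|\<nu> i. f z) (LINT z|\<mu>. f z) < e"
  proof eventually_elim
    case (elim i)
    then show ?case
      using close[of "\<nu> i"] close[OF \<mu>] unfolding dist_real_def by linarith
  qed
qed

text \<open>Tent functions of radius \<open>e\<close> around finitely many centres, divided by their
  sum; the sum is positive on the circle because the balls cover it.\<close>

lemma circle_partition_of_unity:
  fixes e :: real
  assumes e: "0 < e"
  shows "\<exists>(C :: complex set) h :: complex \<Rightarrow> complex \<Rightarrow> real. finite C \<and> C \<subseteq> circle \<and>
    (\<forall>c. continuous_on circle (h c)) \<and> (\<forall>c z. 0 \<le> h c z) \<and>
    (\<forall>z\<in>circle. (\<Sum>c\<in>C. h c z) = 1) \<and> (\<forall>c z. h c z \<noteq> 0 \<longrightarrow> dist z c < e)"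
proof -
  obtain C where C: "finite C" "C \<subseteq> circle" "circle \<subseteq> (\<Union>c\<in>C. ball c e)"
    using seq_compact_imp_totally_bounded[OF compact_imp_seq_compact[OF compact_sphere[of "0::complex" 1]],
        rule_format, OF e]
    by (elim exE conjE) (rule that)
  define b where "b c z = max 0 (e - dist z c)" for c z :: complex
  define S where "S z = (\<Sum>c\<in>C. b c z)" for z
  have S: "0 < S z" if "z \<in> circle" for z
  proof -
    from subsetD[OF C(3) that] obtain c where "c \<in> C" "dist c z < e" by auto
    then show ?thesis
      unfolding S_def by (intro sum_pos2[OF C(1), of c]) (auto simp: b_def dist_commute)
  qed
  show ?thesis
  proof (intro exI[of _ C] exI[of _ "\<lambda>c z. b c z / S z"] conjI allI ballI impI)
    show "continuous_on circle (\<lambda>z. b c z / S z)" for c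
      using S unfolding b_def S_def by (intro continuous_intros) (auto simp: less_le)
    show "0 \<le> b c z / S z" for c z
      by (auto simp: b_def S_def intro!: divide_nonneg_nonneg sum_nonneg)
    show "(\<Sum>c\<in>C. b c z / S z) = 1" if "z \<in> circle" for z
      using S[OF that] by (simp add: sum_divide_distrib[symmetric] S_def)
    show "dist z c < e" if "b c z / S z \<noteq> 0" for c z
      using that by (auto simp: b_def max_def split: if_splits)
  qed (use C in auto)
qed

section \<open>Uniformity over Lipschitz test functions\<close>

lemma W1_nonneg: "0 \<le> W1 \<mu> \<nu>"
  unfolding W1_def
  by (rule SUP_upper2[of "\<lambda>_. 0"]) (auto simp: zero_ereal_def lipschitz_on_def)

text \<open>Convergence of integrals concerns one test function at a time, whereas \<open>W1\<close>
  takes a supremum. Interpolating every 1-Lipschitz function with the same finite partition of unity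
  leaves finitely many integrals to control.\<close>

lemma W1_tendsto_0:
  assumes \<nu>: "\<forall>\<^sub>F i in Fl. sets (\<nu> i) = sets circle_borel \<and> emeasure (\<nu> i) circle = 1"
    and \<mu>: "sets \<mu> = sets circle_borel" "emeasure \<mu> circle = 1"
    and moments: "\<And>k. ((\<lambda>i. LINT z|\<nu> i. z ^ k) \<longlongrightarrow> (LINT z|\<mu>. z ^ k)) Fl"
    and e: "0 < e"
  shows "\<forall>\<^sub>F i in Fl. W1 \<mu> (\<nu> i) \<le> ereal e"
proof -
  have "0 < e / 4" using e by simp
  from circle_partition_of_unity[OF this]
  obtain C :: "complex set" and h :: "complex \<Rightarrow> complex \<Rightarrow> real" where C: "finite C" "C \<subseteq> circle"
    and h: "\<And>c. continuous_on circle (h c)" "\<And>c z. 0 \<le> h c z"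
      "\<And>z. z \<in> circle \<Longrightarrow> (\<Sum>c\<in>C. h c z) = 1" "\<And>c z. h c z \<noteq> 0 \<Longrightarrow> dist z c < e / 4"
    by blast
  define err where "err i = (\<Sum>c\<in>C. \<bar>(LINT z|\<nu> i. h c z) - (LINT z|\<mu>. h c z)\<bar>)" for i
  have "(err \<longlongrightarrow> (\<Sum>c\<in>C. \<bar>(LINT z|\<mu>. h c z) - (LINT z|\<mu>. h c z)\<bar>)) Fl"
    unfolding err_def by (intro tendsto_intros continuous_integral_tendsto[OF \<nu> \<mu> moments] h)
  then have "(err \<longlongrightarrow> 0) Fl" by simp
  then have "\<forall>\<^sub>F i in Fl. err i < e / 4"
    using order_tendstoD(2)[of err 0 Fl "e / 4"] e by simp
  with \<nu> show ?thesis
  proof eventually_elim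
    case (elim i)
    then have \<nu>i: "sets (\<nu> i) = sets circle_borel" "emeasure (\<nu> i) circle = 1" by auto
    show ?case
      unfolding W1_def
    proof (rule SUP_least)
      fix \<phi> :: "complex \<Rightarrow> real" assume "\<phi> \<in> {\<phi>. 1-lipschitz_on circle \<phi>}"
      then have lip: "1-lipschitz_on circle \<phi>" by simp
      \<comment> \<open>Subtracting a constant does not affect the difference of integrals against
        two probability measures, and it bounds the function by the diameter 2 of the
        circle.\<close>
      define \<phi>0 where "\<phi>0 z = \<phi> z - \<phi> 1" for z
      define s where "s z = (\<Sum>c\<in>C. \<phi>0 c * h c z)" for z
      have cont: "continuous_on circle \<phi>" by (rule lipschitz_on_continuous_on[OF lip])
      then have cont0: "continuous_on circle \<phi>0" unfolding \<phi>0_def by (intro continuous_intros)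
      have conts: "continuous_on circle s" unfolding s_def by (intro continuous_intros h)
      have lip0: "\<bar>\<phi>0 z - \<phi>0 c\<bar> \<le> dist z c" if "z \<in> circle" "c \<in> circle" for z c
        using lipschitz_onD[OF lip that] by (simp add: \<phi>0_def dist_real_def)
      have bnd: "\<bar>\<phi>0 c\<bar> \<le> 2" if "c \<in> circle" for c
        using lip0[OF that, of 1] norm_triangle_ineq4[of c 1] that by (simp add: \<phi>0_def dist_norm)
      \<comment> \<open>Only centres within e/4 of \<open>z\<close> carry weight at
        \<open>z\<close>, so the Lipschitz bound controls every contributing term.\<close>
      have close: "\<bar>\<phi>0 z - s z\<bar> \<le> e / 4" if z: "z \<in> circle" for z
      proof -
        have "\<phi>0 z - s z = (\<Sum>c\<in>C. (\<phi>0 z - \<phi>0 c) * h c z)"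
          using h(3)[OF z] by (simp add: s_def left_diff_distrib sum_subtractf sum_distrib_left[symmetric])
        also have "\<bar>\<dots>\<bar> \<le> (\<Sum>c\<in>C. \<bar>(\<phi>0 z - \<phi>0 c) * h c z\<bar>)"
          by (rule sum_abs)
        also have "\<dots> \<le> (\<Sum>c\<in>C. e / 4 * h c z)"
        proof (rule sum_mono)
          fix c assume "c \<in> C"
          then have c: "c \<in> circle" using C by auto
          show "\<bar>(\<phi>0 z - \<phi>0 c) * h c z\<bar> \<le> e / 4 * h c z"
          proof (cases "h c z = 0")
            case False
            then have "\<bar>\<phi>0 z - \<phi>0 c\<bar> \<le> e / 4" using lip0[OF z c] h(4)[of c z] by linarith
            from mult_right_mono[OF this h(2)[of c z]] show ?thesis
              unfolding abs_mult abs_of_nonneg[OF h(2)] .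
          qed simp
        qed
        also have "\<dots> = e / 4" unfolding sum_distrib_left[symmetric] h(3)[OF z] by simp
        finally show ?thesis .
      qed
      have int_s: "(LINT z|M. s z) = (\<Sum>c\<in>C. \<phi>0 c * (LINT z|M. h c z))"
        if "sets M = sets circle_borel" "emeasure M circle = 1" for M
        unfolding s_def using h(1) integrable_circle_measure[OF that]
        by (subst Bochner_Integration.integral_sum) auto
      have int_0: "(LINT z|M. \<phi>0 z) = (LINT z|M. \<phi> z) - \<phi> 1"
        if M: "sets M = sets circle_borel" "emeasure M circle = 1" for M
      proof -
        have "space M = circle"
          using sets_eq_imp_space_eq[OF M(1)] by (simp add: space_restrict_space)
        then show ?thesis
          unfolding \<phi>0_def using integrable_circle_measure[OF M] cont M
          by (subst Bochner_Integration.integral_diff) (auto simp: measure_def)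
      qed
      have "\<bar>(LINT z|\<mu>. s z) - (LINT z|\<nu> i. s z)\<bar>
          = \<bar>\<Sum>c\<in>C. \<phi>0 c * ((LINT z|\<mu>. h c z) - (LINT z|\<nu> i. h c z))\<bar>"
        by (simp add: int_s \<mu> \<nu>i right_diff_distrib sum_subtractf)
      also have "\<dots> \<le> (\<Sum>c\<in>C. \<bar>\<phi>0 c * ((LINT z|\<mu>. h c z) - (LINT z|\<nu> i. h c z))\<bar>)"
        by (rule sum_abs)
      also have "\<dots> \<le> (\<Sum>c\<in>C. 2 * \<bar>(LINT z|\<nu> i. h c z) - (LINT z|\<mu>. h c z)\<bar>)"
        using bnd C by (intro sum_mono) (auto simp: abs_mult abs_minus_commute intro!: mult_right_mono)
      also have "\<dots> = 2 * err i" by (simp add: err_def sum_distrib_left)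
      finally have "\<bar>(LINT z|\<mu>. s z) - (LINT z|\<nu> i. s z)\<bar> \<le> 2 * err i" .
      moreover have "\<bar>(LINT z|\<mu>. \<phi>0 z) - (LINT z|\<mu>. s z)\<bar> \<le> e / 4"
        by (rule integral_circle_measure_close[OF \<mu> cont0 conts close])
      moreover have "\<bar>(LINT z|\<nu> i. \<phi>0 z) - (LINT z|\<nu> i. s z)\<bar> \<le> e / 4"
        by (rule integral_circle_measure_close[OF \<nu>i cont0 conts close])
      \<comment> \<open>Two interpolation errors of e/4 each, and twice \<open>err i\<close>, which
        is below e/4, add up to \<open>e\<close>.\<close>
      ultimately have "(LINT z|\<mu>. \<phi>0 z) - (LINT z|\<nu> i. \<phi>0 z) \<le> e"
        using elim by linarith
      then show "ereal ((LINT z|\<mu>. \<phi> z) - (LINT z|\<nu> i. \<phi> z)) \<le> ereal e"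
        by (simp add: int_0 \<mu> \<nu>i)
    qed
  qed
qed

section \<open>Convergence of mpEDMD spectral measures\<close>

text \<open>Limits along this filter capture the order of limits in the theorem: \<open>M\<close> first, with \<open>N\<close> fixed,
  then \<open>N\<close>. No limit in \<open>M\<close> has to exist.\<close>

definition iterated_sequentially :: "(nat \<times> nat) filter" where
  "iterated_sequentially =
     Abs_filter (\<lambda>P. \<forall>\<^sub>F N in sequentially. \<forall>\<^sub>F M in sequentially. P (N, M))"

lemma eventually_iterated_sequentially:
  "eventually P iterated_sequentially \<longleftrightarrow> (\<forall>\<^sub>F N in sequentially. \<forall>\<^sub>F M in sequentially. P (N, M))"
  unfolding iterated_sequentially_def
proof (rule eventually_Abs_filter, rule is_filter.intro)
  fix P Q :: "nat \<times> nat \<Rightarrow> bool"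
  assume P: "\<forall>\<^sub>F N in sequentially. \<forall>\<^sub>F M in sequentially. P (N, M)"
    and Q: "\<forall>\<^sub>F N in sequentially. \<forall>\<^sub>F M in sequentially. Q (N, M)"
  show "\<forall>\<^sub>F N in sequentially. \<forall>\<^sub>F M in sequentially. P (N, M) \<and> Q (N, M)"
    using P Q by eventually_elim (rule eventually_conj)
next
  fix P Q :: "nat \<times> nat \<Rightarrow> bool"
  assume imp: "\<forall>x. P x \<longrightarrow> Q x" and P: "\<forall>\<^sub>F N in sequentially. \<forall>\<^sub>F M in sequentially. P (N, M)"
  show "\<forall>\<^sub>F N in sequentially. \<forall>\<^sub>F M in sequentially. Q (N, M)"
    using P by (rule eventually_mono) (use imp in \<open>auto elim: eventually_mono\<close>)
qed simp

text \<open>An open neighbourhood of \<open>l\<close> is eventually also a neighbourhood of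
  \<open>g N\<close>, so the inner limit enters it without any uniformity in
  \<open>N\<close>.\<close>

lemma tendsto_iterated_sequentially:
  assumes f: "\<forall>\<^sub>F N in sequentially. (\<lambda>M. f N M) \<longlonglongrightarrow> g N" and g: "g \<longlonglongrightarrow> l"
  shows "((\<lambda>(N, M). f N M) \<longlongrightarrow> l) iterated_sequentially"
proof (rule topological_tendstoI)
  fix S assume S: "open S" "l \<in> S"
  show "\<forall>\<^sub>F x in iterated_sequentially. (case x of (N, M) \<Rightarrow> f N M) \<in> S"
    unfolding eventually_iterated_sequentially
    using f topological_tendstoD[OF g S]
    by eventually_elim (use S(1) in \<open>auto dest: topological_tendstoD\<close>)
qed

text \<open>The Hilbert space counterpart of \<open>dict_comb\<close>: its image under the embedding
  when \<open>e\<close> is the embedded dictionary.\<close>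

definition hcomb :: "nat \<Rightarrow> (nat \<Rightarrow> 'h::complex_hilbert) \<Rightarrow> complex Matrix.vec \<Rightarrow> 'h" where
  "hcomb n e c = (\<Sum>j<n. scaleC (vec_index c j) (e j))"

lemma cinner_hcomb:
  assumes T: "clinear_op T"
  shows "cinner (T (hcomb n e a)) (hcomb n e b) =
    (\<Sum>i<n. \<Sum>j<n. cinner (T (e j)) (e i) * (vec_index a j * cnj (vec_index b i)))"
proof -
  have add: "T (x + y) = T x + T y" and scale: "T (scaleC c x) = scaleC c (T x)" for x y c
    using T by (auto simp: clinear_op_def)
  have zero: "T 0 = 0" using scale[of 0 0] by simp
  have sum: "T (\<Sum>j\<in>I. f j) = (\<Sum>j\<in>I. T (f j))" for I :: "nat set" and f
    by (induction I rule: infinite_finite_induct) (simp_all add: zero add)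
  show ?thesis
    by (simp add: hcomb_def sum scale cinner.sum_left cinner.sum_right cinner_scaleC_left cinner_scaleC_right
        sum_distrib_left mult_ac)
qed

lemma form_tendsto:
  assumes T: "clinear_op T"
    and B: "\<And>M. B M \<in> carrier_mat n n"
    and lim: "\<And>i j. i < n \<Longrightarrow> j < n \<Longrightarrow> (\<lambda>M. B M $$ (i, j)) \<longlonglongrightarrow> cinner (T (e j)) (e i)"
    and a: "a \<in> carrier_vec n" and b: "b \<in> carrier_vec n"
  shows "(\<lambda>M. (B M *\<^sub>v a) \<bullet>c b) \<longlonglongrightarrow> cinner (T (hcomb n e a)) (hcomb n e b)"
  unfolding mat_form_sum[OF B a b] cinner_hcomb[OF T]
  by (intro tendsto_sum tendsto_mult lim tendsto_const) auto

lemma bounded_linear_scaleC_left: "bounded_linear (\<lambda>z. scaleC z u)" for u :: "'h::complex_hilbert"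
proof (rule bounded_linear_intro)
  show "scaleC (r *\<^sub>R z) u = r *\<^sub>R scaleC z u" for r z
    by (simp add: scaleR_scaleC scaleC_scaleC scaleR_conv_of_real)
  show "norm (scaleC z u) \<le> norm z * norm u" for z by (simp add: norm_scaleC)
qed (simp add: scaleC_add_left)

text \<open>Equivalence of norms on a finite-dimensional space: on the compact unit sphere of the
  sum norm, the norm of the combination is continuous and, by independence, has a positive minimum.
  Homogeneity extends the bound to all coefficients.\<close>

lemma independent_coefficient_bound:
  fixes e :: "nat \<Rightarrow> 'h::complex_hilbert"
  assumes indep: "\<And>c. c \<in> carrier_vec n \<Longrightarrow> hcomb n e c = 0 \<Longrightarrow> c = 0\<^sub>v n"
  obtains \<kappa> where "0 < \<kappa>"
    "\<And>c. c \<in> carrier_vec n \<Longrightarrow> (\<Sum>j<n. cmod (vec_index c j)) \<le> \<kappa> * norm (hcomb n e c)"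
proof -
  define f where "f c = norm (\<Sum>j<n. scaleC (c j) (e j))" for c :: "nat \<Rightarrow> complex"
  \<comment> \<open>Coefficient vectors are functions on all naturals with zeros from
    \<open>n\<close> on, so \<open>P\<close> is a product of compact sets and hence compact.\<close>
  define P where "P = (PiE UNIV (\<lambda>i. if i < n then cball 0 1 else {0}) :: (nat \<Rightarrow> complex) set)"
  define S where "S = P \<inter> {c. (\<Sum>j<n. cmod (c j)) = 1}"
  have "compactin (product_topology (\<lambda>i. euclidean) UNIV) P"
    unfolding P_def compactin_PiE by auto
  then have "compact P" by (simp add: euclidean_product_topology flip: compactin_euclidean_iff)
  moreover have "closed {c :: nat \<Rightarrow> complex. (\<Sum>j<n. cmod (c j)) = 1}"
    by (intro closed_Collect_eq continuous_intros continuous_on_product_coordinates)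
  ultimately have S: "compact S" unfolding S_def by (rule compact_Int_closed)
  have f_cont: "continuous_on S f"
    unfolding f_def
    by (intro continuous_on_norm continuous_on_sum
        bounded_linear.continuous_on[OF bounded_linear_scaleC_left]
        continuous_on_subset[OF continuous_on_product_coordinates subset_UNIV])
  have scale: "\<exists>s\<in>S. norm (hcomb n e c) = t * f s"
    if c: "c \<in> carrier_vec n" and t: "t = (\<Sum>j<n. cmod (vec_index c j))" "0 < t" for c t
  proof
    define s where "s j = (if j < n then vec_index c j / complex_of_real t else 0)" for j
    have "(\<Sum>j<n. cmod (s j)) = (\<Sum>j<n. cmod (vec_index c j) / t)"
      using t(2) by (intro sum.cong) (auto simp: s_def norm_divide)
    also have "\<dots> = 1"
      unfolding sum_divide_distrib[symmetric] t(1)[symmetric] using t(2) by simp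
    finally have s1: "(\<Sum>j<n. cmod (s j)) = 1" .
    have "cmod (s j) \<le> 1" if "j < n" for j
      unfolding s1[symmetric] using that by (intro member_le_sum) auto
    then have "s \<in> P" by (auto simp: P_def s_def)
    with s1 show "s \<in> S" by (simp add: S_def)
    have "hcomb n e c = (\<Sum>j<n. scaleC (complex_of_real t) (scaleC (s j) (e j)))"
      unfolding hcomb_def using t(2) by (intro sum.cong) (auto simp: s_def scaleC_scaleC)
    also have "\<dots> = t *\<^sub>R (\<Sum>j<n. scaleC (s j) (e j))"
      unfolding scaleR_sum_right by (simp add: scaleR_scaleC)
    finally show "norm (hcomb n e c) = t * f s" using t(2) by (simp add: f_def)
  qed
  obtain m where m: "0 < m" "\<And>s. s \<in> S \<Longrightarrow> m \<le> f s"
  proof (cases "S = {}")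
    \<comment> \<open>The sphere is empty only for \<open>n = 0\<close>, where any positive constant
      works.\<close>
    case True
    then show ?thesis using that[of 1] by simp
  next
    case False
    then obtain s where s: "s \<in> S" "\<And>c. c \<in> S \<Longrightarrow> f s \<le> f c"
      using continuous_attains_inf[OF S False f_cont] by blast
    have "f s \<noteq> 0"
    proof
      assume "f s = 0"
      then have "hcomb n e (Matrix.vec n s) = 0" by (simp add: f_def hcomb_def)
      then have "Matrix.vec n s = 0\<^sub>v n" by (intro indep) auto
      then have "vec_index (Matrix.vec n s) j = 0" if "j < n" for j using that by simp
      then have "(\<Sum>j<n. cmod (s j)) = 0" by simp
      then show False using s(1) by (simp add: S_def)
    qed
    then show ?thesis using s(2) by (intro that[of "f s"]) (auto simp: f_def)
  qed
  show thesis
  proof (rule that[of "1 / m"])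
    show "(\<Sum>j<n. cmod (vec_index c j)) \<le> 1 / m * norm (hcomb n e c)" if c: "c \<in> carrier_vec n" for c
    proof (cases "(\<Sum>j<n. cmod (vec_index c j)) = 0")
      case False
      then have "0 < (\<Sum>j<n. cmod (vec_index c j))" by (simp add: less_le sum_nonneg)
      from scale[OF c refl this] obtain s where "s \<in> S"
        "norm (hcomb n e c) = (\<Sum>j<n. cmod (vec_index c j)) * f s" by blast
      moreover have "(\<Sum>j<n. cmod (vec_index c j)) * m \<le> (\<Sum>j<n. cmod (vec_index c j)) * f s"
        using m(2)[OF \<open>s \<in> S\<close>] by (intro mult_left_mono sum_nonneg) auto
      ultimately show ?thesis using m(1) by (simp add: field_simps)
    qed (use m(1) in simp)
  qed (use m(1) in simp)
qed

lemma mat_form_diff_bound: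
  assumes B: "B \<in> carrier_mat n n" and a: "a \<in> carrier_vec n" and b: "b \<in> carrier_vec n"
    and T: "clinear_op T"
    and close: "\<And>i j. i < n \<Longrightarrow> j < n \<Longrightarrow> cmod (B $$ (i, j) - cinner (T (e j)) (e i)) \<le> \<eta>"
  shows "cmod ((B *\<^sub>v a) \<bullet>c b - cinner (T (hcomb n e a)) (hcomb n e b))
    \<le> \<eta> * ((\<Sum>j<n. cmod (vec_index a j)) * (\<Sum>i<n. cmod (vec_index b i)))"
proof -
  have "(B *\<^sub>v a) \<bullet>c b - cinner (T (hcomb n e a)) (hcomb n e b) = (\<Sum>i<n. \<Sum>j<n.
      (B $$ (i, j) - cinner (T (e j)) (e i)) * (vec_index a j * cnj (vec_index b i)))"
    unfolding mat_form_sum[OF B a b] cinner_hcomb[OF T] by (simp add: left_diff_distrib sum_subtractf)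
  also have "cmod \<dots> \<le> (\<Sum>i<n. \<Sum>j<n. \<eta> * (cmod (vec_index a j) * cmod (vec_index b i)))"
  proof (intro sum_norm_le)
    fix i j assume "i \<in> {..<n}" "j \<in> {..<n}"
    then show "cmod ((B $$ (i, j) - cinner (T (e j)) (e i)) * (vec_index a j * cnj (vec_index b i)))
      \<le> \<eta> * (cmod (vec_index a j) * cmod (vec_index b i))"
      using close[of i j] by (simp add: norm_mult mult_right_mono)
  qed
  also have "\<dots> = \<eta> * (\<Sum>j<n. \<Sum>i<n. cmod (vec_index a j) * cmod (vec_index b i))"
    unfolding sum_distrib_left by (rule sum.swap)
  also have "\<dots> = \<eta> * ((\<Sum>j<n. cmod (vec_index a j)) * (\<Sum>i<n. cmod (vec_index b i)))"
    by (simp add: sum_product)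
  finally show ?thesis .
qed

text \<open>The problem inside a Hilbert space: \<open>S\<close> stands for the embedded L2 and
  \<open>e N\<close> for the embedded dictionary. Approximation is available only inside
  \<open>S\<close>, which is why invariance of \<open>S\<close> under \<open>K\<close> appears. The
  factors exist only for large \<open>M\<close>, once \<open>G N M\<close> is invertible.\<close>

locale mpedmd_limit =
  fixes K :: "'h::complex_hilbert \<Rightarrow> 'h" and S :: "'h set" and e :: "nat \<Rightarrow> nat \<Rightarrow> 'h"
    and G A R Q U1 U2 Vh :: "nat \<Rightarrow> nat \<Rightarrow> complex mat" and \<sigma> :: "nat \<Rightarrow> nat \<Rightarrow> nat \<Rightarrow> real"
    and lam :: "nat \<Rightarrow> nat \<Rightarrow> nat \<Rightarrow> complex"
  assumes K_linear: "clinear_op K" and K_norm: "\<And>u. norm (K u) = norm u"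
    and K_invariant: "\<And>u. u \<in> S \<Longrightarrow> K u \<in> S"
    and dense: "\<And>u. u \<in> S \<Longrightarrow> \<exists>c. (\<forall>N\<ge>1. c N \<in> carrier_vec N) \<and> (\<lambda>N. hcomb N (e N) (c N)) \<longlonglongrightarrow> u"
    and indep: "\<And>N c. 1 \<le> N \<Longrightarrow> c \<in> carrier_vec N \<Longrightarrow> hcomb N (e N) c = 0 \<Longrightarrow> c = 0\<^sub>v N"
    and carrier: "\<And>N M. G N M \<in> carrier_mat N N" "\<And>N M. A N M \<in> carrier_mat N N"
    and factors: "\<And>N. 1 \<le> N \<Longrightarrow> \<forall>\<^sub>F M in sequentially.
      mpedmd_factors N (G N M) (A N M) (R N M) (Q N M) (U1 N M) (\<sigma> N M) (U2 N M) (Vh N M) (lam N M)"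
    and G_lim: "\<And>N i j. 1 \<le> N \<Longrightarrow> i < N \<Longrightarrow> j < N \<Longrightarrow> (\<lambda>M. G N M $$ (i, j)) \<longlonglongrightarrow> cinner (e N j) (e N i)"
    and A_lim: "\<And>N i j. 1 \<le> N \<Longrightarrow> i < N \<Longrightarrow> j < N \<Longrightarrow> (\<lambda>M. A N M $$ (i, j)) \<longlonglongrightarrow> cinner (K (e N j)) (e N i)"
begin

abbreviation comb :: "nat \<Rightarrow> complex Matrix.vec \<Rightarrow> 'h" where "comb N \<equiv> hcomb N (e N)"
abbreviation P :: "nat \<Rightarrow> nat \<Rightarrow> complex mat" where "P N M \<equiv> polar_factor (U1 N M) (U2 N M)"

lemma data_eventually:
  "1 \<le> N \<Longrightarrow> \<forall>\<^sub>F M in sequentially. mpedmd_data N (G N M) (A N M) (R N M) (Q N M) (U1 N M) (U2 N M) (Vh N M) (\<sigma> N M) (lam N M)"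
  using factors[of N] by (rule eventually_mono) (auto intro: mpedmd_data.intro carrier)

lemma data_iterated:
  "\<forall>\<^sub>F (N, M) in iterated_sequentially. 1 \<le> N \<and>
    mpedmd_data N (G N M) (A N M) (R N M) (Q N M) (U1 N M) (U2 N M) (Vh N M) (\<sigma> N M) (lam N M)"
  unfolding eventually_iterated_sequentially
  by (rule eventually_mono[OF eventually_ge_at_top[of 1]]) (simp add: data_eventually eventually_conj)

lemma G_form_lim:
  assumes "1 \<le> N" "a \<in> carrier_vec N" "b \<in> carrier_vec N"
  shows "(\<lambda>M. (G N M *\<^sub>v a) \<bullet>c b) \<longlonglongrightarrow> cinner (comb N a) (comb N b)"
  using form_tendsto[of "\<lambda>u. u" "G N" N "e N", OF _ carrier(1) G_lim assms(2,3)] assms(1)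
  by (simp add: clinear_op_def)

lemma A_form_lim:
  assumes "1 \<le> N" "a \<in> carrier_vec N" "b \<in> carrier_vec N"
  shows "(\<lambda>M. (A N M *\<^sub>v a) \<bullet>c b) \<longlonglongrightarrow> cinner (K (comb N a)) (comb N b)"
  using form_tendsto[OF K_linear carrier(2) A_lim assms(2,3)] assms(1) by simp

text \<open>In the limit this is Cauchy-Schwarz for an isometry. The difficulty is uniformity over
  unit vectors for \<open>G N M\<close>, a set that moves with \<open>M\<close>. Bounding
  coefficients by the limit norm turns entrywise convergence into a relative error valid for all
  vectors at once.\<close>

lemma A_near_contraction:
  assumes N: "1 \<le> N" and \<delta>: "0 < \<delta>"
  shows "\<forall>\<^sub>F M in sequentially. \<forall>a\<in>carrier_vec N. \<forall>b\<in>carrier_vec N.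
    Re ((G N M *\<^sub>v a) \<bullet>c a) = 1 \<longrightarrow> Re ((G N M *\<^sub>v b) \<bullet>c b) = 1 \<longrightarrow> cmod ((A N M *\<^sub>v a) \<bullet>c b) \<le> 1 + \<delta>"
proof -
  obtain \<kappa> where \<kappa>: "0 < \<kappa>"
    "\<And>c. c \<in> carrier_vec N \<Longrightarrow> (\<Sum>j<N. cmod (vec_index c j)) \<le> \<kappa> * norm (comb N c)"
    using independent_coefficient_bound[OF indep[OF N]] by metis
  \<comment> \<open>\<open>t\<close> solves (1 + t)/(1 - t) = 1 + \<delta>. An entrywise error
    \<open>\<eta>\<close> becomes the relative error \<open>t\<close> after two coefficient bounds,
    each costing one factor \<open>\<kappa>\<close>.\<close>
  define t where "t = \<delta> / (2 + \<delta>)"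
  define \<eta> where "\<eta> = t / \<kappa>\<^sup>2"
  have t: "0 < t" "t < 1" "(1 + t) / (1 - t) = 1 + \<delta>" using \<delta> by (auto simp: t_def field_simps)
  have \<eta>: "0 < \<eta>" and \<eta>\<kappa>: "\<eta> * \<kappa>\<^sup>2 = t" using t \<kappa>(1) by (auto simp: \<eta>_def)
  have ev: "\<forall>\<^sub>F M in sequentially. \<forall>i\<in>{..<N}. \<forall>j\<in>{..<N}. cmod (G N M $$ (i, j) - cinner (e N j) (e N i)) \<le> \<eta> \<and>
      cmod (A N M $$ (i, j) - cinner (K (e N j)) (e N i)) \<le> \<eta>"
  proof (intro eventually_ball_finite ballI eventually_conj finite_lessThan)
    fix i j assume "i \<in> {..<N}" "j \<in> {..<N}"
    then show "\<forall>\<^sub>F M in sequentially. cmod (G N M $$ (i, j) - cinner (e N j) (e N i)) \<le> \<eta>"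
      "\<forall>\<^sub>F M in sequentially. cmod (A N M $$ (i, j) - cinner (K (e N j)) (e N i)) \<le> \<eta>"
      using tendstoD[OF G_lim[OF N, of i j] \<eta>] tendstoD[OF A_lim[OF N, of i j] \<eta>]
      by (auto simp: dist_norm elim: eventually_mono)
  qed
  then show ?thesis
  proof (rule eventually_mono, intro ballI impI)
    fix M a b
    assume close: "\<forall>i\<in>{..<N}. \<forall>j\<in>{..<N}. cmod (G N M $$ (i, j) - cinner (e N j) (e N i)) \<le> \<eta> \<and>
        cmod (A N M $$ (i, j) - cinner (K (e N j)) (e N i)) \<le> \<eta>"
      and a: "a \<in> carrier_vec N" and b: "b \<in> carrier_vec N"
      and a1: "Re ((G N M *\<^sub>v a) \<bullet>c a) = 1" and b1: "Re ((G N M *\<^sub>v b) \<bullet>c b) = 1"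
    have coeff: "\<eta> * ((\<Sum>j<N. cmod (vec_index c j)) * (\<Sum>i<N. cmod (vec_index d i)))
        \<le> t * (norm (comb N c) * norm (comb N d))" if "c \<in> carrier_vec N" "d \<in> carrier_vec N" for c d
    proof -
      have "(\<Sum>j<N. cmod (vec_index c j)) * (\<Sum>i<N. cmod (vec_index d i))
          \<le> (\<kappa> * norm (comb N c)) * (\<kappa> * norm (comb N d))"
        using \<kappa>(1) by (intro mult_mono \<kappa>(2) that sum_nonneg) auto
      then have "\<eta> * ((\<Sum>j<N. cmod (vec_index c j)) * (\<Sum>i<N. cmod (vec_index d i)))
          \<le> \<eta> * ((\<kappa> * norm (comb N c)) * (\<kappa> * norm (comb N d)))"
        using \<eta> by (intro mult_left_mono) auto
      also have "\<dots> = t * (norm (comb N c) * norm (comb N d))"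
        by (simp add: \<eta>\<kappa>[symmetric] power2_eq_square mult_ac)
      finally show ?thesis .
    qed
    \<comment> \<open>The form of \<open>G N M\<close> differs from the squared limit norm by a
      relative error of at most \<open>t\<close>, so its unit vectors stay bounded in the limit
      norm.\<close>
    have unit: "(norm (comb N c))\<^sup>2 \<le> 1 / (1 - t)"
      if c: "c \<in> carrier_vec N" and c1: "Re ((G N M *\<^sub>v c) \<bullet>c c) = 1" for c
    proof -
      have "cmod ((G N M *\<^sub>v c) \<bullet>c c - cinner (comb N c) (comb N c))
          \<le> \<eta> * ((\<Sum>j<N. cmod (vec_index c j)) * (\<Sum>i<N. cmod (vec_index c i)))"
        using close by (intro mat_form_diff_bound[where T = "\<lambda>u. u"] carrier c) (auto simp: clinear_op_def)
      also note coeff[OF c c]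
      finally have "\<bar>Re ((G N M *\<^sub>v c) \<bullet>c c - cinner (comb N c) (comb N c))\<bar> \<le> t * (norm (comb N c))\<^sup>2"
        using abs_Re_le_cmod order_trans by (fastforce simp: power2_eq_square)
      then have "(norm (comb N c))\<^sup>2 * (1 - t) \<le> 1"
        by (simp add: c1 Re_cinner_self algebra_simps)
      then show ?thesis using t by (simp add: pos_le_divide_eq)
    qed
    have ab: "norm (comb N a) * norm (comb N b) \<le> 1 / (1 - t)"
    proof -
      have "2 * (norm (comb N a) * norm (comb N b)) \<le> (norm (comb N a))\<^sup>2 + (norm (comb N b))\<^sup>2"
        using sum_squares_bound[of "norm (comb N a)" "norm (comb N b)"] by (simp add: mult.assoc)
      then show ?thesis using unit[OF a a1] unit[OF b b1] by linarith
    qed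
    have "cmod ((A N M *\<^sub>v a) \<bullet>c b - cinner (K (comb N a)) (comb N b))
        \<le> \<eta> * ((\<Sum>j<N. cmod (vec_index a j)) * (\<Sum>i<N. cmod (vec_index b i)))"
      using close by (intro mat_form_diff_bound carrier a b K_linear) auto
    also note coeff[OF a b]
    finally have "cmod ((A N M *\<^sub>v a) \<bullet>c b) \<le> cmod (cinner (K (comb N a)) (comb N b))
        + t * (norm (comb N a) * norm (comb N b))"
      using norm_triangle_ineq2[of "(A N M *\<^sub>v a) \<bullet>c b" "cinner (K (comb N a)) (comb N b)"] by linarith
    also have "\<dots> \<le> (1 + t) * (norm (comb N a) * norm (comb N b))"
      using cinner_Cauchy_Schwarz[of "K (comb N a)" "comb N b"] by (simp add: K_norm algebra_simps)
    also have "\<dots> \<le> (1 + t) * (1 / (1 - t))"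
      using t by (intro mult_left_mono ab) auto
    also have "\<dots> = 1 + \<delta>" using t(3) by simp
    finally show "cmod ((A N M *\<^sub>v a) \<bullet>c b) \<le> 1 + \<delta>" .
  qed
qed

text \<open>For fixed \<open>N\<close>, the bound of \<open>polar_factor_error\<close> has a limit
  in \<open>M\<close> close to twice the distance from \<open>K (comb N (a N))\<close> to
  \<open>comb N (b N)\<close>. This distance tends to 0 because both vectors tend to
  \<open>K u\<close>.\<close>

lemma polar_step_tendsto_0:
  assumes a: "\<And>N. 1 \<le> N \<Longrightarrow> a N \<in> carrier_vec N" and b: "\<And>N. 1 \<le> N \<Longrightarrow> b N \<in> carrier_vec N"
    and a_lim: "(\<lambda>N. comb N (a N)) \<longlonglongrightarrow> u" and b_lim: "(\<lambda>N. comb N (b N)) \<longlonglongrightarrow> K u"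
  shows "((\<lambda>(N, M). vec_norm (P N M *\<^sub>v (R N M *\<^sub>v a N) - R N M *\<^sub>v b N)) \<longlongrightarrow> 0) iterated_sequentially"
proof (rule tendstoI)
  fix \<epsilon> :: real assume \<epsilon>: "0 < \<epsilon>"
  have K_diff: "K (x - y) = K x - K y" for x y
  proof -
    have "K (x - y + y) = K (x - y) + K y" using K_linear unfolding clinear_op_def by blast
    then show ?thesis by simp
  qed
  have "(\<lambda>N. K (comb N (a N))) \<longlonglongrightarrow> K u"
  proof (rule iffD2[OF tendsto_dist_iff])
    show "(\<lambda>N. dist (K (comb N (a N))) (K u)) \<longlonglongrightarrow> 0"
      using a_lim unfolding tendsto_dist_iff[of _ u] by (simp add: dist_norm K_norm flip: K_diff)
  qed
  then have "(\<lambda>N. 2 * norm (K (comb N (a N)) - comb N (b N))) \<longlonglongrightarrow> 2 * norm (K u - K u)"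
    by (intro tendsto_intros b_lim)
  then have "\<forall>\<^sub>F N in sequentially. 2 * norm (K (comb N (a N)) - comb N (b N)) < \<epsilon>"
    using \<epsilon> by (intro order_tendstoD) auto
  then have "\<forall>\<^sub>F N in sequentially. \<forall>\<^sub>F M in sequentially.
      vec_norm (P N M *\<^sub>v (R N M *\<^sub>v a N) - R N M *\<^sub>v b N) < \<epsilon>"
    using eventually_ge_at_top[of 1]
  proof eventually_elim
    case (elim N)
    define x where "x = norm (K (comb N (a N)) - comb N (b N))"
    define y where "y = norm (comb N (a N))"
    have x: "x\<^sup>2 = y\<^sup>2 - 2 * Re (cinner (K (comb N (a N))) (comb N (b N))) + (norm (comb N (b N)))\<^sup>2"
      by (simp add: x_def y_def norm_diff_power2 K_norm)
    \<comment> \<open>The strict inequality in \<open>elim(1)\<close> leaves room for a positive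
      \<open>\<delta>\<close>, which is sought among the reciprocals of positive integers. It may
      depend on \<open>N\<close>, as \<open>N\<close> is fixed before \<open>M\<close>
      grows.\<close>
    have "(\<lambda>n. 2 * sqrt (x\<^sup>2 + 2 * inverse (real (Suc n)) * (1 + inverse (real (Suc n))) * y\<^sup>2))
        \<longlonglongrightarrow> 2 * sqrt (x\<^sup>2 + 2 * 0 * (1 + 0) * y\<^sup>2)"
      by (intro tendsto_intros LIMSEQ_inverse_real_of_nat)
    moreover have "2 * sqrt (x\<^sup>2 + 2 * 0 * (1 + 0) * y\<^sup>2) < \<epsilon>" using elim(1) by (simp add: x_def)
    ultimately have "\<forall>\<^sub>F n in sequentially.
        2 * sqrt (x\<^sup>2 + 2 * inverse (real (Suc n)) * (1 + inverse (real (Suc n))) * y\<^sup>2) < \<epsilon>"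
      by (rule order_tendstoD(2))
    then obtain n where n: "2 * sqrt (x\<^sup>2 + 2 * inverse (real (Suc n)) * (1 + inverse (real (Suc n))) * y\<^sup>2) < \<epsilon>"
      using eventually_happens'[OF sequentially_bot] by blast
    define \<delta> where "\<delta> = inverse (real (Suc n))"
    have \<delta>: "0 < \<delta>" by (simp add: \<delta>_def)
    define err where "err M = 2 * sqrt ((1 + 2 * \<delta> * (1 + \<delta>)) * Re ((G N M *\<^sub>v a N) \<bullet>c a N)
      - (2 * Re ((A N M *\<^sub>v a N) \<bullet>c b N) - Re ((G N M *\<^sub>v b N) \<bullet>c b N)))" for M
    have "err \<longlonglongrightarrow> 2 * sqrt ((1 + 2 * \<delta> * (1 + \<delta>)) * Re (cinner (comb N (a N)) (comb N (a N)))
      - (2 * Re (cinner (K (comb N (a N))) (comb N (b N))) - Re (cinner (comb N (b N)) (comb N (b N)))))"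
      unfolding err_def by (intro tendsto_intros G_form_lim A_form_lim a b elim)
    \<comment> \<open>Since \<open>K\<close> is isometric, the limiting forms complete the square
      \<open>x\<^sup>2\<close>.\<close>
    also have "(1 + 2 * \<delta> * (1 + \<delta>)) * Re (cinner (comb N (a N)) (comb N (a N)))
      - (2 * Re (cinner (K (comb N (a N))) (comb N (b N))) - Re (cinner (comb N (b N)) (comb N (b N))))
      = x\<^sup>2 + 2 * \<delta> * (1 + \<delta>) * y\<^sup>2"
      unfolding x Re_cinner_self y_def by (simp add: algebra_simps)
    finally have "\<forall>\<^sub>F M in sequentially. err M < \<epsilon>"
      using n by (intro order_tendstoD) (auto simp: \<delta>_def)
    with A_near_contraction[OF elim(2) \<delta>] data_eventually[OF elim(2)] show ?case
    proof eventually_elim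
      case (elim M)
      interpret mpedmd_data N "G N M" "A N M" "R N M" "Q N M" "U1 N M" "U2 N M" "Vh N M" "\<sigma> N M" "lam N M"
        by (rule elim(2))
      have "\<sigma> N M i \<le> 1 + \<delta>" if "i < N" for i
        by (rule sigma_le[OF _ that]) (use elim(1) in blast)
      then have "vec_norm (P N M *\<^sub>v (R N M *\<^sub>v a N) - R N M *\<^sub>v b N) \<le> err M"
        unfolding err_def using \<delta> by (intro polar_factor_error a b \<open>1 \<le> N\<close>) auto
      then show ?case using elim(3) by simp
    qed
  qed
  then show "\<forall>\<^sub>F z in iterated_sequentially.
      dist (case z of (N, M) \<Rightarrow> vec_norm (P N M *\<^sub>v (R N M *\<^sub>v a N) - R N M *\<^sub>v b N)) 0 < \<epsilon>"
    by (simp add: eventually_iterated_sequentially vec_norm_nonneg)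
qed

text \<open>Each step replaces the approximation of one orbit point by a fresh approximation of the
  next. The accumulated error is not amplified because \<open>P N M\<close> is unitary.\<close>

lemma polar_power_tracks_orbit:
  assumes u: "u \<in> S" and g: "\<And>N. 1 \<le> N \<Longrightarrow> g N \<in> carrier_vec N" and g_lim: "(\<lambda>N. comb N (g N)) \<longlonglongrightarrow> u"
  shows "\<exists>b. (\<forall>N\<ge>1. b N \<in> carrier_vec N) \<and> (\<lambda>N. comb N (b N)) \<longlonglongrightarrow> (K ^^ k) u \<and>
    ((\<lambda>(N, M). vec_norm (((*\<^sub>v) (P N M) ^^ k) (R N M *\<^sub>v g N) - R N M *\<^sub>v b N)) \<longlongrightarrow> 0) iterated_sequentially"
proof (induction k)
  case 0
  have "\<forall>\<^sub>F x in iterated_sequentially. 0 = (\<lambda>(N, M). vec_norm (R N M *\<^sub>v g N - R N M *\<^sub>v g N)) x"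
    using data_iterated
  proof eventually_elim
    case (elim x)
    obtain N M where x: "x = (N, M)" by (cases x)
    with elim have N: "1 \<le> N" by simp
    interpret mpedmd_data N "G N M" "A N M" "R N M" "Q N M" "U1 N M" "U2 N M" "Vh N M" "\<sigma> N M" "lam N M"
      using elim x by simp
    have "R N M *\<^sub>v g N \<in> carrier_vec N" using R_carrier g[OF N] by (rule mult_mat_vec_carrier)
    then show ?case by (simp add: x vec_norm_def)
  qed
  then have "((\<lambda>(N, M). vec_norm (R N M *\<^sub>v g N - R N M *\<^sub>v g N)) \<longlongrightarrow> 0) iterated_sequentially"
    by (rule Lim_transform_eventually[OF tendsto_const])
  then show ?case using g g_lim by (intro exI[of _ g]) simp
next
  case (Suc k)
  then obtain b where b: "\<And>N. 1 \<le> N \<Longrightarrow> b N \<in> carrier_vec N" and b_lim: "(\<lambda>N. comb N (b N)) \<longlonglongrightarrow> (K ^^ k) u"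
    and err: "((\<lambda>(N, M). vec_norm (((*\<^sub>v) (P N M) ^^ k) (R N M *\<^sub>v g N) - R N M *\<^sub>v b N)) \<longlongrightarrow> 0) iterated_sequentially"
    by blast
  \<comment> \<open>Invariance keeps the orbit where the dictionary approximates.\<close>
  have "(K ^^ k) u \<in> S" for k by (induction k) (simp_all add: u K_invariant)
  from dense[OF this[of "Suc k"]] obtain b' where
    b': "\<And>N. 1 \<le> N \<Longrightarrow> b' N \<in> carrier_vec N" and "(\<lambda>N. comb N (b' N)) \<longlonglongrightarrow> (K ^^ Suc k) u"
    by blast
  then have b'_lim: "(\<lambda>N. comb N (b' N)) \<longlonglongrightarrow> K ((K ^^ k) u)" by simp
  have "((\<lambda>x. (\<lambda>(N, M). vec_norm (((*\<^sub>v) (P N M) ^^ k) (R N M *\<^sub>v g N) - R N M *\<^sub>v b N)) x +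
      (\<lambda>(N, M). vec_norm (P N M *\<^sub>v (R N M *\<^sub>v b N) - R N M *\<^sub>v b' N)) x) \<longlongrightarrow> 0 + 0) iterated_sequentially"
    by (intro tendsto_add err polar_step_tendsto_0[OF b b' b_lim b'_lim])
  then have "((\<lambda>x. (\<lambda>(N, M). vec_norm (((*\<^sub>v) (P N M) ^^ k) (R N M *\<^sub>v g N) - R N M *\<^sub>v b N)) x +
      (\<lambda>(N, M). vec_norm (P N M *\<^sub>v (R N M *\<^sub>v b N) - R N M *\<^sub>v b' N)) x) \<longlongrightarrow> 0) iterated_sequentially"
    by simp
  then have "((\<lambda>(N, M). vec_norm (((*\<^sub>v) (P N M) ^^ Suc k) (R N M *\<^sub>v g N) - R N M *\<^sub>v b' N)) \<longlongrightarrow> 0)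
      iterated_sequentially"
  proof (rule Lim_null_comparison[rotated])
    show "\<forall>\<^sub>F x in iterated_sequentially.
        norm (case x of (N, M) \<Rightarrow> vec_norm (((*\<^sub>v) (P N M) ^^ Suc k) (R N M *\<^sub>v g N) - R N M *\<^sub>v b' N))
        \<le> (case x of (N, M) \<Rightarrow> vec_norm (((*\<^sub>v) (P N M) ^^ k) (R N M *\<^sub>v g N) - R N M *\<^sub>v b N)) +
          (case x of (N, M) \<Rightarrow> vec_norm (P N M *\<^sub>v (R N M *\<^sub>v b N) - R N M *\<^sub>v b' N))"
      using data_iterated
    proof eventually_elim
      case (elim x)
      obtain N M where x: "x = (N, M)" by (cases x)
      with elim have N: "1 \<le> N" by simp
      interpret mpedmd_data N "G N M" "A N M" "R N M" "Q N M" "U1 N M" "U2 N M" "Vh N M" "\<sigma> N M" "lam N M"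
        using elim x by simp
      define y where "y = ((*\<^sub>v) (P N M) ^^ k) (R N M *\<^sub>v g N)"
      have Rg: "R N M *\<^sub>v g N \<in> carrier_vec N" and Rb: "R N M *\<^sub>v b N \<in> carrier_vec N"
        and Rb': "R N M *\<^sub>v b' N \<in> carrier_vec N"
        using mult_mat_vec_carrier[OF R_carrier] g[OF N] b[OF N] b'[OF N] by auto
      have y: "y \<in> carrier_vec N" unfolding y_def by (rule U_funpow_carrier[OF Rg])
      have P: "P N M \<in> carrier_mat N N" using unitary_U by (simp add: unitary_mat_def)
      have "vec_norm (P N M *\<^sub>v y - R N M *\<^sub>v b' N) \<le> vec_norm (P N M *\<^sub>v y - P N M *\<^sub>v (R N M *\<^sub>v b N)) +
          vec_norm (P N M *\<^sub>v (R N M *\<^sub>v b N) - R N M *\<^sub>v b' N)"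
        by (intro vec_norm_triangle[of _ N] mult_mat_vec_carrier[OF P] y Rb Rb')
      also have "P N M *\<^sub>v y - P N M *\<^sub>v (R N M *\<^sub>v b N) = P N M *\<^sub>v (y - R N M *\<^sub>v b N)"
        by (rule mult_minus_distrib_mat_vec[OF P y Rb, symmetric])
      also have "vec_norm \<dots> = vec_norm (y - R N M *\<^sub>v b N)"
        by (rule unitary_mat_vec_norm[OF unitary_U minus_carrier_vec[OF y Rb]])
      finally show ?case by (simp add: x y_def vec_norm_nonneg)
    qed
  qed
  then show ?case using b' b'_lim by (intro exI[of _ b']) simp
qed

text \<open>Cauchy-Schwarz replaces the power by \<open>R N M *\<^sub>v b N\<close>. The scalar
  product with \<open>R N M *\<^sub>v g N\<close> is then the form of \<open>G N M\<close>, whose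
  iterated limit is an inner product.\<close>

lemma polar_power_moment_tendsto:
  assumes u: "u \<in> S" and g: "\<And>N. 1 \<le> N \<Longrightarrow> g N \<in> carrier_vec N" and g_lim: "(\<lambda>N. comb N (g N)) \<longlonglongrightarrow> u"
  shows "((\<lambda>(N, M). ((*\<^sub>v) (P N M) ^^ k) (R N M *\<^sub>v g N) \<bullet>c (R N M *\<^sub>v g N)) \<longlongrightarrow> cinner ((K ^^ k) u) u)
    iterated_sequentially"
proof -
  from polar_power_tracks_orbit[OF u g g_lim, of k]
  obtain b where b: "\<And>N. 1 \<le> N \<Longrightarrow> b N \<in> carrier_vec N" and b_lim: "(\<lambda>N. comb N (b N)) \<longlonglongrightarrow> (K ^^ k) u"
    and err: "((\<lambda>(N, M). vec_norm (((*\<^sub>v) (P N M) ^^ k) (R N M *\<^sub>v g N) - R N M *\<^sub>v b N)) \<longlongrightarrow> 0) iterated_sequentially"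
    by blast
  have form: "((\<lambda>(N, M). (G N M *\<^sub>v c N) \<bullet>c g N) \<longlongrightarrow> cinner v u) iterated_sequentially"
    if c: "\<And>N. 1 \<le> N \<Longrightarrow> c N \<in> carrier_vec N" and c_lim: "(\<lambda>N. comb N (c N)) \<longlonglongrightarrow> v" for c v
  proof (rule tendsto_iterated_sequentially)
    show "\<forall>\<^sub>F N in sequentially. (\<lambda>M. (G N M *\<^sub>v c N) \<bullet>c g N) \<longlonglongrightarrow> cinner (comb N (c N)) (comb N (g N))"
      by (rule eventually_mono[OF eventually_ge_at_top[of 1]]) (intro G_form_lim c g)
    show "(\<lambda>N. cinner (comb N (c N)) (comb N (g N))) \<longlonglongrightarrow> cinner v u"
      by (intro cinner.tendsto c_lim g_lim)
  qed
  define D where "D = (\<lambda>(N, M). ((*\<^sub>v) (P N M) ^^ k) (R N M *\<^sub>v g N) \<bullet>c (R N M *\<^sub>v g N) - (G N M *\<^sub>v b N) \<bullet>c g N)"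
  have "((\<lambda>x. (case x of (N, M) \<Rightarrow> vec_norm (((*\<^sub>v) (P N M) ^^ k) (R N M *\<^sub>v g N) - R N M *\<^sub>v b N)) *
      sqrt (Re (case x of (N, M) \<Rightarrow> (G N M *\<^sub>v g N) \<bullet>c g N))) \<longlongrightarrow> 0 * sqrt (Re (cinner u u))) iterated_sequentially"
    by (intro tendsto_intros err form g g_lim)
  then have "((\<lambda>x. (case x of (N, M) \<Rightarrow> vec_norm (((*\<^sub>v) (P N M) ^^ k) (R N M *\<^sub>v g N) - R N M *\<^sub>v b N)) *
      sqrt (Re (case x of (N, M) \<Rightarrow> (G N M *\<^sub>v g N) \<bullet>c g N))) \<longlongrightarrow> 0) iterated_sequentially"
    by simp
  then have "(D \<longlongrightarrow> 0) iterated_sequentially"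
  proof (rule Lim_null_comparison[rotated])
    show "\<forall>\<^sub>F x in iterated_sequentially. cmod (D x)
        \<le> (case x of (N, M) \<Rightarrow> vec_norm (((*\<^sub>v) (P N M) ^^ k) (R N M *\<^sub>v g N) - R N M *\<^sub>v b N)) *
          sqrt (Re (case x of (N, M) \<Rightarrow> (G N M *\<^sub>v g N) \<bullet>c g N))"
      using data_iterated
    proof eventually_elim
      case (elim x)
      obtain N M where x: "x = (N, M)" by (cases x)
      with elim have N: "1 \<le> N" by simp
      interpret mpedmd_data N "G N M" "A N M" "R N M" "Q N M" "U1 N M" "U2 N M" "Vh N M" "\<sigma> N M" "lam N M"
        using elim x by simp
      define y where "y = ((*\<^sub>v) (P N M) ^^ k) (R N M *\<^sub>v g N)"
      have Rg: "R N M *\<^sub>v g N \<in> carrier_vec N" and Rb: "R N M *\<^sub>v b N \<in> carrier_vec N"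
        using mult_mat_vec_carrier[OF R_carrier] g[OF N] b[OF N] by auto
      have y: "y \<in> carrier_vec N" unfolding y_def by (rule U_funpow_carrier[OF Rg])
      have "D x = y \<bullet>c (R N M *\<^sub>v g N) - (R N M *\<^sub>v b N) \<bullet>c (R N M *\<^sub>v g N)"
        by (simp add: D_def x y_def sqrt_pair_cscalar_prod[OF sqrt_pair b[OF N] g[OF N]])
      also have "\<dots> = (y - R N M *\<^sub>v b N) \<bullet>c (R N M *\<^sub>v g N)"
        using y Rb Rg by (intro minus_scalar_prod_distrib[symmetric]) auto
      also have "cmod \<dots> \<le> vec_norm (y - R N M *\<^sub>v b N) * vec_norm (R N M *\<^sub>v g N)"
        by (rule cscalar_prod_Cauchy_Schwarz[OF minus_carrier_vec[OF y Rb] Rg])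
      also have "vec_norm (R N M *\<^sub>v g N) = sqrt (Re ((G N M *\<^sub>v g N) \<bullet>c g N))"
        using vec_norm_R[OF g[OF N]] by (simp add: real_sqrt_unique vec_norm_nonneg)
      finally show ?case by (simp add: x y_def)
    qed
  qed
  from tendsto_add[OF this form[OF b b_lim]] show ?thesis
    by (simp add: D_def case_prod_unfold)
qed

end

section \<open>Mass and moments of the normalized discrete measures\<close>

context mpedmd_data
begin

lemma G_normalize_coefficient:
  assumes c: "c \<in> carrier_vec n" and j: "j < n" and r: "0 < Re ((G *\<^sub>v c) \<bullet>c c)"
  shows "(cmod ((G *\<^sub>v G_normalize G c) \<bullet>c col (Q * Vh) j))\<^sup>2 =
    (cmod (vec_index (mat_adjoint Vh *\<^sub>v (R *\<^sub>v c)) j))\<^sup>2 / Re ((G *\<^sub>v c) \<bullet>c c)"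
proof -
  define s where "s = complex_of_real (1 / sqrt (Re ((G *\<^sub>v c) \<bullet>c c)))"
  have G: "G \<in> carrier_mat n n" using R_carrier by (auto simp: G_eq)
  have "G *\<^sub>v G_normalize G c = s \<cdot>\<^sub>v (G *\<^sub>v c)"
    unfolding G_normalize_def s_def by (rule mult_mat_vec[OF G c])
  moreover have "conjugate (col (Q * Vh) j) \<in> carrier_vec n"
    using carrier_matD(1)[OF Q_carrier] by (intro carrier_vecI) simp
  moreover have "G *\<^sub>v c \<in> carrier_vec n" using G c by auto
  ultimately have "(G *\<^sub>v G_normalize G c) \<bullet>c col (Q * Vh) j = s * ((G *\<^sub>v c) \<bullet>c col (Q * Vh) j)"
    by simp
  also have "(cmod \<dots>)\<^sup>2 = (cmod ((G *\<^sub>v c) \<bullet>c col (Q * Vh) j))\<^sup>2 / Re ((G *\<^sub>v c) \<bullet>c c)"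
    using r by (simp add: s_def norm_mult norm_divide power_mult_distrib power_divide)
  finally show ?thesis by (simp only: cscalar_prod_col[OF c j])
qed

lemma normalized_measure_moment:
  assumes c: "c \<in> carrier_vec n" and r: "0 < Re ((G *\<^sub>v c) \<bullet>c c)"
  shows "(LINT z|mpedmd_measure n G (Q * Vh) lam (G_normalize G c). z ^ k) =
    ((*\<^sub>v) U ^^ k) (R *\<^sub>v c) \<bullet>c (R *\<^sub>v c) / complex_of_real (Re ((G *\<^sub>v c) \<bullet>c c))"
proof -
  have lam: "\<forall>j<n. lam j \<in> circle" using cmod_lam by simp
  have Rc: "R *\<^sub>v c \<in> carrier_vec n" using mult_mat_vec_carrier[OF R_carrier c] .
  have "(\<lambda>z. z ^ k) \<in> borel_measurable circle_borel"
    by (intro borel_measurable_continuous_on_restrict continuous_intros)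
  from integral_mpedmd_measure[OF lam this, where G = G and V = "Q * Vh" and c = "G_normalize G c"] show ?thesis
    unfolding U_funpow_moment[OF Rc]
    by (simp add: G_normalize_coefficient[OF c _ r] sum_divide_distrib scaleR_conv_of_real mult.commute)
qed

text \<open>Parseval in the basis \<open>Vh\<close>: the masses sum to the squared norm of
  \<open>R *\<^sub>v c\<close>, which is exactly the normalizing form.\<close>

lemma normalized_measure_mass:
  assumes c: "c \<in> carrier_vec n" and r: "0 < Re ((G *\<^sub>v c) \<bullet>c c)"
  shows "emeasure (mpedmd_measure n G (Q * Vh) lam (G_normalize G c)) circle = 1"
    and "sets (mpedmd_measure n G (Q * Vh) lam (G_normalize G c)) = sets circle_borel"
proof -
  have lam: "\<forall>j<n. lam j \<in> circle" using cmod_lam by simp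
  have Rc: "R *\<^sub>v c \<in> carrier_vec n" using mult_mat_vec_carrier[OF R_carrier c] .
  define t where "t = mat_adjoint Vh *\<^sub>v (R *\<^sub>v c)"
  have t: "t \<in> carrier_vec n"
    unfolding t_def by (rule mult_mat_vec_carrier[OF mat_adjoint_carrier[OF Vh_carrier] Rc])
  have "(\<Sum>j<n. (cmod ((G *\<^sub>v G_normalize G c) \<bullet>c col (Q * Vh) j))\<^sup>2) = (vec_norm t)\<^sup>2 / Re ((G *\<^sub>v c) \<bullet>c c)"
    unfolding vec_norm_power2_sum[OF t] sum_divide_distrib
    by (simp add: G_normalize_coefficient[OF c _ r] t_def)
  also have "vec_norm t = vec_norm (R *\<^sub>v c)"
    unfolding t_def by (rule unitary_mat_vec_norm[OF unitary_mat_adjoint[OF unitary_Vh] Rc])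
  also have "(vec_norm (R *\<^sub>v c))\<^sup>2 / Re ((G *\<^sub>v c) \<bullet>c c) = 1"
    using r by (simp add: vec_norm_R[OF c])
  finally show "emeasure (mpedmd_measure n G (Q * Vh) lam (G_normalize G c)) circle = 1"
    by (simp add: emeasure_mpedmd_measure_circle[OF lam])
  show "sets (mpedmd_measure n G (Q * Vh) lam (G_normalize G c)) = sets circle_borel"
    by (rule sets_mpedmd_measure[OF lam])
qed

end

lemma (in mpedmd_limit) mpedmd_measure_converges:
  assumes \<mu>: "sets \<mu> = sets circle_borel" "emeasure \<mu> circle = 1"
    and moments: "\<And>k. (LINT z|\<mu>. z ^ k) = cinner ((K ^^ k) u) u"
    and u: "u \<in> S" "norm u = 1"
    and g: "\<And>N. 1 \<le> N \<Longrightarrow> g N \<in> carrier_vec N" and g_lim: "(\<lambda>N. comb N (g N)) \<longlonglongrightarrow> u"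
    and \<epsilon>: "0 < \<epsilon>"
  shows "\<forall>\<^sub>F N in sequentially. \<forall>\<^sub>F M in sequentially.
    W1 \<mu> (mpedmd_measure N (G N M) (Q N M * Vh N M) (lam N M) (G_normalize (G N M) (g N))) \<le> ereal \<epsilon>"
proof -
  define r where "r = (\<lambda>(N, M). Re ((G N M *\<^sub>v g N) \<bullet>c g N))"
  define m where "m k = (\<lambda>(N, M). ((*\<^sub>v) (P N M) ^^ k) (R N M *\<^sub>v g N) \<bullet>c (R N M *\<^sub>v g N))" for k
  define \<nu> where "\<nu> = (\<lambda>(N, M). mpedmd_measure N (G N M) (Q N M * Vh N M) (lam N M) (G_normalize (G N M) (g N)))"
  have m_lim: "(m k \<longlongrightarrow> cinner ((K ^^ k) u) u) iterated_sequentially" for k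
    unfolding m_def by (rule polar_power_moment_tendsto[OF u(1) g g_lim])
  \<comment> \<open>The normalizing constant is the zeroth unnormalized moment, so it tends to 1. It
    is thus eventually positive, and dividing by it leaves the limits of all moments
    unchanged.\<close>
  have "\<forall>\<^sub>F x in iterated_sequentially. Re (m 0 x) = r x"
    using data_iterated
  proof eventually_elim
    case (elim x)
    obtain N M where x: "x = (N, M)" by (cases x)
    interpret mpedmd_data N "G N M" "A N M" "R N M" "Q N M" "U1 N M" "U2 N M" "Vh N M" "\<sigma> N M" "lam N M"
      using elim x by simp
    show ?case using sqrt_pair_cscalar_prod[OF sqrt_pair] g[of N] elim by (simp add: x m_def r_def)
  qed
  moreover have "((\<lambda>x. Re (m 0 x)) \<longlongrightarrow> 1) iterated_sequentially"
    using tendsto_Re[OF m_lim[of 0]] by (simp add: Re_cinner_self u)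
  ultimately have r_lim: "(r \<longlongrightarrow> 1) iterated_sequentially"
    by (rule Lim_transform_eventually[rotated])
  then have "\<forall>\<^sub>F x in iterated_sequentially. 0 < r x"
    by (rule order_tendstoD) simp
  with data_iterated have \<nu>: "\<forall>\<^sub>F x in iterated_sequentially. (sets (\<nu> x) = sets circle_borel \<and> emeasure (\<nu> x) circle = 1) \<and>
      (\<forall>k. m k x / complex_of_real (r x) = (LINT z|\<nu> x. z ^ k))"
  proof eventually_elim
    case (elim x)
    obtain N M where x: "x = (N, M)" by (cases x)
    interpret mpedmd_data N "G N M" "A N M" "R N M" "Q N M" "U1 N M" "U2 N M" "Vh N M" "\<sigma> N M" "lam N M"
      using elim x by simp
    have c: "g N \<in> carrier_vec N" using g elim x by simp
    have "0 < Re ((G N M *\<^sub>v g N) \<bullet>c g N)" using elim x by (simp add: r_def)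
    note * = normalized_measure_mass[OF c this] normalized_measure_moment[OF c this]
    show ?case by (simp add: x m_def r_def \<nu>_def *)
  qed
  have "\<forall>\<^sub>F x in iterated_sequentially. W1 \<mu> (\<nu> x) \<le> ereal \<epsilon>"
  proof (rule W1_tendsto_0[OF _ \<mu> _ \<epsilon>])
    show "\<forall>\<^sub>F x in iterated_sequentially. sets (\<nu> x) = sets circle_borel \<and> emeasure (\<nu> x) circle = 1"
      using \<nu> by (rule eventually_mono) blast
    fix k
    have "((\<lambda>x. m k x / complex_of_real (r x)) \<longlongrightarrow> cinner ((K ^^ k) u) u / complex_of_real 1) iterated_sequentially"
      by (intro tendsto_intros m_lim r_lim) simp
    then have "((\<lambda>x. m k x / complex_of_real (r x)) \<longlongrightarrow> (LINT z|\<mu>. z ^ k)) iterated_sequentially"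
      by (simp add: moments)
    then show "((\<lambda>x. LINT z|\<nu> x. z ^ k) \<longlongrightarrow> (LINT z|\<mu>. z ^ k)) iterated_sequentially"
      by (rule Lim_transform_eventually) (use \<nu> in \<open>auto elim: eventually_mono\<close>)
  qed
  then show ?thesis by (simp add: eventually_iterated_sequentially \<nu>_def)
qed

section \<open>Square-integrable functions and their embedding\<close>

lemma L2_add: "f \<in> L2 \<omega> \<Longrightarrow> g \<in> L2 \<omega> \<Longrightarrow> (\<lambda>p. f p + g p) \<in> L2 \<omega>"
proof -
  assume f: "f \<in> L2 \<omega>" and g: "g \<in> L2 \<omega>"
  have m: "f \<in> borel_measurable \<omega>" "g \<in> borel_measurable \<omega>"
    and i: "integrable \<omega> (\<lambda>p. (cmod (f p))\<^sup>2)" "integrable \<omega> (\<lambda>p. (cmod (g p))\<^sup>2)"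
    using f g by (auto simp: L2_def)
  have "(cmod (x + y))\<^sup>2 \<le> 2 * (cmod x)\<^sup>2 + 2 * (cmod y)\<^sup>2" for x y
  proof -
    have "(cmod (x + y))\<^sup>2 \<le> (cmod x + cmod y)\<^sup>2"
      by (intro power_mono norm_triangle_ineq) simp
    also have "\<dots> \<le> 2 * (cmod x)\<^sup>2 + 2 * (cmod y)\<^sup>2"
      using sum_squares_bound[of "cmod x" "cmod y"] by (simp add: power2_sum)
    finally show ?thesis .
  qed
  then have "integrable \<omega> (\<lambda>p. (cmod (f p + g p))\<^sup>2)"
    using m by (intro Bochner_Integration.integrable_bound[OF Bochner_Integration.integrable_add[OF
            integrable_mult_right[OF i(1), of 2] integrable_mult_right[OF i(2), of 2]]]) auto
  then show ?thesis using m by (simp add: L2_def)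
qed

lemma L2_scale: "f \<in> L2 \<omega> \<Longrightarrow> (\<lambda>p. c * f p) \<in> L2 \<omega>"
  by (auto simp: L2_def norm_mult power_mult_distrib)

lemma L2_zero: "(\<lambda>p. 0) \<in> L2 \<omega>"
  by (simp add: L2_def)

lemma L2_diff: "f \<in> L2 \<omega> \<Longrightarrow> g \<in> L2 \<omega> \<Longrightarrow> (\<lambda>p. f p - g p) \<in> L2 \<omega>"
  using L2_add[of f \<omega> "\<lambda>p. - 1 * g p"] L2_scale[of g \<omega> "- 1"] by simp

lemma L2_koopman:
  assumes F: "measure_preserving_map \<omega> F" and f: "f \<in> L2 \<omega>"
  shows "koopman F f \<in> L2 \<omega>"
proof -
  have m: "F \<in> measurable \<omega> \<omega>" and d: "distr \<omega> \<omega> F = \<omega>" and fm: "f \<in> borel_measurable \<omega>"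
    and i: "integrable \<omega> (\<lambda>p. (cmod (f p))\<^sup>2)"
    using F f by (auto simp: measure_preserving_map_def L2_def)
  have "integrable (distr \<omega> \<omega> F) (\<lambda>p. (cmod (f p))\<^sup>2)" using i by (simp add: d)
  then have "integrable \<omega> (\<lambda>p. (cmod (f (F p)))\<^sup>2)" by (rule integrable_distr[OF m])
  then show ?thesis using m fm by (simp add: L2_def koopman_def comp_def)
qed

lemma L2_dict_comb:
  "(\<And>j. j < n \<Longrightarrow> \<phi> j \<in> L2 \<omega>) \<Longrightarrow> dict_comb n \<phi> c \<in> L2 \<omega>"
proof (induction n)
  case 0
  then show ?case using L2_zero by (simp add: dict_comb_def[abs_def])
next
  case (Suc n)
  then show ?case
    using L2_add[of "dict_comb n \<phi> c" \<omega> "\<lambda>p. vec_index c n * \<phi> n p"] L2_scale[of "\<phi> n" \<omega> "vec_index c n"]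
    by (simp add: dict_comb_def[abs_def])
qed

lemma L2_norm_nonneg: "0 \<le> L2_norm \<omega> f"
  by (simp add: L2_norm_def)

locale L2_model =
  fixes \<omega> :: "'p measure" and J :: "('p \<Rightarrow> complex) \<Rightarrow> 'h::complex_hilbert"
  assumes embedding: "L2_embedding \<omega> J"
begin

lemma J_add: "f \<in> L2 \<omega> \<Longrightarrow> g \<in> L2 \<omega> \<Longrightarrow> J (\<lambda>p. f p + g p) = J f + J g"
  and J_scale: "f \<in> L2 \<omega> \<Longrightarrow> J (\<lambda>p. c * f p) = scaleC c (J f)"
  and J_cinner: "f \<in> L2 \<omega> \<Longrightarrow> g \<in> L2 \<omega> \<Longrightarrow> cinner (J f) (J g) = L2_inner \<omega> f g"
  and J_closed: "closed (J ` L2 \<omega>)"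
  using embedding by (auto simp: L2_embedding_def)

lemma J_zero: "J (\<lambda>p. 0) = 0"
  using J_scale[OF L2_zero, of 0] by simp

lemma J_diff: "f \<in> L2 \<omega> \<Longrightarrow> g \<in> L2 \<omega> \<Longrightarrow> J (\<lambda>p. f p - g p) = J f - J g"
  using J_add[of f "\<lambda>p. - 1 * g p"] L2_scale[of g \<omega> "- 1"] J_scale[of g "- 1"] by simp

lemma norm_J:
  assumes "f \<in> L2 \<omega>"
  shows "norm (J f) = L2_norm \<omega> f"
proof -
  have "L2_inner \<omega> f f = complex_of_real (LINT p|\<omega>. (cmod (f p))\<^sup>2)"
    unfolding L2_inner_def complex_norm_square[symmetric] by (rule integral_complex_of_real)
  then show ?thesis using J_cinner[OF assms assms] by (simp add: norm_eq_sqrt_cinner L2_norm_def)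
qed

lemma J_dict_comb:
  "(\<And>j. j < n \<Longrightarrow> \<phi> j \<in> L2 \<omega>) \<Longrightarrow> J (dict_comb n \<phi> c) = hcomb n (\<lambda>j. J (\<phi> j)) c"
proof (induction n)
  case 0
  then show ?case using J_zero by (simp add: dict_comb_def[abs_def] hcomb_def)
next
  case (Suc n)
  then show ?case
    using J_add[OF L2_dict_comb[of n \<phi> \<omega> c] L2_scale[of "\<phi> n" \<omega> "vec_index c n"]]
    by (simp add: dict_comb_def[abs_def] hcomb_def J_scale)
qed

lemma J_image_zero: "0 \<in> J ` L2 \<omega>"
  using imageI[OF L2_zero[of \<omega>], of J] by (simp only: J_zero)

lemma J_image_add: "u \<in> J ` L2 \<omega> \<Longrightarrow> v \<in> J ` L2 \<omega> \<Longrightarrow> u + v \<in> J ` L2 \<omega>"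
  by (elim imageE) (simp only: J_add[symmetric], rule imageI, rule L2_add)

lemma J_image_scale: "u \<in> J ` L2 \<omega> \<Longrightarrow> scaleC c u \<in> J ` L2 \<omega>"
  by (elim imageE) (simp only: J_scale[symmetric], rule imageI, rule L2_scale)

text \<open>Compression to a subspace does not alter the quadratic form at its vectors, so the
  scalar measure can be computed in the larger Hilbert space.\<close>

lemma koopman_scalar_measure_eq:
  assumes "g \<in> L2 \<omega>"
  shows "koopman_scalar_measure \<omega> J E' g = scalar_measure E' (J g)"
proof -
  have "cinner (orth_proj (J ` L2 \<omega>) v) (J g) = cinner v (J g)" for v
    by (rule orth_proj_properties(2)[OF J_closed J_image_zero J_image_add J_image_scale imageI[OF assms]])
  then show ?thesis
    by (simp only: koopman_scalar_measure_def scalar_measure_def koopman_spectral_measure_def)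
qed

text \<open>Transfers independence: a combination vanishing in the Hilbert space has L2 norm zero,
  hence vanishes almost everywhere.\<close>

lemma hcomb_eq_0_imp_AE:
  assumes \<phi>: "\<And>j. j < n \<Longrightarrow> \<phi> j \<in> L2 \<omega>" and 0: "hcomb n (\<lambda>j. J (\<phi> j)) c = 0"
  shows "AE p in \<omega>. dict_comb n \<phi> c p = 0"
proof -
  have f: "dict_comb n \<phi> c \<in> L2 \<omega>" by (rule L2_dict_comb[OF \<phi>])
  have "J (dict_comb n \<phi> c) = 0" using J_dict_comb[of n \<phi> c] \<phi> 0 by simp
  then have "L2_norm \<omega> (dict_comb n \<phi> c) = 0" by (simp flip: norm_J[OF f])
  then have int_0: "(LINT p|\<omega>. (cmod (dict_comb n \<phi> c p))\<^sup>2) = 0" by (simp add: L2_norm_def)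
  have int: "integrable \<omega> (\<lambda>p. (cmod (dict_comb n \<phi> c p))\<^sup>2)" using f by (simp add: L2_def)
  have "AE p in \<omega>. (cmod (dict_comb n \<phi> c p))\<^sup>2 = 0"
    by (rule iffD1[OF integral_nonneg_eq_0_iff_AE[OF int] int_0]) simp
  then show ?thesis by simp
qed

lemma hcomb_tendsto:
  assumes \<phi>: "\<And>N j. 1 \<le> N \<Longrightarrow> j < N \<Longrightarrow> \<phi> N j \<in> L2 \<omega>" and h: "h \<in> L2 \<omega>"
    and lim: "(\<lambda>N. L2_norm \<omega> (\<lambda>p. h p - dict_comb N (\<phi> N) (c N) p)) \<longlonglongrightarrow> 0"
  shows "(\<lambda>N. hcomb N (\<lambda>j. J (\<phi> N j)) (c N)) \<longlonglongrightarrow> J h"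
proof -
  have "\<forall>\<^sub>F N in sequentially. L2_norm \<omega> (\<lambda>p. h p - dict_comb N (\<phi> N) (c N) p) =
      dist (hcomb N (\<lambda>j. J (\<phi> N j)) (c N)) (J h)"
    using eventually_ge_at_top[of 1]
  proof eventually_elim
    case (elim N)
    have f: "dict_comb N (\<phi> N) (c N) \<in> L2 \<omega>" by (rule L2_dict_comb) (rule \<phi>[OF elim])
    have "L2_norm \<omega> (\<lambda>p. h p - dict_comb N (\<phi> N) (c N) p) = norm (J h - J (dict_comb N (\<phi> N) (c N)))"
      unfolding J_diff[OF h f, symmetric] by (rule norm_J[OF L2_diff[OF h f], symmetric])
    then show ?case
      using J_dict_comb[of N "\<phi> N" "c N"] \<phi>[OF elim] by (simp add: dist_norm norm_minus_commute)
  qed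
  with lim show ?thesis unfolding tendsto_dist_iff[of _ "J h"] by (rule Lim_transform_eventually)
qed

text \<open>Near-minimizers of the distance suffice; the slack 1/(N + 1) makes the infimum strictly
  exceeded and vanishes in the limit.\<close>

lemma dictionary_approximation:
  assumes \<phi>: "\<And>N j. 1 \<le> N \<Longrightarrow> j < N \<Longrightarrow> \<phi> N j \<in> L2 \<omega>" and h: "h \<in> L2 \<omega>"
    and lim: "(\<lambda>N. L2_dist \<omega> h (dict_span N (\<phi> N))) \<longlonglongrightarrow> 0"
  shows "\<exists>c. (\<forall>N\<ge>1. c N \<in> carrier_vec N) \<and> (\<lambda>N. hcomb N (\<lambda>j. J (\<phi> N j)) (c N)) \<longlonglongrightarrow> J h"
proof -
  define d where "d N = L2_dist \<omega> h (dict_span N (\<phi> N))" for N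
  have "\<exists>c\<in>carrier_vec N. L2_norm \<omega> (\<lambda>p. h p - dict_comb N (\<phi> N) c p) < d N + inverse (real (Suc N))" for N
  proof -
    have ne: "dict_span N (\<phi> N) \<noteq> {}"
      unfolding dict_span_def using zero_carrier_vec[of N] by blast
    have bdd: "bdd_below ((\<lambda>f. L2_norm \<omega> (\<lambda>p. h p - f p)) ` dict_span N (\<phi> N))"
      by (rule bdd_belowI[of _ 0]) (auto simp: L2_norm_nonneg)
    have "(INF f\<in>dict_span N (\<phi> N). L2_norm \<omega> (\<lambda>p. h p - f p)) < d N + inverse (real (Suc N))"
      by (simp add: d_def L2_dist_def)
    then show ?thesis unfolding cINF_less_iff[OF ne bdd] by (auto simp: dict_span_def)
  qed
  then obtain c where c: "\<And>N. c N \<in> carrier_vec N"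
    "\<And>N. L2_norm \<omega> (\<lambda>p. h p - dict_comb N (\<phi> N) (c N) p) < d N + inverse (real (Suc N))"
    by metis
  have "(\<lambda>N. L2_norm \<omega> (\<lambda>p. h p - dict_comb N (\<phi> N) (c N) p)) \<longlonglongrightarrow> 0"
  proof (rule tendsto_sandwich[OF _ _ tendsto_const])
    show "(\<lambda>N. d N + inverse (real (Suc N))) \<longlonglongrightarrow> 0"
      using tendsto_add[OF lim LIMSEQ_inverse_real_of_nat] by (simp add: d_def)
    show "\<forall>\<^sub>F N in sequentially. L2_norm \<omega> (\<lambda>p. h p - dict_comb N (\<phi> N) (c N) p) \<le> d N + inverse (real (Suc N))"
      using c(2) by (simp add: less_imp_le)
  qed (simp add: L2_norm_nonneg)
  from hcomb_tendsto[OF \<phi> h this] c(1) show ?thesis by blast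
qed

end

lemma edmd_carrier: "edmd_G N M \<phi> x w \<in> carrier_mat N N" "edmd_A N M \<phi> F x w \<in> carrier_mat N N"
proof -
  have d: "data_mat N M \<phi> y \<in> carrier_mat M N" for y by (simp add: data_mat_def)
  have "weight_mat M w \<in> carrier_mat M M" by (simp add: weight_mat_def)
  then show "edmd_G N M \<phi> x w \<in> carrier_mat N N" "edmd_A N M \<phi> F x w \<in> carrier_mat N N"
    unfolding edmd_G_def edmd_A_def
    by (auto intro!: mult_carrier_mat[of _ N M] mat_adjoint_carrier d)
qed

text \<open>An eventual bound in \<open>M\<close> passes to the limit superior, and nonnegativity
  supplies the lower half of convergence to 0.\<close>

lemma limsup_tendsto_0_ereal:
  fixes f :: "nat \<Rightarrow> nat \<Rightarrow> ereal"
  assumes nonneg: "\<And>N M. 0 \<le> f N M"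
    and small: "\<And>\<epsilon>. 0 < \<epsilon> \<Longrightarrow> \<forall>\<^sub>F N in sequentially. \<forall>\<^sub>F M in sequentially. f N M \<le> ereal \<epsilon>"
  shows "(\<lambda>N. limsup (f N)) \<longlonglongrightarrow> 0"
proof (rule order_tendstoI)
  fix a :: ereal assume "a < 0"
  moreover have "0 \<le> limsup (f N)" for N
    by (rule le_Limsup) (simp_all add: nonneg)
  ultimately show "\<forall>\<^sub>F N in sequentially. a < limsup (f N)"
    by (intro always_eventually allI) (rule less_le_trans)
next
  fix a :: ereal assume "0 < a"
  \<comment> \<open>A real number strictly between 0 and \<open>a\<close> recovers the strict
    inequality, since the limit superior only inherits a non-strict one.\<close>
  then obtain \<epsilon> where \<epsilon>: "0 < ereal \<epsilon>" "ereal \<epsilon> < a" using ereal_dense2 by blast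
  then have "0 < \<epsilon>" by simp
  from small[OF this] show "\<forall>\<^sub>F N in sequentially. limsup (f N) < a"
  proof eventually_elim
    case (elim N)
    then have "limsup (f N) \<le> ereal \<epsilon>" by (rule Limsup_bounded)
    then show ?case using \<epsilon>(2) by simp
  qed
qed

section \<open>Transfer of the Hilbert space result to the Koopman operator\<close>

theorem corollary5p6:
  fixes \<Omega> :: "(real ^ 'd) set"
    and \<omega> :: "(real ^ 'd) measure"
    and F :: "real ^ 'd \<Rightarrow> real ^ 'd"
    and J :: "(real ^ 'd \<Rightarrow> complex) \<Rightarrow> 'h::complex_hilbert"
    and K' :: "'h \<Rightarrow> 'h"
    and E' :: "complex set \<Rightarrow> 'h \<Rightarrow> 'h"
    and \<psi> :: "nat \<Rightarrow> nat \<Rightarrow> real ^ 'd \<Rightarrow> complex"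
    and x :: "nat \<Rightarrow> nat \<Rightarrow> real ^ 'd"
    and w :: "nat \<Rightarrow> nat \<Rightarrow> real"
    and G A R Q U1 U2 Vh :: "nat \<Rightarrow> nat \<Rightarrow> complex mat"
    and \<sigma> :: "nat \<Rightarrow> nat \<Rightarrow> nat \<Rightarrow> real"
    and lam :: "nat \<Rightarrow> nat \<Rightarrow> nat \<Rightarrow> complex"
    and g :: "real ^ 'd \<Rightarrow> complex"
    and gN :: "nat \<Rightarrow> complex Matrix.vec"
  assumes "space \<omega> = \<Omega>"
    and "measure_preserving_map \<omega> F"
    and "unitary_extension \<omega> F J K'"
    and "spectral_measure_of K' E'"
    and "\<forall>N\<ge>1. \<forall>j<N. \<psi> N j \<in> L2 \<omega>"
    and "\<forall>N\<ge>1. L2_independent \<omega> N (\<psi> N)"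
    and "\<forall>M. \<forall>m<M. x M m \<in> \<Omega>"
    and "\<forall>M. \<forall>m<M. 0 \<le> w M m"
    and "\<forall>N M. G N M = edmd_G N M (\<psi> N) (x M) (w M)"
    and "\<forall>N M. A N M = edmd_A N M (\<psi> N) F (x M) (w M)"
    and "\<forall>N\<ge>1. \<forall>\<^sub>F M in sequentially. invertible_mat (G N M)"
    and "\<forall>N\<ge>1. \<forall>M. invertible_mat (G N M) \<longrightarrow>
           mpedmd_factors N (G N M) (A N M) (R N M) (Q N M) (U1 N M) (\<sigma> N M) (U2 N M) (Vh N M) (lam N M)"
    and "\<forall>h\<in>L2 \<omega>. (\<lambda>N. L2_dist \<omega> h (dict_span N (\<psi> N))) \<longlonglongrightarrow> 0"
    and "\<forall>N\<ge>1. \<forall>j<N. \<forall>k<N.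
           (\<lambda>M. G N M $$ (j, k)) \<longlonglongrightarrow> L2_inner \<omega> (\<psi> N k) (\<psi> N j)"
    and "\<forall>N\<ge>1. \<forall>j<N. \<forall>k<N.
           (\<lambda>M. A N M $$ (j, k)) \<longlonglongrightarrow> L2_inner \<omega> (koopman F (\<psi> N k)) (\<psi> N j)"
    and "g \<in> L2 \<omega>" and "L2_norm \<omega> g = 1"
    and "\<forall>N\<ge>1. gN N \<in> carrier_vec N"
    and "(\<lambda>N. L2_norm \<omega> (\<lambda>p. g p - dict_comb N (\<psi> N) (gN N) p)) \<longlonglongrightarrow> 0"
  shows "(\<lambda>N. limsup (\<lambda>M. W1 (koopman_scalar_measure \<omega> J E' g)
                 (mpedmd_measure N (G N M) (Q N M * Vh N M) (lam N M)
                   (G_normalize (G N M) (gN N))))) \<longlonglongrightarrow> 0"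
proof (rule limsup_tendsto_0_ereal)
  fix \<epsilon> :: real assume \<epsilon>: "0 < \<epsilon>"
  have embedding: "L2_embedding \<omega> J" and unitary: "unitary_op K'"
    and extends: "\<And>f. f \<in> L2 \<omega> \<Longrightarrow> K' (J f) = J (koopman F f)"
    using assms(3) by (auto simp: unitary_extension_def)
  interpret L2_model \<omega> J by unfold_locales (rule embedding)
  interpret unitary_spectral E' K'
    using assms(4) unitary by unfold_locales (auto simp: spectral_measure_of_def)
  have \<psi>: "\<psi> N j \<in> L2 \<omega>" if "1 \<le> N" "j < N" for N j using assms(5) that by blast
  \<comment> \<open>The unitary extension serves as the isometry, since on the image of L2 it
    coincides with the embedded Koopman operator and leaves that image invariant.\<close>
  interpret mpedmd_limit K' "J ` L2 \<omega>" "\<lambda>N j. J (\<psi> N j)" G A R Q U1 U2 Vh \<sigma> lam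
  proof
    show "clinear_op K'" using unitary by (simp add: unitary_op_def)
    show "norm (K' u) = norm u" for u by (rule norm_K)
    show "K' u \<in> J ` L2 \<omega>" if "u \<in> J ` L2 \<omega>" for u
      using that extends L2_koopman[OF assms(2)] by auto
    show "\<exists>c. (\<forall>N\<ge>1. c N \<in> carrier_vec N) \<and> (\<lambda>N. hcomb N (\<lambda>j. J (\<psi> N j)) (c N)) \<longlonglongrightarrow> u"
      if "u \<in> J ` L2 \<omega>" for u
      using that assms(13) dictionary_approximation[of \<psi>] \<psi> by blast
    show "c = 0\<^sub>v N" if "1 \<le> N" "c \<in> carrier_vec N" "hcomb N (\<lambda>j. J (\<psi> N j)) c = 0" for N c
      using assms(6) that hcomb_eq_0_imp_AE[of N "\<psi> N" c] \<psi> unfolding L2_independent_def by blast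
    show "G N M \<in> carrier_mat N N" "A N M \<in> carrier_mat N N" for N M
      using assms(9,10) by (simp_all add: edmd_carrier)
    show "\<forall>\<^sub>F M in sequentially.
        mpedmd_factors N (G N M) (A N M) (R N M) (Q N M) (U1 N M) (\<sigma> N M) (U2 N M) (Vh N M) (lam N M)"
      if "1 \<le> N" for N
    proof -
      have "\<forall>\<^sub>F M in sequentially. invertible_mat (G N M)" using assms(11) that by blast
      then show ?thesis by (rule eventually_mono) (use assms(12) that in blast)
    qed
    show "(\<lambda>M. G N M $$ (i, j)) \<longlonglongrightarrow> cinner (J (\<psi> N j)) (J (\<psi> N i))"
      "(\<lambda>M. A N M $$ (i, j)) \<longlonglongrightarrow> cinner (K' (J (\<psi> N j))) (J (\<psi> N i))"
      if "1 \<le> N" "i < N" "j < N" for N i j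
      using assms(14,15) that by (simp_all add: J_cinner extends \<psi> L2_koopman[OF assms(2)])
  qed
  have norm_g: "norm (J g) = 1" using norm_J[OF assms(16)] assms(17) by simp
  have gN: "\<And>N. 1 \<le> N \<Longrightarrow> gN N \<in> carrier_vec N" using assms(18) by blast
  show "\<forall>\<^sub>F N in sequentially. \<forall>\<^sub>F M in sequentially.
      W1 (koopman_scalar_measure \<omega> J E' g)
        (mpedmd_measure N (G N M) (Q N M * Vh N M) (lam N M) (G_normalize (G N M) (gN N))) \<le> ereal \<epsilon>"
    unfolding koopman_scalar_measure_eq[OF assms(16)]
  proof (rule mpedmd_measure_converges[OF _ _ moment_eq _ norm_g gN _ \<epsilon>])
    show "emeasure (scalar_measure E' (J g)) circle = 1"
      by (simp add: emeasure_scalar_measure_circle norm_g)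
    show "J g \<in> J ` L2 \<omega>" using assms(16) by blast
    show "(\<lambda>N. comb N (gN N)) \<longlonglongrightarrow> J g"
      by (rule hcomb_tendsto[OF \<psi> assms(16,19)])
  qed (rule scalar_measure_sets)
qed (rule W1_nonneg)

end
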